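(* For every $r$ with $|r|<1$ and $\eta$ with $\mathrm{Re}(\eta)\ge0$ there exist column vectors $C_1^w(r,\eta),\ldots,C_N^w(r,\eta)\in\mathbb{C}^N$ such that, with $$K(r,s,\eta)=r\Lambda\big(M^T(\eta-s)\big)^{-1}B^*(s),\qquad L^w(r,s,\eta)=re^{-sw}\widehat p+\frac{1}{\prod_{j=1}^N(s-\mu_j(\eta))}\sum_{l=1}^Ns^lC_l^w(r,\eta),$$ one has $$\tilde Z^w(r,s,\eta)=K(r,s,\eta)\tilde Z^w(r,as,\eta)+L^w(r,s,\eta)\qquad\text{and}\qquad \tilde Z^w(r,s,\eta)=\sum_{n=0}^\infty\prod_{m=0}^{n-1}K(r,a^ms,\eta)\,L^w(r,a^ns,\eta)$$ for all $s$ with $\mathrm{Re}(s)\ge0$ such that $a^ns\notin\{\mu_1(\eta),\ldots,\mu_N(\eta)\}$ for all $n\ge0$.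
   Context: Let $E=\{1,\ldots,N\}$, $a\in(0,1)$. $\{X(t);t\ge0\}$ is a continuous-time Markov chain on $E$ with infinitesimal generator $Q=(q_{i,j})$ and a stationary distribution. Customers arrive at epochs $0=T_1<T_2<\cdots$; while $X(t)=i$, arrivals occur according to a Poisson process with rate $\lambda_i>0$, and a customer arriving while $X(t)=i$ has a service time with distribution function $B_i$ on $[0,\infty)$ and Laplace–Stieltjes transform (LST) $\beta_i^*$. Given the background process, the service times $S_1,S_2,\ldots$ are independent and independent of the arrival process. Put $A_n=T_n-T_{n-1}$ ($n\ge2$), $Y_n=X_{T_n}$ ($n\ge1$). The workload just before the $n$th arrival satisfies $W_{n+1}=[aW_n+S_n-A_{n+1}]^+$, $n\ge1$, with $W_1=w\ge0$, $[x]^+=\max(0,x)$. Notation: $\Lambda=\mathrm{diag}(\lambda_1,\ldots,\lambda_N)$, $M(s)=sI+\Lambda-Q$, $B^*(s)=\mathrm{diag}(\beta_1^*(s),\ldots,\beta_N^*(s))$, $\widehat p=(p_1,\ldots,p_N)^T$ with $p_j=P(X_0=j)$, $\tilde Z^w=(Z_1^w,\ldots,Z_N^w)^T$ with $$Z_j^w(r,s,\eta)=\sum_{n=1}^\infty r^nE\big(e^{-sW_n-\eta T_n}1_{\{Y_n=j\}}\mid W_1=w\big).$$ $\mu_1(\eta),\ldots,\mu_N(\eta)$ are the $N$ zeros in $s$ (with multiplicity) of $\det((\eta-s)I+\Lambda-Q^T)$. Matrix products are ordered with increasing index from left to right; empty products are the identity. *)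

theory Defs
  imports "HOL-Probability.Probability" "HOL-Computational_Algebra.Polynomial"
begin

text \<open>
  The state space \<open>E = {1,\<dots>,N}\<close> is a type \<open>'n\<close> of class \<open>finite\<close>, with \<open>N = CARD('n)\<close>.
  Sequences that start at index 1 (\<open>T\<close>, \<open>S\<close>, \<open>W\<close>, \<open>\<mu>\<close>, \<open>C\<close>) are functions on \<open>nat\<close>
  whose value at 0 is never used.
\<close>

subsection \<open>The background process\<close>

definition transition_semigroup :: "(real \<Rightarrow> real^'n^'n) \<Rightarrow> bool" where
  "transition_semigroup P \<longleftrightarrow>
     (\<forall>t\<ge>0. (\<forall>i j. 0 \<le> P t $ i $ j) \<and> (\<forall>i. (\<Sum>j\<in>UNIV. P t $ i $ j) = 1)) \<and>
     P 0 = mat 1 \<and>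
     (\<forall>s\<ge>0. \<forall>t\<ge>0. P (s + t) = P s ** P t)"

definition has_generator :: "(real \<Rightarrow> real^'n^'n) \<Rightarrow> real^'n^'n \<Rightarrow> bool" where
  "has_generator P Q \<longleftrightarrow> ((\<lambda>h. (1 / h) *\<^sub>R (P h - mat 1)) \<longlongrightarrow> Q) (at_right 0)"

definition stationary_distribution :: "(real \<Rightarrow> real^'n^'n) \<Rightarrow> real^'n \<Rightarrow> bool" where
  "stationary_distribution P \<pi> \<longleftrightarrow>
     (\<forall>i. 0 \<le> \<pi> $ i) \<and> (\<Sum>i\<in>UNIV. \<pi> $ i) = 1 \<and> (\<forall>t\<ge>0. \<pi> v* P t = \<pi>)"

definition history :: "'w measure \<Rightarrow> (real \<Rightarrow> 'w \<Rightarrow> 'n) \<Rightarrow> real \<Rightarrow> 'w measure" where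
  "history M X t = sigma (space M) {{\<omega>\<in>space M. X u \<omega> = i} | u i. 0 \<le> u \<and> u \<le> t}"

definition background :: "'w measure \<Rightarrow> (real \<Rightarrow> 'w \<Rightarrow> 'n) \<Rightarrow> 'w measure" where
  "background M X = sigma (space M) {{\<omega>\<in>space M. X u \<omega> = i} | u i. 0 \<le> u}"

definition background_arrivals ::
  "'w measure \<Rightarrow> (real \<Rightarrow> 'w \<Rightarrow> 'n) \<Rightarrow> (nat \<Rightarrow> 'w \<Rightarrow> real) \<Rightarrow> 'w measure" where
  "background_arrivals M X T = sigma (space M)
     ({{\<omega>\<in>space M. X u \<omega> = i} | u i. 0 \<le> u} \<union> {{\<omega>\<in>space M. T n \<omega> \<le> c} | n c. 1 \<le> n})"

text \<open>
  \<open>X\<close> is a Markov chain (with right-continuous paths in the discrete space \<open>'n\<close> and arbitrary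
  initial law) whose transition semigroup has generator \<open>Q\<close> and a stationary distribution.
\<close>

definition ctmc :: "'w measure \<Rightarrow> (real \<Rightarrow> 'w \<Rightarrow> 'n::finite) \<Rightarrow> real^'n^'n \<Rightarrow> bool" where
  "ctmc M X Q \<longleftrightarrow>
     (\<forall>t\<ge>0. X t \<in> measurable M (count_space UNIV)) \<and>
     (\<forall>\<omega>\<in>space M. \<forall>t\<ge>0. \<forall>\<^sub>F u in at_right t. X u \<omega> = X t \<omega>) \<and>
     (\<exists>P. transition_semigroup P \<and> has_generator P Q \<and> (\<exists>\<pi>. stationary_distribution P \<pi>) \<and>
        (\<forall>t\<ge>0. \<forall>h\<ge>0. \<forall>j. AE \<omega> in M.
           real_cond_exp M (history M X t) (indicator {\<omega>\<in>space M. X (t + h) \<omega> = j}) \<omega>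
             = P h $ X t \<omega> $ j))"

subsection \<open>Arrivals and services\<close>

text \<open>
  Infinite sets have \<open>card\<close> 0, so counting events ask for finiteness explicitly.
\<close>

definition arrivals_in :: "(nat \<Rightarrow> 'w \<Rightarrow> real) \<Rightarrow> real \<Rightarrow> real \<Rightarrow> 'w \<Rightarrow> nat set" where
  "arrivals_in T u v \<omega> = {n. 1 \<le> n \<and> u < T n \<omega> \<and> T n \<omega> \<le> v}"

text \<open>
  Arrivals at rate \<open>lam i\<close> while the background is in state \<open>i\<close>: given the whole background
  path, the epochs after \<open>T\<^sub>1 = 0\<close> form a Poisson process with intensity \<open>lam (X u)\<close>, that is,
  the counts in successive intervals are independent Poisson variables whose means are the
  integrals of the intensity.
\<close>

definition modulated_poisson_arrivals ::
  "'w measure \<Rightarrow> (real \<Rightarrow> 'w \<Rightarrow> 'n) \<Rightarrow> ('n \<Rightarrow> real) \<Rightarrow> (nat \<Rightarrow> 'w \<Rightarrow> real) \<Rightarrow> bool" where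
  "modulated_poisson_arrivals M X lam T \<longleftrightarrow>
     (\<forall>n\<ge>1. T n \<in> borel_measurable M) \<and>
     (\<forall>\<omega>\<in>space M. T 1 \<omega> = 0 \<and> (\<forall>n\<ge>1. T n \<omega> < T (Suc n) \<omega>)) \<and>
     (\<forall>k (t :: nat \<Rightarrow> real) m. 0 \<le> t 0 \<and> (\<forall>i<k. t i < t (Suc i)) \<longrightarrow>
        (AE \<omega> in M.
           real_cond_exp M (background M X)
             (indicator {\<omega>\<in>space M. \<forall>i<k. finite (arrivals_in T (t i) (t (Suc i)) \<omega>) \<and>
                                          card (arrivals_in T (t i) (t (Suc i)) \<omega>) = m i}) \<omega>
           = (\<Prod>i<k. pmf (poisson_pmf (LINT u:{t i..t (Suc i)}|lborel. lam (X u \<omega>))) (m i))))"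

definition arrival_state :: "(real \<Rightarrow> 'w \<Rightarrow> 'n) \<Rightarrow> (nat \<Rightarrow> 'w \<Rightarrow> real) \<Rightarrow> nat \<Rightarrow> 'w \<Rightarrow> 'n" where
  "arrival_state X T n \<omega> = X (T n \<omega>) \<omega>"

text \<open>
  The distribution function of customers arriving in state \<open>i\<close> is \<open>cdf (B i)\<close>.  Conditionally
  on the background process and the arrival epochs, the service times are independent, and the
  law of the \<open>n\<close>th one depends only on the background state at the \<open>n\<close>th arrival.
\<close>

definition service_law :: "real measure \<Rightarrow> bool" where
  "service_law D \<longleftrightarrow> real_distribution D \<and> (\<forall>x<0. cdf D x = 0)"

definition modulated_services ::
  "'w measure \<Rightarrow> (real \<Rightarrow> 'w \<Rightarrow> 'n) \<Rightarrow> (nat \<Rightarrow> 'w \<Rightarrow> real) \<Rightarrow> ('n \<Rightarrow> real measure) \<Rightarrow>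
   (nat \<Rightarrow> 'w \<Rightarrow> real) \<Rightarrow> bool" where
  "modulated_services M X T B S \<longleftrightarrow>
     (\<forall>n\<ge>1. S n \<in> borel_measurable M) \<and>
     (\<forall>n (x :: nat \<Rightarrow> real). AE \<omega> in M.
        real_cond_exp M (background_arrivals M X T)
          (indicator {\<omega>\<in>space M. \<forall>k\<in>{1..n}. S k \<omega> \<le> x k}) \<omega>
        = (\<Prod>k=1..n. cdf (B (arrival_state X T k \<omega>)) (x k)))"

definition LST :: "real measure \<Rightarrow> complex \<Rightarrow> complex" where
  "LST D s = (LINT x|D. exp (- s * of_real x))"

subsection \<open>Workload and transforms\<close>

fun workload ::
  "real \<Rightarrow> real \<Rightarrow> (nat \<Rightarrow> 'w \<Rightarrow> real) \<Rightarrow> (nat \<Rightarrow> 'w \<Rightarrow> real) \<Rightarrow> nat \<Rightarrow> 'w \<Rightarrow> real" where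
  "workload a w T S 0 \<omega> = w"
| "workload a w T S (Suc 0) \<omega> = w"
| "workload a w T S (Suc (Suc n)) \<omega> =
     max 0 (a * workload a w T S (Suc n) \<omega> + S (Suc n) \<omega>
            - (T (Suc (Suc n)) \<omega> - T (Suc n) \<omega>))"

definition Zvec ::
  "'w measure \<Rightarrow> (real \<Rightarrow> 'w \<Rightarrow> 'n::finite) \<Rightarrow> (nat \<Rightarrow> 'w \<Rightarrow> real) \<Rightarrow> (nat \<Rightarrow> 'w \<Rightarrow> real) \<Rightarrow>
   real \<Rightarrow> real \<Rightarrow> complex \<Rightarrow> complex \<Rightarrow> complex \<Rightarrow> complex^'n" where
  "Zvec M X T S a w r s \<eta> = (\<chi> j. \<Sum>n. r ^ Suc n *
     (LINT \<omega>|M. exp (- s * of_real (workload a w T S (Suc n) \<omega>) - \<eta> * of_real (T (Suc n) \<omega>))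
                 * indicator {\<omega>. arrival_state X T (Suc n) \<omega> = j} \<omega>))"

definition initial_vec :: "'w measure \<Rightarrow> (real \<Rightarrow> 'w \<Rightarrow> 'n::finite) \<Rightarrow> complex^'n" where
  "initial_vec M X = (\<chi> j. of_real (measure M {\<omega>\<in>space M. X 0 \<omega> = j}))"

definition diag :: "('n::finite \<Rightarrow> 'a::zero) \<Rightarrow> 'a^'n^'n" where
  "diag d = (\<chi> i j. if i = j then d i else 0)"

definition Lam :: "('n::finite \<Rightarrow> real) \<Rightarrow> complex^'n^'n" where
  "Lam lam = diag (\<lambda>i. of_real (lam i))"

definition Mmat :: "real^'n^'n \<Rightarrow> ('n::finite \<Rightarrow> real) \<Rightarrow> complex \<Rightarrow> complex^'n^'n" where
  "Mmat Q lam s = mat s + Lam lam - map_matrix of_real Q"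

definition Bstar :: "('n::finite \<Rightarrow> real measure) \<Rightarrow> complex \<Rightarrow> complex^'n^'n" where
  "Bstar B s = diag (\<lambda>i. LST (B i) s)"

text \<open>
  The determinant of \<open>(\<eta> - s) I + \<Lambda> - Q\<^sup>T\<close> as a polynomial in \<open>s\<close>; \<open>[:\<eta>, -1:]\<close> is \<open>\<eta> - s\<close>.
\<close>

definition det_poly :: "real^'n^'n \<Rightarrow> ('n::finite \<Rightarrow> real) \<Rightarrow> complex \<Rightarrow> complex poly" where
  "det_poly Q lam \<eta> =
     det (mat [:\<eta>, -1:] + diag (\<lambda>i. [:of_real (lam i):])
          - map_matrix (\<lambda>q. [:of_real q:]) (transpose Q))"

definition enumerates_zeros ::
  "real^'n^'n \<Rightarrow> ('n::finite \<Rightarrow> real) \<Rightarrow> complex \<Rightarrow> (nat \<Rightarrow> complex) \<Rightarrow> bool" where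
  "enumerates_zeros Q lam \<eta> z \<longleftrightarrow>
     image_mset z (mset_set {1..CARD('n)}) = proots (det_poly Q lam \<eta>)"

definition Kmat ::
  "real^'n^'n \<Rightarrow> ('n::finite \<Rightarrow> real) \<Rightarrow> ('n \<Rightarrow> real measure) \<Rightarrow>
   complex \<Rightarrow> complex \<Rightarrow> complex \<Rightarrow> complex^'n^'n" where
  "Kmat Q lam B r s \<eta> =
     mat r ** Lam lam ** matrix_inv (transpose (Mmat Q lam (\<eta> - s))) ** Bstar B s"

text \<open>
  Here \<open>z\<close> enumerates the zeros, and \<open>C\<close> the coefficient vectors, for the given \<open>\<eta>\<close> and \<open>r\<close>.
\<close>

definition Lvec ::
  "complex^'n \<Rightarrow> (nat \<Rightarrow> complex) \<Rightarrow> (nat \<Rightarrow> complex^'n::finite) \<Rightarrow> real \<Rightarrow>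
   complex \<Rightarrow> complex \<Rightarrow> complex^'n" where
  "Lvec p z C w r s =
     (r * exp (- s * of_real w)) *s p
     + (1 / (\<Prod>j=1..CARD('n). (s - z j))) *s (\<Sum>l=1..CARD('n). s ^ l *s C l)"

text \<open>The product \<open>F 0 ** F 1 ** \<dots> ** F (n - 1)\<close>, in this order.\<close>

primrec ordered_prod :: "(nat \<Rightarrow> 'a::semiring_1^'n^'n) \<Rightarrow> nat \<Rightarrow> 'a^'n::finite^'n" where
  "ordered_prod F 0 = mat 1"
| "ordered_prod F (Suc n) = ordered_prod F n ** F n"

end

theory Submission
  imports Defs "HOL-Computational_Algebra.Fundamental_Theorem_Algebra"
begin

text \<open>
The recursion is a one-step analysis between two successive arrivals.  Let \<open>z\<^sub>n(s)\<close>
(\<open>pre_transform\<close>) be the row vector of transforms of \<open>(W\<^sub>n, T\<^sub>n)\<close> on the events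
\<open>Y\<^sub>n = j\<close>, and let \<open>u\<^sub>n(s)\<close> (\<open>post_transform\<close>) be the same with \<open>W\<^sub>n\<close> replaced
by \<open>a W\<^sub>n + S\<^sub>n\<close>, the workload just after the arrival.  Up to the next arrival the
workload decreases at unit speed until it reaches 0, the background moves with generator
\<open>Q\<close>, and an arrival occurs at rate \<open>lam\<close>.  Following \<open>exp (- s V(t) - \<eta> t)\<close> along this
evolution and integrating over the whole interval between two arrivals gives the identity
\<open>balance\<close>,
\<open>z\<^sub>n\<^sub>+\<^sub>1(s) \<Lambda>\<^sup>-\<^sup>1 M(\<eta> - s) = u\<^sub>n(s) - s \<kappa>\<^sub>n\<close>,
where \<open>\<kappa>\<^sub>n\<close> is the discounted expected time that the server spends idle in that
interval, by the state of the background.  The point is that \<open>\<kappa>\<^sub>n\<close> does not depend on \<open>s\<close>.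

Since the service time depends on the past only through \<open>Y\<^sub>n\<close>, one has
\<open>u\<^sub>n(s) = z\<^sub>n(a s) B\<^sup>*(s)\<close> (\<open>post_transform_eq\<close>).  Summing the balance with the weights
\<open>r ^ (n + 1)\<close> and inverting \<open>M\<^sup>T(\<eta> - s)\<close> yields the functional equation with the
inhomogeneous term \<open>r exp (- s w) p - s \<Lambda> M\<^sup>T(\<eta> - s)\<^sup>-\<^sup>1 \<kappa>\<close>.  By Cramer's rule the components
of \<open>M\<^sup>T(\<eta> - s)\<^sup>-\<^sup>1 \<kappa>\<close> are polynomials in \<open>s\<close> of degree below \<open>N\<close>, divided by the
determinant, which is a constant multiple of \<open>\<Prod>(s - \<mu>\<^sub>j)\<close>; this is the asserted form of
\<open>L\<close> (\<open>functional_equation\<close>).  The iteration converges because near \<open>s = 0\<close> the matrix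
\<open>K(r, s, \<eta>)\<close> contracts the \<open>l\<^sup>1\<close> norm by the factor \<open>\<bar>r\<bar> / (1 - Re s / min lam)\<close>, which
is a consequence of the vanishing row sums of \<open>Q\<close> (\<open>resolvent_contraction\<close>), while the
transform vector is bounded on the right half plane (\<open>iterated_solution\<close>).

The probabilistic core is the balance.  Time is cut into cells of length \<open>h\<close>.  Given all that
is known at time \<open>t\<close>, including the services of the customers already present, the next cell
contains no arrival and ends in \<open>j\<close> with probability \<open>\<delta>\<^sub>i\<^sub>j + h (Q - \<Lambda>)\<^sub>i\<^sub>j + o(h)\<close>, and it
contains exactly one arrival with probability \<open>h \<Lambda>\<^sub>i\<^sub>j + o(h)\<close>, uniformly in \<open>t\<close>
(\<open>one_step\<close>).  This rests on the conditional independence of past and future given \<open>X t\<close>,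
obtained in three stages: for the chain alone, with \<open>\<integral> lam (X u) du\<close> as a limit of Riemann sums
(\<open>markov_future\<close>); for the chain with its arrivals, whose counts in disjoint intervals are
independent given the path (\<open>orth_past\<close>); and finally with the service times
(\<open>one_step_exact\<close>).  Telescoping over the cells between two arrivals and letting \<open>h\<close> tend to
0 by dominated convergence gives the balance, without solving for the law of the interarrival
times.
\<close>

section \<open>Functions orthogonal to a sigma-algebra\<close>

text \<open>
Conditional independence statements are expressed by orthogonality of a suitable function to a
sigma-algebra.  Unlike the equivalent statement that a conditional expectation vanishes, this
form is accessible to Dynkin's lemma, and it needs no division by the probability of the
conditioning event.
\<close>

definition orth :: "'w measure \<Rightarrow> 'w set set \<Rightarrow> ('w \<Rightarrow> real) \<Rightarrow> bool" where
  "orth M \<G> D \<longleftrightarrow> (\<forall>G\<in>\<G>. (LINT \<omega>|M. indicator G \<omega> * D \<omega>) = 0)"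

lemma orth_sigma_sets:
  assumes D: "integrable M D" "(LINT \<omega>|M. D \<omega>) = 0"
    and G: "\<G> \<subseteq> sets M" "Int_stable \<G>" "orth M \<G> D"
  shows "orth M (sigma_sets (space M) \<G>) D"
  unfolding orth_def
proof
  fix A assume A: "A \<in> sigma_sets (space M) \<G>"
  have sub: "sigma_sets (space M) \<G> \<subseteq> sets M" using G(1) by (rule sets.sigma_sets_subset)
  have int: "integrable M (\<lambda>\<omega>. indicator A \<omega> * D \<omega>)" if "A \<in> sets M" for A
    using integrable_mult_indicator[OF that D(1)] by simp
  have GP: "\<G> \<subseteq> Pow (space M)" using G(1) sets.sets_into_space by auto
  show "(LINT \<omega>|M. indicator A \<omega> * D \<omega>) = 0"
    using G(2) GP A
  proof (induction rule: sigma_sets_induct_disjoint)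
    case (basic A) then show ?case using G(3) by (auto simp: orth_def)
  next
    case empty then show ?case by simp
  next
    case (compl A)
    have "(LINT \<omega>|M. indicator (space M - A) \<omega> * D \<omega>)
        = (LINT \<omega>|M. D \<omega> - indicator A \<omega> * D \<omega>)"
      by (rule Bochner_Integration.integral_cong) (auto simp: indicator_def)
    also have "\<dots> = 0" using compl sub int D by (subst Bochner_Integration.integral_diff) auto
    finally show ?case .
  next
    case (union A)
    have AM: "A i \<in> sets M" for i using union(2) sub by auto
    have "(LINT \<omega>:(\<Union>i. A i)|M. D \<omega>) = (\<Sum>i. (LINT \<omega>:(A i)|M. D \<omega>))"
      using union(1) AM int[of "\<Union>i. A i"] by (intro lebesgue_integral_countable_add)
        (auto simp: disjoint_family_on_def set_integrable_def)
    then show ?case using union by (simp add: set_lebesgue_integral_def)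
  qed
qed

context prob_space
begin

lemma integrable_bounded:
  fixes f :: "'a \<Rightarrow> 'b::{banach, second_countable_topology}"
  assumes "f \<in> borel_measurable M" "\<And>\<omega>. \<omega> \<in> space M \<Longrightarrow> norm (f \<omega>) \<le> C"
  shows "integrable M f"
  using assms by (intro integrable_const_bound[where B=C]) auto

lemma norm_expectation_le:
  fixes f :: "'a \<Rightarrow> 'b::{banach, second_countable_topology}"
  assumes "f \<in> borel_measurable M" "\<And>\<omega>. \<omega> \<in> space M \<Longrightarrow> norm (f \<omega>) \<le> C"
  shows "norm (LINT \<omega>|M. f \<omega>) \<le> C"
proof -
  have "norm (LINT \<omega>|M. f \<omega>) \<le> (LINT \<omega>|M. norm (f \<omega>))" by (rule integral_norm_bound)
  also have "\<dots> \<le> (LINT \<omega>|M. C)"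
    using assms integrable_bounded[OF assms] by (intro integral_mono) auto
  finally show ?thesis by (simp add: prob_space)
qed

lemma orth_integral_real:
  assumes F: "subalgebra M F" and o: "orth M (sets F) D" and D: "integrable M D"
    and f: "f \<in> borel_measurable F" "\<And>\<omega>. \<omega> \<in> space M \<Longrightarrow> \<bar>f \<omega>\<bar> \<le> C"
  shows "(LINT \<omega>|M. f \<omega> * D \<omega>) = (0::real)"
proof -
  interpret F: finite_measure_subalgebra M F using F by unfold_locales
  have fM: "f \<in> borel_measurable M" using F f(1) by (rule measurable_from_subalg)
  have 0: "AE x in M. real_cond_exp M F D x = 0"
    by (rule F.real_cond_exp_charact) (use o D in \<open>auto simp: orth_def set_lebesgue_integral_def\<close>)
  have int: "integrable M (\<lambda>\<omega>. f \<omega> * D \<omega>)"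
  proof (rule Bochner_Integration.integrable_bound)
    show "integrable M (\<lambda>\<omega>. C * D \<omega>)" using D by simp
    show "(\<lambda>\<omega>. f \<omega> * D \<omega>) \<in> borel_measurable M" using fM D by auto
    show "AE x in M. norm (f x * D x) \<le> norm (C * D x)"
      using f(2) by (auto simp: abs_mult intro!: AE_I2 mult_right_mono order_trans[OF f(2)])
  qed
  have "(LINT \<omega>|M. f \<omega> * D \<omega>) = (LINT \<omega>|M. f \<omega> * real_cond_exp M F D \<omega>)"
    using int f D by (intro F.real_cond_exp_intg(2)[symmetric]) auto
  also have "\<dots> = (LINT \<omega>|M. 0)"
    by (rule integral_cong_AE) (use 0 fM in auto)
  finally show ?thesis by simp
qed

text \<open>
The conditional expectation of \<open>D\<close> vanishes, so \<open>f\<close> can be pulled out.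
\<close>

lemma orth_integral:
  fixes f :: "'a \<Rightarrow> complex"
  assumes F: "subalgebra M F" and o: "orth M (sets F) D" and D: "integrable M D"
    and f: "f \<in> borel_measurable F" "\<And>\<omega>. \<omega> \<in> space M \<Longrightarrow> norm (f \<omega>) \<le> C"
  shows "(LINT \<omega>|M. f \<omega> * of_real (D \<omega>)) = 0"
proof -
  have fM: "f \<in> borel_measurable M" using F f(1) by (rule measurable_from_subalg)
  have int: "integrable M (\<lambda>\<omega>. f \<omega> * of_real (D \<omega>))"
  proof (rule Bochner_Integration.integrable_bound)
    show "integrable M (\<lambda>\<omega>. C * D \<omega>)" using D by simp
    show "(\<lambda>\<omega>. f \<omega> * of_real (D \<omega>)) \<in> borel_measurable M" using fM D by auto
    show "AE x in M. norm (f x * of_real (D x)) \<le> norm (C * D x)"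
      using f(2) by (auto simp: abs_mult norm_mult intro!: AE_I2 mult_right_mono order_trans[OF f(2)])
  qed
  have "(LINT \<omega>|M. Re (f \<omega>) * D \<omega>) = 0"
    using f by (intro orth_integral_real[OF F o D, where C=C])
      (auto intro: order_trans[OF abs_Re_le_cmod])
  moreover have "(LINT \<omega>|M. Im (f \<omega>) * D \<omega>) = 0"
    using f by (intro orth_integral_real[OF F o D, where C=C])
      (auto intro: order_trans[OF abs_Im_le_cmod])
  moreover have "Re (LINT \<omega>|M. f \<omega> * of_real (D \<omega>)) = (LINT \<omega>|M. Re (f \<omega>) * D \<omega>)"
    using int by (subst integral_Re[symmetric]) auto
  moreover have "Im (LINT \<omega>|M. f \<omega> * of_real (D \<omega>)) = (LINT \<omega>|M. Im (f \<omega>) * D \<omega>)"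
    using int by (subst integral_Im[symmetric]) auto
  ultimately show ?thesis by (simp add: complex_eq_iff)
qed

end

section \<open>Riemann sums of right-continuous paths\<close>

lemma grid_cell_unique:
  fixes r u \<delta> :: real
  assumes "0 < \<delta>"
  shows "u + (real k - 1) * \<delta> < r \<and> r \<le> u + real k * \<delta> \<longleftrightarrow> int k = \<lceil>(r - u) / \<delta>\<rceil>"
proof -
  have "int k = \<lceil>(r - u) / \<delta>\<rceil> \<longleftrightarrow> real k - 1 < (r-u)/\<delta> \<and> (r-u)/\<delta> \<le> real k"
    by (auto simp: ceiling_unique) linarith+
  then show ?thesis using assms by (auto simp: field_simps)
qed

text \<open>
Evaluation at the right end points makes right-continuity sufficient: the step function that
is integrated by the Riemann sum converges at every point.
\<close>

lemma riemann_sum_right_continuous: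
  fixes x :: "real \<Rightarrow> 'n::finite" and lam :: "'n \<Rightarrow> real"
  assumes uv: "0 \<le> u" "u < v"
    and rc: "\<And>t. 0 \<le> t \<Longrightarrow> \<forall>\<^sub>F r in at_right t. x r = x t"
  shows "(\<lambda>q. \<Sum>k=1..Suc q. (v - u) / Suc q * lam (x (u + k * ((v - u) / Suc q))))
           \<longlonglongrightarrow> (LINT r:{u..v}|lborel. lam (x r))"
proof -
  define \<delta> where "\<delta> q = (v - u) / real (Suc q)" for q
  have \<delta>: "0 < \<delta> q" for q using uv by (simp add: \<delta>_def)
  have \<delta>q: "\<delta> q * Suc q = v - u" for q using uv by (simp add: \<delta>_def)
  define \<phi> where "\<phi> q r = (\<Sum>k=1..Suc q. indicator {u + (real k - 1) * \<delta> q <.. u + real k * \<delta> q} r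
      * lam (x (u + real k * \<delta> q)))" for q r
  have \<phi>_val: "\<phi> q r = indicator {u<..v} r * lam (x (u + nat \<lceil>(r - u) / \<delta> q\<rceil> * \<delta> q))" for q r
  proof -
    define k0 where "k0 = \<lceil>(r - u) / \<delta> q\<rceil>"
    have in_iff: "r \<in> {u<..v} \<longleftrightarrow> 1 \<le> k0 \<and> k0 \<le> Suc q"
    proof -
      have "1 \<le> k0 \<longleftrightarrow> u < r" unfolding k0_def using \<delta>[of q] by (simp add: one_le_ceiling field_simps)
      moreover have "k0 \<le> Suc q \<longleftrightarrow> r \<le> v"
        unfolding k0_def using \<delta>[of q] \<delta>q[of q] by (simp add: ceiling_le_iff field_simps)
      ultimately show ?thesis by auto
    qed
    have "\<phi> q r = (\<Sum>k=1..Suc q. if int k = k0 then lam (x (u + real k * \<delta> q)) else 0)"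
      unfolding \<phi>_def k0_def
      by (intro sum.cong refl) (simp add: indicator_def grid_cell_unique[OF \<delta>])
    also have "\<dots> = (\<Sum>k\<in>{1..Suc q} \<inter> {k. int k = k0}. lam (x (u + real k * \<delta> q)))"
      by (simp add: sum.inter_restrict)
    also have "{1..Suc q} \<inter> {k. int k = k0} = (if r \<in> {u<..v} then {nat k0} else {})"
      unfolding in_iff by auto
    finally show ?thesis by (simp add: k0_def indicator_def)
  qed
  have lim: "(\<lambda>q. \<phi> q r) \<longlonglongrightarrow> indicator {u<..v} r * lam (x r)" for r
  proof (cases "r \<in> {u<..v}")
    case True
    then have r0: "0 \<le> r" "u < r" using uv by auto
    from rc[OF r0(1)] obtain b where b: "b > r" "\<And>y. r < y \<Longrightarrow> y < b \<Longrightarrow> x y = x r"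
      by (auto simp: eventually_at_right_field)
    have "\<delta> \<longlonglongrightarrow> 0" unfolding \<delta>_def
      by (rule LIMSEQ_Suc[OF lim_const_over_n])
    then have "\<forall>\<^sub>F q in sequentially. \<delta> q < b - r"
      using b by (intro order_tendstoD(2)) auto
    then have "\<forall>\<^sub>F q in sequentially. \<phi> q r = indicator {u<..v} r * lam (x r)"
    proof eventually_elim
      case (elim q)
      define k0 where "k0 = \<lceil>(r - u) / \<delta> q\<rceil>"
      have k0: "0 < k0" unfolding k0_def using r0 \<delta> by simp
      have "u + (real (nat k0) - 1) * \<delta> q < r \<and> r \<le> u + real (nat k0) * \<delta> q"
        using k0 by (subst grid_cell_unique[OF \<delta>]) (simp add: k0_def)
      then have "r \<le> u + real (nat k0) * \<delta> q" "u + real (nat k0) * \<delta> q < b"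
        using elim by (auto simp: algebra_simps)
      then have "x (u + real (nat k0) * \<delta> q) = x r" using b(2) by (cases "r = u + real (nat k0) * \<delta> q") auto
      then show ?case by (simp add: \<phi>_val k0_def)
    qed
    then show ?thesis by (rule tendsto_eventually)
  next
    case False then show ?thesis by (simp add: \<phi>_val)
  qed
  define C where "C = (\<Sum>i\<in>UNIV. \<bar>lam i\<bar>)"
  have C: "\<bar>lam i\<bar> \<le> C" for i unfolding C_def by (rule member_le_sum) auto
  have C0: "0 \<le> C" unfolding C_def by (simp add: sum_nonneg)
  have m\<phi>: "\<phi> q \<in> borel_measurable lborel" for q
    unfolding \<phi>_def by measurable
  have ml: "(\<lambda>r. indicator {u<..v} r * lam (x r)) \<in> borel_measurable lborel"
    by (rule borel_measurable_LIMSEQ_metric[OF m\<phi> lim])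
  have \<phi>_int_lim: "(\<lambda>q. LINT r|lborel. \<phi> q r) \<longlonglongrightarrow> (LINT r|lborel. indicator {u<..v} r * lam (x r))"
  proof (rule integral_dominated_convergence[where w="\<lambda>r. indicator {u..v} r * C"])
    show "integrable lborel (\<lambda>r. indicator {u..v} r * C)"
      by (intro integrable_mult_left integrable_real_indicator) (auto simp: emeasure_lborel_Icc_eq)
    show "AE r in lborel. norm (\<phi> q r) \<le> indicator {u..v} r * C" for q
      by (intro AE_I2) (auto simp: \<phi>_val indicator_def C C0)
  qed (use m\<phi> ml lim in auto)
  have fin: "emeasure lborel {a<..b::real} < \<top>" for a b
    using emeasure_bounded_finite[of "{a<..b}"] by simp
  have sums: "(LINT r|lborel. \<phi> q r) = (\<Sum>k=1..Suc q. \<delta> q * lam (x (u + k * \<delta> q)))" for q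
  proof -
    have "(LINT r|lborel. \<phi> q r) = (\<Sum>k=1..Suc q. LINT r|lborel.
        indicator {u + (real k - 1) * \<delta> q <.. u + real k * \<delta> q} r * lam (x (u + real k * \<delta> q)))"
      unfolding \<phi>_def
      by (intro Bochner_Integration.integral_sum integrable_mult_left integrable_real_indicator)
        (auto simp: fin)
    also have "\<dots> = (\<Sum>k=1..Suc q. \<delta> q * lam (x (u + real k * \<delta> q)))"
      by (intro sum.cong refl) (use \<delta>[of q] in \<open>auto simp: algebra_simps measure_lborel_Ioc\<close>)
    finally show ?thesis .
  qed
  have "(LINT r|lborel. indicator {u<..v} r * lam (x r)) = (LINT r:{u..v}|lborel. lam (x r))"
    unfolding set_lebesgue_integral_def
  proof (rule integral_cong_AE)
    have ne: "AE r in lborel. r \<noteq> u" by (rule AE_lborel_singleton)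
    show eq: "AE r in lborel. indicator {u<..v} r * lam (x r) = indicator {u..v} r *\<^sub>R lam (x r)"
      using ne by eventually_elim (auto simp: indicator_def)
    have "(\<lambda>r. indicator {u<..v} r * lam (x r) + indicator {u} r * lam (x u)) \<in> borel_measurable lborel"
      using ml by measurable
    also have "(\<lambda>r. indicator {u<..v} r * lam (x r) + indicator {u} r * lam (x u))
       = (\<lambda>r. indicator {u..v} r *\<^sub>R lam (x r))"
      using uv by (auto simp: indicator_def fun_eq_iff)
    finally show "(\<lambda>r. indicator {u..v} r *\<^sub>R lam (x r)) \<in> borel_measurable lborel" .
  qed (rule ml)
  then show ?thesis using \<phi>_int_lim sums by (simp add: \<delta>_def)
qed

section \<open>The Markov property\<close>

lemma measurable_of_bool [measurable (raw)]:
  "Measurable.pred M P \<Longrightarrow> (\<lambda>\<omega>. of_bool (P \<omega>) :: 'b::{zero_neq_one, topological_space}) \<in> borel_measurable M"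
  unfolding of_bool_def by measurable

lemma space_history [simp]: "space (history M X t) = space M"
  unfolding history_def by (auto intro!: space_measure_of)

lemma space_background [simp]: "space (background M X) = space M"
  unfolding background_def by (auto intro!: space_measure_of)

lemma sets_history:
  "sets (history M X t) = sigma_sets (space M) {{\<omega>\<in>space M. X u \<omega> = i} | u i. 0 \<le> u \<and> u \<le> t}"
  unfolding history_def by (intro sets_measure_of) auto

lemma sets_background:
  "sets (background M X) = sigma_sets (space M) {{\<omega>\<in>space M. X u \<omega> = i} | u i. 0 \<le> u}"
  unfolding background_def by (intro sets_measure_of) auto

lemma subalgebra_history_mono: "s \<le> t \<Longrightarrow> subalgebra (history M X t) (history M X s)"
  unfolding subalgebra_def by (auto simp: sets_history intro!: sigma_sets_mono')

lemma subalgebra_background_history: "subalgebra (background M X) (history M X s)"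
  unfolding subalgebra_def by (auto simp: sets_history sets_background intro!: sigma_sets_mono')

lemma measurable_countI:
  assumes "\<And>i. {\<omega>\<in>space N. f \<omega> = i} \<in> sets N"
  shows "f \<in> measurable N (count_space (UNIV::'n::finite set))"
  using assms by (subst measurable_count_space_eq2)
    (auto simp: vimage_def Int_def conj_commute)

lemma X_history:
  fixes X :: "real \<Rightarrow> 'w \<Rightarrow> 'n::finite"
  shows "0 \<le> u \<Longrightarrow> u \<le> t \<Longrightarrow> X u \<in> measurable (history M X t) (count_space UNIV)"
  by (intro measurable_countI) (auto simp: sets_history intro!: sigma_sets.Basic)

lemma X_background:
  fixes X :: "real \<Rightarrow> 'w \<Rightarrow> 'n::finite"
  shows "0 \<le> u \<Longrightarrow> X u \<in> measurable (background M X) (count_space UNIV)"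
  by (intro measurable_countI) (auto simp: sets_background intro!: sigma_sets.Basic)

text \<open>
Induction over the list of epochs avoids measurability of list-valued maps.
\<close>

lemma measurable_of_path:
  fixes X :: "real \<Rightarrow> 'w \<Rightarrow> 'n::finite" and \<Phi> :: "'n list \<Rightarrow> real"
  assumes "\<And>u. u \<in> set us \<Longrightarrow> X u \<in> measurable N (count_space UNIV)"
  shows "(\<lambda>\<omega>. \<Phi> (map (\<lambda>u. X u \<omega>) us)) \<in> borel_measurable N"
  using assms
proof (induction us arbitrary: \<Phi>)
  case (Cons u us)
  have "(\<lambda>\<omega>. (\<lambda>i \<omega>. \<Phi> (i # map (\<lambda>u. X u \<omega>) us)) (X u \<omega>) \<omega>) \<in> borel_measurable N"
    by (rule measurable_compose_countable) (use Cons.IH[of "\<lambda>xs. \<Phi> (_ # xs)"] Cons.prems in auto)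
  then show ?case by simp
qed simp

text \<open>
The model with its transition semigroup \<open>P\<close> as a parameter, so that the lemmas can refer to it.
\<close>

locale queue = prob_space M for M :: "'w measure" +
  fixes X :: "real \<Rightarrow> 'w \<Rightarrow> 'n::finite"
    and P :: "real \<Rightarrow> real^'n^'n" and Q :: "real^'n^'n"
    and lam :: "'n \<Rightarrow> real" and B :: "'n \<Rightarrow> real measure"
    and T S :: "nat \<Rightarrow> 'w \<Rightarrow> real"
  assumes lam_pos: "0 < lam i"
    and service: "service_law (B i)"
    and X_meas: "0 \<le> t \<Longrightarrow> X t \<in> measurable M (count_space UNIV)"
    and X_rc: "\<omega> \<in> space M \<Longrightarrow> 0 \<le> t \<Longrightarrow> \<forall>\<^sub>F u in at_right t. X u \<omega> = X t \<omega>"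
    and semigroup: "transition_semigroup P" and generator: "has_generator P Q"
    and markov: "0 \<le> t \<Longrightarrow> 0 \<le> h \<Longrightarrow> AE \<omega> in M.
           real_cond_exp M (history M X t) (indicator {\<omega>\<in>space M. X (t + h) \<omega> = j}) \<omega>
             = P h $ X t \<omega> $ j"
    and arrivals: "modulated_poisson_arrivals M X lam T"
    and services: "modulated_services M X T B S"
begin

lemma bound_nonneg:
  assumes "\<And>\<omega>. \<omega> \<in> space M \<Longrightarrow> norm (f \<omega>) \<le> C"
  shows "0 \<le> C"
proof -
  obtain \<omega> where "\<omega> \<in> space M" using not_empty by auto
  from assms[OF this] show ?thesis using norm_ge_zero order_trans by blast
qed

lemma expectation_of_bool:
  assumes "{\<omega>\<in>space M. R \<omega>} \<in> sets M"
  shows "(LINT \<omega>|M. (of_bool (R \<omega>) :: real)) = prob {\<omega>\<in>space M. R \<omega>}"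
proof -
  have "(LINT \<omega>|M. of_bool (R \<omega>)) = (LINT \<omega>|M. (indicator {\<omega>\<in>space M. R \<omega>} \<omega> :: real))"
    by (rule Bochner_Integration.integral_cong) (auto simp: indicator_def)
  then show ?thesis using assms by simp
qed

lemma X_sets: "0 \<le> u \<Longrightarrow> {\<omega>\<in>space M. X u \<omega> = i} \<in> sets M"
  using measurable_sets[OF X_meas, of u "{i}"] by (simp add: vimage_def Int_def conj_commute)

lemma subalgebra_history: "subalgebra M (history M X t)"
  unfolding subalgebra_def using X_sets
  by (auto simp: sets_history intro!: sets.sigma_sets_subset)

lemma subalgebra_background: "subalgebra M (background M X)"
  unfolding subalgebra_def using X_sets
  by (auto simp: sets_background intro!: sets.sigma_sets_subset)

lemma markov_step:
  assumes f: "f \<in> borel_measurable (history M X t)" "\<And>\<omega>. \<omega> \<in> space M \<Longrightarrow> \<bar>f \<omega>\<bar> \<le> C"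
    and t: "0 \<le> t" "0 \<le> h"
  shows "(LINT \<omega>|M. f \<omega> * of_bool (X t \<omega> = i) * of_bool (X (t + h) \<omega> = j))
       = P h $ i $ j * (LINT \<omega>|M. f \<omega> * of_bool (X t \<omega> = i))"
proof -
  let ?H = "history M X t"
  interpret F: finite_measure_subalgebra M ?H using subalgebra_history by unfold_locales
  have [measurable]: "f \<in> borel_measurable ?H" by (rule f)
  have [measurable]: "X t \<in> measurable ?H (count_space UNIV)" using t by (intro X_history) auto
  have [measurable]: "X t \<in> measurable M (count_space UNIV)" "X (t + h) \<in> measurable M (count_space UNIV)"
    using t by (auto intro!: X_meas)
  have fM [measurable]: "f \<in> borel_measurable M" using subalgebra_history f(1) by (rule measurable_from_subalg)
  let ?g = "\<lambda>\<omega>. f \<omega> * of_bool (X t \<omega> = i)" and ?I = "indicator {\<omega>\<in>space M. X (t + h) \<omega> = j}"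
  have g: "?g \<in> borel_measurable ?H" by measurable
  have int: "integrable M (\<lambda>\<omega>. ?g \<omega> * ?I \<omega>)"
    using f(2) bound_nonneg[of f C] by (intro integrable_bounded[where C=C]) (auto simp: indicator_def)
  have "(LINT \<omega>|M. ?g \<omega> * of_bool (X (t + h) \<omega> = j)) = (LINT \<omega>|M. ?g \<omega> * ?I \<omega>)"
    by (rule Bochner_Integration.integral_cong) (auto simp: indicator_def)
  also have "\<dots> = (LINT \<omega>|M. ?g \<omega> * real_cond_exp M ?H ?I \<omega>)"
    using int g by (intro F.real_cond_exp_intg(2)[symmetric]) auto
  also have "\<dots> = (LINT \<omega>|M. P h $ i $ j * ?g \<omega>)"
  proof (rule integral_cong_AE)
    show "AE \<omega> in M. ?g \<omega> * real_cond_exp M ?H ?I \<omega> = P h $ i $ j * ?g \<omega>"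
      using markov[OF t, of j] by eventually_elim auto
  qed measurable
  finally show ?thesis by simp
qed

text \<open>
Given \<open>X t = i\<close>, any function of the chain at finitely many later epochs is independent of
the history up to \<open>t\<close>; the constant \<open>d\<close> is its conditional mean.  The induction peels off
the first step and uses the Markov property at the new epoch \<open>t + \<delta>\<close>.
\<close>

lemma markov_path:
  fixes \<Phi> :: "'n list \<Rightarrow> real"
  assumes "0 \<le> t" "0 \<le> \<delta>" "\<And>xs. \<bar>\<Phi> xs\<bar> \<le> K"
  shows "\<exists>d. \<forall>f C. f \<in> borel_measurable (history M X t) \<longrightarrow> (\<forall>\<omega>\<in>space M. \<bar>f \<omega>\<bar> \<le> C) \<longrightarrow>
     (LINT \<omega>|M. f \<omega> * of_bool (X t \<omega> = i) * \<Phi> (map (\<lambda>k. X (t + real k * \<delta>) \<omega>) [1..<Suc q]))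
       = d * (LINT \<omega>|M. f \<omega> * of_bool (X t \<omega> = i))"
  using assms
proof (induction q arbitrary: t i \<Phi>)
  case 0
  show ?case by (rule exI[of _ "\<Phi> []"]) simp
next
  case (Suc q)
  let ?path = "\<lambda>t \<omega>. map (\<lambda>k. X (t + real k * \<delta>) \<omega>) [1..<Suc q]"
  let ?R = "\<lambda>j (d::real). \<forall>(f::'w \<Rightarrow> real) C. f \<in> borel_measurable (history M X (t + \<delta>)) \<longrightarrow> (\<forall>\<omega>\<in>space M. \<bar>f \<omega>\<bar> \<le> C) \<longrightarrow>
     (LINT \<omega>|M. f \<omega> * of_bool (X (t + \<delta>) \<omega> = j) * \<Phi> (j # ?path (t + \<delta>) \<omega>))
       = d * (LINT \<omega>|M. f \<omega> * of_bool (X (t + \<delta>) \<omega> = j))"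
  have "\<forall>j. \<exists>d. ?R j d"
  proof
    fix j show "\<exists>d. ?R j d"
      by (rule Suc.IH[of "t + \<delta>" "\<lambda>xs. \<Phi> (j # xs)" j]) (use Suc.prems in auto)
  qed
  from choice[OF this] obtain d where d0: "\<forall>j. ?R j (d j)" by blast
  have d: "(LINT \<omega>|M. f \<omega> * of_bool (X (t + \<delta>) \<omega> = j) * \<Phi> (j # ?path (t + \<delta>) \<omega>))
       = d j * (LINT \<omega>|M. f \<omega> * of_bool (X (t + \<delta>) \<omega> = j))"
    if "f \<in> borel_measurable (history M X (t + \<delta>))" "\<forall>\<omega>\<in>space M. \<bar>f \<omega>\<bar> \<le> C" for j f C
    using d0 that by blast
  have path: "map (\<lambda>k. X (t + real k * \<delta>) \<omega>) [1..<Suc (Suc q)] = X (t + \<delta>) \<omega> # ?path (t + \<delta>) \<omega>" for \<omega>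
  proof -
    have "[1..<Suc (Suc q)] = 1 # map Suc [1..<Suc q]" by (simp only: map_Suc_upt upt_conv_Cons)
    then show ?thesis by (simp add: comp_def algebra_simps del: upt_Suc)
  qed
  show ?case
  proof (rule exI[of _ "\<Sum>j\<in>UNIV. d j * P \<delta> $ i $ j"], intro allI impI)
    fix f :: "'w \<Rightarrow> real" and C assume f: "f \<in> borel_measurable (history M X t)" "\<forall>\<omega>\<in>space M. \<bar>f \<omega>\<bar> \<le> C"
    let ?g = "\<lambda>\<omega>. f \<omega> * of_bool (X t \<omega> = i)"
    have [measurable]: "f \<in> borel_measurable (history M X (t + \<delta>))"
      using subalgebra_history_mono f(1) by (rule measurable_from_subalg) (use Suc.prems in auto)
    have [measurable]: "X t \<in> measurable (history M X (t + \<delta>)) (count_space UNIV)"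
      using Suc.prems by (intro X_history) auto
    have g: "?g \<in> borel_measurable (history M X (t + \<delta>))" by measurable
    have C0: "0 \<le> C" using f(2) bound_nonneg[of f C] by auto
    have gb: "\<forall>\<omega>\<in>space M. \<bar>?g \<omega>\<bar> \<le> C" using f(2) C0 by auto
    have gM [measurable]: "?g \<in> borel_measurable M" using subalgebra_history g by (rule measurable_from_subalg)
    have XM [measurable]: "X (t + \<delta>) \<in> measurable M (count_space UNIV)" using Suc.prems by (intro X_meas) auto
    have \<Phi>M [measurable]: "(\<lambda>\<omega>. \<Phi> (j # ?path (t + \<delta>) \<omega>)) \<in> borel_measurable M" for j
    proof -
      have "X u \<in> measurable M (count_space UNIV)"
        if "u \<in> set (map (\<lambda>k. t + \<delta> + real k * \<delta>) [1..<Suc q])" for u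
        using that Suc.prems by (auto intro!: X_meas)
      from measurable_of_path[where \<Phi>="\<lambda>xs. \<Phi> (j # xs)" and X=X
          and us="map (\<lambda>k. t + \<delta> + real k * \<delta>) [1..<Suc q]", OF this]
      show ?thesis by (simp add: comp_def del: upt_Suc)
    qed
    have K0: "0 \<le> K" using Suc.prems(3)[of "[]"] by linarith
    have int: "integrable M (\<lambda>\<omega>. ?g \<omega> * of_bool (X (t + \<delta>) \<omega> = j) * \<Phi> (j # ?path (t + \<delta>) \<omega>))" for j
    proof (rule integrable_bounded[where C="C * K"])
      fix \<omega> assume w: "\<omega> \<in> space M"
      have "\<bar>?g \<omega>\<bar> * \<bar>of_bool (X (t + \<delta>) \<omega> = j)\<bar> * \<bar>\<Phi> (j # ?path (t + \<delta>) \<omega>)\<bar> \<le> C * 1 * K"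
        using gb w C0 K0 by (intro mult_mono Suc.prems(3)) auto
      then show "norm (?g \<omega> * of_bool (X (t + \<delta>) \<omega> = j) * \<Phi> (j # ?path (t + \<delta>) \<omega>)) \<le> C * K"
        unfolding real_norm_def abs_mult by simp
    qed measurable
    have "(LINT \<omega>|M. ?g \<omega> * \<Phi> (map (\<lambda>k. X (t + real k * \<delta>) \<omega>) [1..<Suc (Suc q)]))
        = (LINT \<omega>|M. (\<Sum>j\<in>UNIV. ?g \<omega> * of_bool (X (t + \<delta>) \<omega> = j) * \<Phi> (j # ?path (t + \<delta>) \<omega>)))"
    proof (rule Bochner_Integration.integral_cong)
      fix \<omega>
      have "(\<Sum>j\<in>UNIV. ?g \<omega> * of_bool (X (t + \<delta>) \<omega> = j) * \<Phi> (j # ?path (t + \<delta>) \<omega>))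
          = (\<Sum>j\<in>UNIV. if X (t + \<delta>) \<omega> = j then ?g \<omega> * \<Phi> (j # ?path (t + \<delta>) \<omega>) else 0)"
        by (rule sum.cong) auto
      then show "?g \<omega> * \<Phi> (map (\<lambda>k. X (t + real k * \<delta>) \<omega>) [1..<Suc (Suc q)])
          = (\<Sum>j\<in>UNIV. ?g \<omega> * of_bool (X (t + \<delta>) \<omega> = j) * \<Phi> (j # ?path (t + \<delta>) \<omega>))"
        unfolding path by simp
    qed simp
    also have "\<dots> = (\<Sum>j\<in>UNIV. d j * (LINT \<omega>|M. ?g \<omega> * of_bool (X (t + \<delta>) \<omega> = j)))"
      unfolding d[OF g gb, symmetric] by (rule Bochner_Integration.integral_sum) (rule int)
    also have "\<dots> = (\<Sum>j\<in>UNIV. d j * P \<delta> $ i $ j) * (LINT \<omega>|M. ?g \<omega>)"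
    proof -
      have "(LINT \<omega>|M. ?g \<omega> * of_bool (X (t + \<delta>) \<omega> = j)) = P \<delta> $ i $ j * (LINT \<omega>|M. ?g \<omega>)" for j
        using Suc.prems f by (intro markov_step[where C=C]) auto
      then show ?thesis by (simp only: sum_distrib_right mult.assoc)
    qed
    finally show "(LINT \<omega>|M. ?g \<omega> * \<Phi> (map (\<lambda>k. X (t + real k * \<delta>) \<omega>) [1..<Suc (Suc q)]))
      = (\<Sum>j\<in>UNIV. d j * P \<delta> $ i $ j) * (LINT \<omega>|M. ?g \<omega>)" .
  qed
qed

text \<open>
The cumulated arrival intensity.
\<close>

definition cum :: "real \<Rightarrow> real \<Rightarrow> 'w \<Rightarrow> real" where
  "cum u v \<omega> = (LINT r:{u..v}|lborel. lam (X r \<omega>))"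

lemma cum_limit:
  assumes "0 \<le> u" "u < v" "\<omega> \<in> space M"
  shows "(\<lambda>q. \<Sum>k=1..Suc q. (v - u) / Suc q * lam (X (u + k * ((v - u) / Suc q)) \<omega>)) \<longlonglongrightarrow> cum u v \<omega>"
  unfolding cum_def using assms X_rc by (intro riemann_sum_right_continuous) auto

lemma cum_bounds:
  assumes "0 \<le> u" "u < v" "\<omega> \<in> space M"
    and "\<And>i. c \<le> lam i" "\<And>i. lam i \<le> C"
  shows "(v - u) * c \<le> cum u v \<omega>" "cum u v \<omega> \<le> (v - u) * C"
proof -
  have w: "0 \<le> (v - u) / Suc q" for q using assms(2) by simp
  have "(\<Sum>k=1..Suc q. (v - u) / Suc q * c) \<le> (\<Sum>k=1..Suc q. (v - u) / Suc q * lam (X (u + k * ((v - u) / Suc q)) \<omega>))" for q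
    using assms(4) w by (intro sum_mono mult_left_mono) auto
  then have 1: "(v - u) * c \<le> (\<Sum>k=1..Suc q. (v - u) / Suc q * lam (X (u + k * ((v - u) / Suc q)) \<omega>))" for q
    by (simp only: sum_constant card_atLeastAtMost) simp
  have "(\<Sum>k=1..Suc q. (v - u) / Suc q * lam (X (u + k * ((v - u) / Suc q)) \<omega>)) \<le> (\<Sum>k=1..Suc q. (v - u) / Suc q * C)" for q
    using assms(5) w by (intro sum_mono mult_left_mono) auto
  then have 2: "(\<Sum>k=1..Suc q. (v - u) / Suc q * lam (X (u + k * ((v - u) / Suc q)) \<omega>)) \<le> (v - u) * C" for q
    by (simp only: sum_constant card_atLeastAtMost) simp
  show "(v - u) * c \<le> cum u v \<omega>" "cum u v \<omega> \<le> (v - u) * C"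
    using LIMSEQ_le_const[OF cum_limit[OF assms(1-3)]] LIMSEQ_le_const2[OF cum_limit[OF assms(1-3)]] 1 2
    by blast+
qed

definition lmin :: real where "lmin = Min (range lam)"
definition lmax :: real where "lmax = Max (range lam)"

lemma lmin_le: "lmin \<le> lam i" and lam_le: "lam i \<le> lmax" and lmin_pos: "0 < lmin"
  unfolding lmin_def lmax_def using lam_pos by auto

lemma lmax_pos: "0 < lmax"
  using lmin_pos lmin_le lam_le by (meson less_le_trans order_less_le_trans)

lemma cum_pos: "0 \<le> u \<Longrightarrow> u < v \<Longrightarrow> \<omega> \<in> space M \<Longrightarrow> 0 < cum u v \<omega>"
  using cum_bounds(1)[of u v \<omega> lmin lmax] lmin_le lam_le mult_pos_pos[OF _ lmin_pos, of "v - u"] by auto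

lemma grid_point_le:
  assumes "k \<in> {1..Suc q}" "(u::real) < v"
  shows "u \<le> u + k * ((v - u) / Suc q)" "u + k * ((v - u) / Suc q) \<le> v"
proof -
  have "real k * (v - u) \<le> real (Suc q) * (v - u)" using assms by (intro mult_right_mono) auto
  then show "u + k * ((v - u) / Suc q) \<le> v" by (simp add: field_simps)
qed (use assms in auto)

lemma cum_history:
  assumes "0 \<le> u" "u < v"
  shows "cum u v \<in> borel_measurable (history M X v)"
proof (rule borel_measurable_LIMSEQ_metric)
  show "(\<lambda>\<omega>. \<Sum>k=1..Suc q. (v - u) / Suc q * lam (X (u + k * ((v - u) / Suc q)) \<omega>)) \<in> borel_measurable (history M X v)" for q
  proof (intro borel_measurable_sum)
    fix k assume k: "k \<in> {1..Suc q}"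
    have [measurable]: "X (u + k * ((v - u) / Suc q)) \<in> measurable (history M X v) (count_space UNIV)"
      using grid_point_le[OF k assms(2)] assms by (intro X_history) auto
    show "(\<lambda>\<omega>. (v - u) / Suc q * lam (X (u + k * ((v - u) / Suc q)) \<omega>)) \<in> borel_measurable (history M X v)"
      by measurable
  qed
  show "(\<lambda>q. \<Sum>k=1..Suc q. (v - u) / Suc q * lam (X (u + k * ((v - u) / Suc q)) \<omega>)) \<longlonglongrightarrow> cum u v \<omega>"
    if "\<omega> \<in> space (history M X v)" for \<omega>
    using cum_limit[OF assms, of \<omega>] that by simp
qed

lemma cum_measurable [measurable]:
  assumes "0 \<le> u" "u < v"
  shows "cum u v \<in> borel_measurable M" "cum u v \<in> borel_measurable (background M X)"
  by (rule measurable_from_subalg[OF subalgebra_history cum_history[OF assms]],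
      rule measurable_from_subalg[OF subalgebra_background_history cum_history[OF assms]])

definition pois :: "nat \<Rightarrow> real \<Rightarrow> real" where "pois m r = r ^ m / fact m * exp (- r)"

lemma pmf_poisson_eq_pois: "0 < r \<Longrightarrow> pmf (poisson_pmf r) m = pois m r"
  by (simp add: pois_def)

lemma pois_le_1: "0 \<le> r \<Longrightarrow> \<bar>pois m r\<bar> \<le> 1"
proof (cases "r = 0")
  case False
  assume "0 \<le> r"
  then have "pois m r = pmf (poisson_pmf r) m"
    using False by (intro pmf_poisson_eq_pois[symmetric]) auto
  then show ?thesis by (simp add: pmf_le_1)
qed (cases m, auto simp: pois_def)

lemma pois_measurable [measurable]: "pois m \<in> borel_measurable borel"
  unfolding pois_def by measurable

text \<open>
The product form states conditional independence given \<open>X t = i\<close> also when this event has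
probability 0.  The intensity over \<open>[t, t + h]\<close> is the limit of functions of finitely many
epochs, to which \<open>markov_path\<close> applies, and both sides are stable under bounded convergence.
\<close>

lemma markov_future:
  assumes f: "f \<in> borel_measurable (history M X t)" "\<And>\<omega>. \<omega> \<in> space M \<Longrightarrow> \<bar>f \<omega>\<bar> \<le> C"
    and t: "0 \<le> t" "0 < h"
  shows "(LINT \<omega>|M. f \<omega> * of_bool (X t \<omega> = i) * (pois m (cum t (t + h) \<omega>) * of_bool (X (t + h) \<omega> = j)))
           * prob {\<omega>\<in>space M. X t \<omega> = i}
       = (LINT \<omega>|M. of_bool (X t \<omega> = i) * (pois m (cum t (t + h) \<omega>) * of_bool (X (t + h) \<omega> = j)))
           * (LINT \<omega>|M. f \<omega> * of_bool (X t \<omega> = i))"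
proof -
  define R where "R q \<omega> = (\<Sum>k=1..Suc q. h / Suc q * lam (X (t + k * (h / Suc q)) \<omega>))" for q \<omega>
  define \<psi> where "\<psi> q \<omega> = pois m (R q \<omega>) * of_bool (X (t + h) \<omega> = j)" for q \<omega>
  define \<psi>' where "\<psi>' \<omega> = pois m (cum t (t + h) \<omega>) * of_bool (X (t + h) \<omega> = j)" for \<omega>
  have R0: "0 \<le> R q \<omega>" for q \<omega> unfolding R_def using t lam_pos
    by (intro sum_nonneg mult_nonneg_nonneg) (auto simp: less_imp_le)
  have R_lim: "(\<lambda>q. R q \<omega>) \<longlonglongrightarrow> cum t (t + h) \<omega>" if "\<omega> \<in> space M" for \<omega>
    using cum_limit[of t "t + h" \<omega>] t that by (simp add: R_def)
  have RM: "R q \<in> borel_measurable M" for q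
    unfolding R_def
  proof (intro borel_measurable_sum)
    fix k assume k: "k \<in> {1..Suc q}"
    have [measurable]: "X (t + k * (h / Suc q)) \<in> measurable M (count_space UNIV)"
      using t by (intro X_meas) auto
    show "(\<lambda>\<omega>. h / Suc q * lam (X (t + k * (h / Suc q)) \<omega>)) \<in> borel_measurable M" by measurable
  qed
  have XM [measurable]: "X (t + h) \<in> measurable M (count_space UNIV)" "X t \<in> measurable M (count_space UNIV)"
    using t by (auto intro!: X_meas)
  note [measurable] = RM
  have [measurable]: "cum t (t + h) \<in> borel_measurable M" using t by (intro cum_measurable) auto
  have \<psi>M [measurable]: "\<psi> q \<in> borel_measurable M" for q
    unfolding \<psi>_def by measurable
  have \<psi>'M [measurable]: "\<psi>' \<in> borel_measurable M"
    unfolding \<psi>'_def by measurable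
  have \<psi>b: "\<bar>\<psi> q \<omega>\<bar> \<le> 1" for q \<omega> using pois_le_1[OF R0] by (auto simp: \<psi>_def)
  have \<psi>_lim: "(\<lambda>q. \<psi> q \<omega>) \<longlonglongrightarrow> \<psi>' \<omega>" if "\<omega> \<in> space M" for \<omega>
    unfolding \<psi>_def \<psi>'_def pois_def using R_lim[OF that]
    by (intro tendsto_intros) auto
  have eq: "\<exists>d. \<forall>f C. f \<in> borel_measurable (history M X t) \<longrightarrow> (\<forall>\<omega>\<in>space M. \<bar>f \<omega>\<bar> \<le> C) \<longrightarrow>
     (LINT \<omega>|M. f \<omega> * of_bool (X t \<omega> = i) * \<psi> q \<omega>) = d * (LINT \<omega>|M. f \<omega> * of_bool (X t \<omega> = i))" for q
  proof -
    let ?\<Phi> = "\<lambda>xs. pois m (sum_list (map (\<lambda>x. h / Suc q * lam x) xs)) * of_bool (last xs = j)"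
    have "?\<Phi> (map (\<lambda>k. X (t + real k * (h / Suc q)) \<omega>) [1..<Suc (Suc q)]) = \<psi> q \<omega>" for \<omega>
      unfolding \<psi>_def R_def
      by (simp add: comp_def last_map interv_sum_list_conv_sum_set_nat atLeastLessThanSuc_atLeastAtMost del: upt_Suc)
    moreover have "\<bar>?\<Phi> xs\<bar> \<le> 1" for xs
    proof -
      have "0 \<le> sum_list (map (\<lambda>x. h / Suc q * lam x) xs)"
        using t lam_pos by (intro sum_list_nonneg) (auto intro!: mult_nonneg_nonneg simp: less_imp_le)
      from pois_le_1[OF this] show ?thesis by auto
    qed
    ultimately show ?thesis using markov_path[of t "h / Suc q" ?\<Phi> 1 i "Suc q"] t by simp
  qed
  have eq': "(LINT \<omega>|M. f \<omega> * of_bool (X t \<omega> = i) * \<psi> q \<omega>) * prob {\<omega>\<in>space M. X t \<omega> = i}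
     = (LINT \<omega>|M. of_bool (X t \<omega> = i) * \<psi> q \<omega>) * (LINT \<omega>|M. f \<omega> * of_bool (X t \<omega> = i))" for q
  proof -
    obtain d where d: "\<And>f C. f \<in> borel_measurable (history M X t) \<Longrightarrow> (\<And>\<omega>. \<omega>\<in>space M \<Longrightarrow> \<bar>f \<omega>\<bar> \<le> C) \<Longrightarrow>
     (LINT \<omega>|M. f \<omega> * of_bool (X t \<omega> = i) * \<psi> q \<omega>) = d * (LINT \<omega>|M. f \<omega> * of_bool (X t \<omega> = i))"
      using eq by blast
    have p: "(LINT \<omega>|M. of_bool (X t \<omega> = i)) = prob {\<omega>\<in>space M. X t \<omega> = i}"
      using t by (intro expectation_of_bool X_sets)
    show ?thesis using d[OF f] d[of "\<lambda>_. 1" 1] p by simp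
  qed
  have fM [measurable]: "f \<in> borel_measurable M" using subalgebra_history f(1) by (rule measurable_from_subalg)
  have lim: "(\<lambda>q. LINT \<omega>|M. g \<omega> * of_bool (X t \<omega> = i) * \<psi> q \<omega>) \<longlonglongrightarrow> (LINT \<omega>|M. g \<omega> * of_bool (X t \<omega> = i) * \<psi>' \<omega>)"
    if [measurable]: "g \<in> borel_measurable M" and g: "\<And>\<omega>. \<omega> \<in> space M \<Longrightarrow> \<bar>g \<omega>\<bar> \<le> K" for g K
  proof (rule integral_dominated_convergence[where w="\<lambda>_. K"])
    show "AE \<omega> in M. (\<lambda>q. g \<omega> * of_bool (X t \<omega> = i) * \<psi> q \<omega>) \<longlonglongrightarrow> g \<omega> * of_bool (X t \<omega> = i) * \<psi>' \<omega>"
      by (intro AE_I2 tendsto_intros \<psi>_lim)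
    show "AE \<omega> in M. norm (g \<omega> * of_bool (X t \<omega> = i) * \<psi> q \<omega>) \<le> K" for q
    proof (rule AE_I2)
      fix \<omega> assume w: "\<omega> \<in> space M"
      have "\<bar>g \<omega>\<bar> * \<bar>of_bool (X t \<omega> = i)\<bar> * \<bar>\<psi> q \<omega>\<bar> \<le> K * 1 * 1"
        using g[OF w] \<psi>b bound_nonneg[of g K] g by (intro mult_mono) auto
      then show "norm (g \<omega> * of_bool (X t \<omega> = i) * \<psi> q \<omega>) \<le> K" unfolding real_norm_def abs_mult by simp
    qed
  qed auto
  have "(\<lambda>q. (LINT \<omega>|M. f \<omega> * of_bool (X t \<omega> = i) * \<psi> q \<omega>) * prob {\<omega>\<in>space M. X t \<omega> = i})
     \<longlonglongrightarrow> (LINT \<omega>|M. f \<omega> * of_bool (X t \<omega> = i) * \<psi>' \<omega>) * prob {\<omega>\<in>space M. X t \<omega> = i}"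
    by (intro tendsto_intros lim[OF fM f(2)])
  moreover have "(\<lambda>q. (LINT \<omega>|M. of_bool (X t \<omega> = i) * \<psi> q \<omega>) * (LINT \<omega>|M. f \<omega> * of_bool (X t \<omega> = i)))
    \<longlonglongrightarrow> (LINT \<omega>|M. of_bool (X t \<omega> = i) * \<psi>' \<omega>) * (LINT \<omega>|M. f \<omega> * of_bool (X t \<omega> = i))"
    using lim[of "\<lambda>_. 1" 1] by (intro tendsto_intros) auto
  ultimately show ?thesis unfolding eq' \<psi>'_def by (rule LIMSEQ_unique)
qed

end

section \<open>Past and future of the modulated arrival process\<close>

text \<open>
Poisson counts are only given on successive intervals, so events with arbitrary epochs in
\<open>[0, t]\<close> have to be refined to a common grid that ends at \<open>t\<close>.
\<close>

lemma ex_grid: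
  fixes C :: "real set"
  assumes "finite C" "C \<subseteq> {0..t}" "0 \<le> t"
  obtains k \<tau> where "\<tau> 0 = 0" "\<tau> (k::nat) = t" "\<And>i. i < k \<Longrightarrow> \<tau> i < \<tau> (Suc i)"
    "\<And>c. c \<in> C \<Longrightarrow> \<exists>p\<le>k. c = \<tau> p"
proof -
  define A where "A = insert 0 (insert t C)"
  define xs where "xs = sorted_list_of_set A"
  have A: "finite A" "A \<subseteq> {0..t}" "0 \<in> A" "t \<in> A" using assms by (auto simp: A_def)
  have set: "set xs = A" and srt: "sorted_wrt (<) xs" using A unfolding xs_def by auto
  have less: "i < j \<Longrightarrow> j < length xs \<Longrightarrow> xs ! i < xs ! j" for i j
    using srt by (rule sorted_wrt_nth_less)
  have len: "0 < length xs" using set A by (cases xs) auto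
  define k where "k = length xs - 1"
  have mem: "\<exists>p\<le>k. c = xs ! p" if c: "c \<in> A" for c
  proof -
    from c set obtain p where "p < length xs" "xs ! p = c" by (metis in_set_conv_nth)
    then show ?thesis unfolding k_def by (intro exI[of _ p]) auto
  qed
  have in01: "xs ! p \<in> {0..t}" if "p < length xs" for p using set A(2) nth_mem[OF that] by auto
  have 0: "xs ! 0 = 0"
  proof -
    obtain p where p: "p \<le> k" "0 = xs ! p" using mem[OF A(3)] by auto
    have "p < length xs" using p(1) len unfolding k_def by linarith
    then have "xs ! 0 \<le> xs ! p" using less[of 0 p] by (cases "p = 0") auto
    then show ?thesis using in01[OF len] p by auto
  qed
  have k: "xs ! k = t"
  proof -
    obtain p where p: "p \<le> k" "t = xs ! p" using mem[OF A(4)] by auto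
    have "xs ! p \<le> xs ! k" using less[of p k] p len unfolding k_def by (cases "p = k") (auto simp: k_def)
    then show ?thesis using in01[of k] p len unfolding k_def by auto
  qed
  show thesis
    by (rule that[of "\<lambda>i. xs ! i" k]) (use 0 k mem less in \<open>auto simp: k_def A_def\<close>)
qed

definition counts :: "(nat \<Rightarrow> 'w \<Rightarrow> real) \<Rightarrow> nat \<Rightarrow> real \<Rightarrow> real \<Rightarrow> 'w \<Rightarrow> bool" where
  "counts T m u v \<omega> \<longleftrightarrow> finite (arrivals_in T u v \<omega>) \<and> card (arrivals_in T u v \<omega>) = m"

text \<open>
The finite sets of arrival numbers form a countable set, which reduces the count to countably
many comparisons of arrival epochs.
\<close>

lemma pred_counts:
  assumes T: "\<And>n. 1 \<le> n \<Longrightarrow> T n \<in> borel_measurable N"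
  shows "Measurable.pred N (counts T m u v)"
proof -
  have "counts T m u v \<omega> \<longleftrightarrow> (\<exists>F\<in>{F. finite F \<and> card F = m}.
     \<forall>n. (n \<in> F) = (1 \<le> n \<and> (u < T (max 1 n) \<omega> \<and> T (max 1 n) \<omega> \<le> v)))" for \<omega>
  proof -
    have "arrivals_in T u v \<omega> = F \<longleftrightarrow> (\<forall>n. (n \<in> F) = (1 \<le> n \<and> (u < T (max 1 n) \<omega> \<and> T (max 1 n) \<omega> \<le> v)))" for F
      unfolding arrivals_in_def set_eq_iff by (auto simp: max_def)
    then show ?thesis unfolding counts_def by (simp add: conj_commute) metis
  qed
  then have eq: "counts T m u v = (\<lambda>\<omega>. \<exists>F\<in>{F. finite F \<and> card F = m}.
     \<forall>n. (n \<in> F) = (1 \<le> n \<and> (u < T (max 1 n) \<omega> \<and> T (max 1 n) \<omega> \<le> v)))" by (rule ext)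
  have [measurable]: "T (max 1 n) \<in> borel_measurable N" for n using T by simp
  have "countable {F::nat set. finite F \<and> card F = m}"
    by (rule countable_subset[OF _ countable_Collect_finite]) auto
  then show ?thesis unfolding eq by measurable
qed

context queue
begin

lemma T_meas: "1 \<le> n \<Longrightarrow> T n \<in> borel_measurable M"
  and T_one: "\<omega> \<in> space M \<Longrightarrow> T (Suc 0) \<omega> = 0"
  and T_Suc: "\<omega> \<in> space M \<Longrightarrow> 1 \<le> n \<Longrightarrow> T n \<omega> < T (Suc n) \<omega>"
  using arrivals by (auto simp: modulated_poisson_arrivals_def)

lemma T_less: "\<omega> \<in> space M \<Longrightarrow> 1 \<le> n \<Longrightarrow> n < k \<Longrightarrow> T n \<omega> < T k \<omega>"
proof (induction k)
  case (Suc k)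
  then show ?case using T_Suc[of \<omega> k] by (cases "n = k") auto
qed simp

lemma T_nonneg: "\<omega> \<in> space M \<Longrightarrow> 1 \<le> n \<Longrightarrow> 0 \<le> T n \<omega>"
  using T_less[of \<omega> 1 n] T_one[of \<omega>] by (cases "n = 1") auto

lemma counts_meas [measurable]: "Measurable.pred M (counts T m u v)"
  using T_meas by (rule pred_counts)

text \<open>
Given the path of the background, the counts may be replaced by their Poisson probabilities.
\<close>

lemma poisson_counts:
  fixes \<tau> :: "nat \<Rightarrow> real"
  assumes f: "f \<in> borel_measurable (background M X)" "\<And>\<omega>. \<omega> \<in> space M \<Longrightarrow> \<bar>f \<omega>\<bar> \<le> C"
    and \<tau>: "0 \<le> \<tau> 0" "\<And>i. i < k \<Longrightarrow> \<tau> i < \<tau> (Suc i)"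
  shows "(LINT \<omega>|M. f \<omega> * of_bool (\<forall>i<k. counts T (m i) (\<tau> i) (\<tau> (Suc i)) \<omega>))
       = (LINT \<omega>|M. f \<omega> * (\<Prod>i<k. pois (m i) (cum (\<tau> i) (\<tau> (Suc i)) \<omega>)))"
proof -
  let ?F = "background M X"
  interpret F: finite_measure_subalgebra M ?F using subalgebra_background by unfold_locales
  have fM [measurable]: "f \<in> borel_measurable M" using subalgebra_background f(1) by (rule measurable_from_subalg)
  let ?A = "{\<omega>\<in>space M. \<forall>i<k. counts T (m i) (\<tau> i) (\<tau> (Suc i)) \<omega>}"
  have \<tau>0: "0 \<le> \<tau> i" if "i \<le> k" for i using that
  proof (induction i)
    case (Suc i) then show ?case using \<tau>(2)[of i] by auto
  qed (use \<tau> in simp)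
  have AM [measurable]: "?A \<in> sets M" by measurable
  have "AE \<omega> in M. real_cond_exp M ?F (indicator ?A) \<omega>
      = (\<Prod>i<k. pmf (poisson_pmf (LINT u:{\<tau> i..\<tau> (Suc i)}|lborel. lam (X u \<omega>))) (m i))"
    using arrivals \<tau> unfolding modulated_poisson_arrivals_def counts_def by blast
  then have ce: "AE \<omega> in M. f \<omega> * real_cond_exp M ?F (indicator ?A) \<omega>
      = f \<omega> * (\<Prod>i<k. pois (m i) (cum (\<tau> i) (\<tau> (Suc i)) \<omega>))"
    using AE_space
  proof eventually_elim
    case (elim \<omega>)
    have "(\<Prod>i<k. pmf (poisson_pmf (LINT u:{\<tau> i..\<tau> (Suc i)}|lborel. lam (X u \<omega>))) (m i))
        = (\<Prod>i<k. pois (m i) (cum (\<tau> i) (\<tau> (Suc i)) \<omega>))"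
    proof (rule prod.cong)
      fix i assume "i \<in> {..<k}"
      then have "0 < cum (\<tau> i) (\<tau> (Suc i)) \<omega>" using \<tau>0[of i] \<tau>(2) elim by (intro cum_pos) auto
      then show "pmf (poisson_pmf (LINT u:{\<tau> i..\<tau> (Suc i)}|lborel. lam (X u \<omega>))) (m i) = pois (m i) (cum (\<tau> i) (\<tau> (Suc i)) \<omega>)"
        unfolding cum_def by (rule pmf_poisson_eq_pois)
    qed simp
    then show ?case using elim by simp
  qed
  have pm: "(\<lambda>\<omega>. \<Prod>i<k. pois (m i) (cum (\<tau> i) (\<tau> (Suc i)) \<omega>)) \<in> borel_measurable M"
  proof (intro borel_measurable_prod)
    fix i assume "i \<in> {..<k}"
    then have [measurable]: "cum (\<tau> i) (\<tau> (Suc i)) \<in> borel_measurable M" using \<tau>0[of i] \<tau>(2) by (intro cum_measurable) auto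
    show "(\<lambda>\<omega>. pois (m i) (cum (\<tau> i) (\<tau> (Suc i)) \<omega>)) \<in> borel_measurable M" by measurable
  qed
  have int: "integrable M (\<lambda>\<omega>. f \<omega> * indicator ?A \<omega>)"
    using f(2) bound_nonneg[of f C] by (intro integrable_bounded[where C=C]) (auto simp: indicator_def)
  have "(LINT \<omega>|M. f \<omega> * of_bool (\<forall>i<k. counts T (m i) (\<tau> i) (\<tau> (Suc i)) \<omega>)) = (LINT \<omega>|M. f \<omega> * indicator ?A \<omega>)"
    by (rule Bochner_Integration.integral_cong) (auto simp: indicator_def)
  also have "\<dots> = (LINT \<omega>|M. f \<omega> * real_cond_exp M ?F (indicator ?A) \<omega>)"
    using int f by (intro F.real_cond_exp_intg(2)[symmetric]) auto
  also have "\<dots> = (LINT \<omega>|M. f \<omega> * (\<Prod>i<k. pois (m i) (cum (\<tau> i) (\<tau> (Suc i)) \<omega>)))"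
    using ce by (rule integral_cong_AE[rotated 2]) (use pm in auto)
  finally show ?thesis .
qed

text \<open>
The counting condition of the model speaks of finite counts only; that there are no
accumulation points of arrivals follows since the Poisson probabilities sum to 1.
\<close>

lemma AE_counts_finite:
  assumes "0 \<le> u" "u < v"
  shows "AE \<omega> in M. finite (arrivals_in T u v \<omega>)"
proof -
  let ?A = "\<lambda>m. {\<omega>\<in>space M. counts T m u v \<omega>}"
  have A: "?A m \<in> sets M" for m by measurable
  have pr: "prob (?A m) = (LINT \<omega>|M. pois m (cum u v \<omega>))" for m
    using poisson_counts[of "\<lambda>_. 1" 1 "\<lambda>i. if i = 0 then u else v" 1 "\<lambda>_. m"] assms
    by (simp add: expectation_of_bool[OF A])
  have "disjoint_family ?A" by (auto simp: disjoint_family_on_def counts_def)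
  with A have "(\<lambda>m. prob (?A m)) sums prob (\<Union>m. ?A m)"
    by (intro finite_measure_UNION) auto
  then have 1: "(\<lambda>K. \<Sum>m<K. prob (?A m)) \<longlonglongrightarrow> prob (\<Union>m. ?A m)" by (simp add: sums_def)
  have [measurable]: "cum u v \<in> borel_measurable M" using assms by (intro cum_measurable)
  have c0: "0 < cum u v \<omega>" if "\<omega> \<in> space M" for \<omega> using cum_pos assms that by auto
  have int: "integrable M (\<lambda>\<omega>. pois m (cum u v \<omega>))" for m
    using pois_le_1 c0 by (intro integrable_bounded[where C=1]) (auto simp: less_imp_le)
  have "(\<lambda>K. LINT \<omega>|M. (\<Sum>m<K. pois m (cum u v \<omega>))) \<longlonglongrightarrow> (LINT \<omega>|M. 1)"
  proof (rule integral_dominated_convergence[where w="\<lambda>_. 1"])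
    have s: "(\<lambda>m. pois m r) sums 1" for r :: real
    proof -
      have "(\<lambda>m. r ^ m /\<^sub>R fact m * exp (-r)) sums (exp r * exp (-r))"
        by (intro sums_mult2 exp_converges)
      then show ?thesis by (simp add: pois_def divide_inverse mult_ac flip: exp_add)
    qed
    then show "AE \<omega> in M. (\<lambda>K. \<Sum>m<K. pois m (cum u v \<omega>)) \<longlonglongrightarrow> 1"
      by (simp add: sums_def)
    show "AE \<omega> in M. norm (\<Sum>m<K. pois m (cum u v \<omega>)) \<le> 1" for K
    proof (rule AE_I2)
      fix \<omega> assume "\<omega> \<in> space M"
      then have p: "0 \<le> pois m (cum u v \<omega>)" for m using c0[of \<omega>] by (simp add: pois_def)
      have "(\<Sum>m<K. pois m (cum u v \<omega>)) \<le> (\<Sum>m. pois m (cum u v \<omega>))"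
        using s p by (intro sum_le_suminf) (auto simp: sums_iff)
      then show "norm (\<Sum>m<K. pois m (cum u v \<omega>)) \<le> 1"
        using s[of "cum u v \<omega>"] p by (simp add: sums_iff sum_nonneg)
    qed
  qed auto
  then have "(\<lambda>K. \<Sum>m<K. prob (?A m)) \<longlonglongrightarrow> 1"
    using int by (simp add: pr prob_space)
  then have "prob (\<Union>m. ?A m) = 1" using 1 LIMSEQ_unique by blast
  then have "AE \<omega> in M. \<omega> \<in> (\<Union>m. ?A m)" using A by (subst (asm) prob_eq_1) auto
  then show ?thesis by eventually_elim (auto simp: counts_def)
qed

text \<open>
The first arrival takes place at time 0 and is not counted in \<open>(0, c]\<close>, whence the shift by
one.
\<close>

lemma arrival_le_iff:
  assumes w: "\<omega> \<in> space M" and c: "0 \<le> c" and n: "1 \<le> n" and fin: "finite (arrivals_in T 0 c \<omega>)"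
  shows "T n \<omega> \<le> c \<longleftrightarrow> n \<le> Suc (card (arrivals_in T 0 c \<omega>))"
proof
  let ?A = "arrivals_in T 0 c \<omega>"
  assume le: "T n \<omega> \<le> c"
  have "{2..n} \<subseteq> ?A"
  proof
    fix k assume k: "k \<in> {2..n}"
    have "T k \<omega> \<le> T n \<omega>" using T_less[OF w, of k n] k by (cases "k = n") auto
    moreover have "0 < T k \<omega>" using T_less[OF w, of 1 k] T_one[OF w] k by simp
    ultimately show "k \<in> ?A" using le k by (simp add: arrivals_in_def)
  qed
  from card_mono[OF fin this] show "n \<le> Suc (card ?A)" by simp
next
  let ?A = "arrivals_in T 0 c \<omega>"
  assume le: "n \<le> Suc (card ?A)"
  show "T n \<omega> \<le> c"
  proof (rule ccontr)
    assume gt: "\<not> T n \<omega> \<le> c"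
    then have n1: "n \<noteq> 1" using T_one[OF w] c by auto
    have "?A \<subseteq> {2..<n}"
    proof
      fix k assume k: "k \<in> ?A"
      then have kk: "1 \<le> k" "0 < T k \<omega>" "T k \<omega> \<le> c" by (auto simp: arrivals_in_def)
      have "k \<noteq> 1" using kk T_one[OF w] by auto
      moreover have "k < n" using kk gt T_less[OF w n, of k] by (cases k n rule: linorder_cases) auto
      ultimately show "k \<in> {2..<n}" using kk by auto
    qed
    from card_mono[OF _ this] show False using le n n1 by simp
  qed
qed

lemma counts_grid:
  fixes \<tau> :: "nat \<Rightarrow> real"
  assumes \<tau>: "\<tau> 0 = 0" "\<And>i. i < k \<Longrightarrow> \<tau> i < \<tau> (Suc i)"
    and c: "\<And>i. i < k \<Longrightarrow> counts T (m i) (\<tau> i) (\<tau> (Suc i)) \<omega>" and "p \<le> k"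
  shows "counts T (\<Sum>i<p. m i) 0 (\<tau> p) \<omega>" "0 \<le> \<tau> p"
proof -
  have "counts T (\<Sum>i<p. m i) 0 (\<tau> p) \<omega> \<and> 0 \<le> \<tau> p" using \<open>p \<le> k\<close>
  proof (induction p)
    case 0
    have "arrivals_in T 0 0 \<omega> = {}" by (auto simp: arrivals_in_def)
    then show ?case using \<tau> by (simp add: counts_def)
  next
    case (Suc p)
    then have IH: "counts T (\<Sum>i<p. m i) 0 (\<tau> p) \<omega>" "0 \<le> \<tau> p" by auto
    have lt: "\<tau> p < \<tau> (Suc p)" and cp: "counts T (m p) (\<tau> p) (\<tau> (Suc p)) \<omega>" using Suc \<tau> c by auto
    have "arrivals_in T 0 (\<tau> (Suc p)) \<omega> = arrivals_in T 0 (\<tau> p) \<omega> \<union> arrivals_in T (\<tau> p) (\<tau> (Suc p)) \<omega>"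
      using IH(2) lt by (auto simp: arrivals_in_def)
    moreover have "arrivals_in T 0 (\<tau> p) \<omega> \<inter> arrivals_in T (\<tau> p) (\<tau> (Suc p)) \<omega> = {}"
      by (auto simp: arrivals_in_def)
    ultimately show ?case using IH cp lt by (auto simp: counts_def card_Un_disjoint)
  qed
  then show "counts T (\<Sum>i<p. m i) 0 (\<tau> p) \<omega>" "0 \<le> \<tau> p" by auto
qed

lemma arrival_le_grid:
  fixes \<tau> :: "nat \<Rightarrow> real"
  assumes "\<tau> 0 = 0" "\<And>i. i < k \<Longrightarrow> \<tau> i < \<tau> (Suc i)"
    and "\<And>i. i < k \<Longrightarrow> counts T (m i) (\<tau> i) (\<tau> (Suc i)) \<omega>" and "p \<le> k"
    and "\<omega> \<in> space M" "1 \<le> n"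
  shows "T n \<omega> \<le> \<tau> p \<longleftrightarrow> n \<le> Suc (\<Sum>i<p. m i)"
  using counts_grid[of \<tau> k m \<omega> p] assms arrival_le_iff[of \<omega> "\<tau> p" n] by (auto simp: counts_def)

text \<open>
A generator, stable under intersection, of the information that is available at time \<open>t\<close>
about the background and the arrivals.
\<close>

definition past_sets :: "real \<Rightarrow> 'w set set" where
  "past_sets t = {{\<omega>\<in>H. \<forall>(n, c)\<in>R. T n \<omega> \<le> c} | H R.
     H \<in> sets (history M X t) \<and> finite R \<and> R \<subseteq> {1..} \<times> {0..t}}"

definition past :: "real \<Rightarrow> 'w measure" where
  "past t = sigma (space M) (past_sets t)"

text \<open>
The event that the background is in \<open>i\<close> at time \<open>t\<close> and in \<open>j\<close> at time \<open>t + h\<close>, with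
\<open>m\<close> arrivals in between.
\<close>

definition slot :: "nat \<Rightarrow> real \<Rightarrow> real \<Rightarrow> 'n \<Rightarrow> 'n \<Rightarrow> 'w \<Rightarrow> real" where
  "slot m t h i j \<omega> = of_bool (X t \<omega> = i) * of_bool (counts T m t (t + h) \<omega>) * of_bool (X (t + h) \<omega> = j)"

lemma history_sets: "H \<in> sets (history M X t) \<Longrightarrow> H \<in> sets M"
  using subalgebra_history[of t] by (auto simp: subalgebra_def)

lemma past_sets_sub: "past_sets t \<subseteq> sets M"
proof
  fix A assume "A \<in> past_sets t"
  then obtain H R where A: "A = {\<omega>\<in>H. \<forall>(n, c)\<in>R. T n \<omega> \<le> c}" and H: "H \<in> sets (history M X t)"
    and R: "finite R" "R \<subseteq> {1..} \<times> {0..t}" unfolding past_sets_def by blast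
  have [measurable]: "H \<in> sets M" by (rule history_sets[OF H])
  have sub: "H \<subseteq> space M" using history_sets[OF H] by (rule sets.sets_into_space)
  have "Measurable.pred M (\<lambda>\<omega>. \<forall>x\<in>R. T (fst x) \<omega> \<le> snd x)"
  proof (rule pred_intros_finite(3)[OF R(1)])
    fix x assume "x \<in> R"
    then have [measurable]: "T (fst x) \<in> borel_measurable M" using R by (intro T_meas) auto
    show "Measurable.pred M (\<lambda>\<omega>. T (fst x) \<omega> \<le> snd x)" by measurable
  qed
  then have "{\<omega>\<in>space M. \<omega> \<in> H \<and> (\<forall>x\<in>R. T (fst x) \<omega> \<le> snd x)} \<in> sets M" by measurable
  also have "{\<omega>\<in>space M. \<omega> \<in> H \<and> (\<forall>x\<in>R. T (fst x) \<omega> \<le> snd x)} = A"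
    unfolding A using sub by (auto simp: case_prod_beta)
  finally show "A \<in> sets M" .
qed

lemma space_past [simp]: "space (past t) = space M"
  using past_sets_sub[of t] sets.sets_into_space by (auto simp: past_def intro!: space_measure_of)

lemma sets_past: "sets (past t) = sigma_sets (space M) (past_sets t)"
  using past_sets_sub[of t] sets.sets_into_space by (auto simp: past_def intro!: sets_measure_of)

lemma subalgebra_past: "subalgebra M (past t)"
  using past_sets_sub[of t] by (auto simp: subalgebra_def sets_past intro!: sets.sigma_sets_subset)

lemma slot_01: "slot m t h i j \<omega> = 0 \<or> slot m t h i j \<omega> = 1"
  by (auto simp: slot_def)

lemma slot_bounds: "0 \<le> slot m t h i j \<omega>" "slot m t h i j \<omega> \<le> 1" "\<bar>slot m t h i j \<omega>\<bar> \<le> 1"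
  using slot_01[of m t h i j \<omega>] by auto

lemma slot_meas:
  assumes "0 \<le> t" "0 \<le> h" shows "slot m t h i j \<in> borel_measurable M"
proof -
  have [measurable]: "X t \<in> measurable M (count_space UNIV)" "X (t + h) \<in> measurable M (count_space UNIV)"
    using assms by (auto intro!: X_meas)
  show ?thesis unfolding slot_def by measurable
qed

lemma expectation_slot:
  assumes "0 \<le> t" "0 < h"
  shows "(LINT \<omega>|M. slot m t h i j \<omega>)
       = (LINT \<omega>|M. of_bool (X t \<omega> = i) * (pois m (cum t (t + h) \<omega>) * of_bool (X (t + h) \<omega> = j)))"
proof -
  have [measurable]: "X t \<in> measurable (background M X) (count_space UNIV)"
    "X (t + h) \<in> measurable (background M X) (count_space UNIV)"
    using assms by (auto intro!: X_background)
  let ?f = "\<lambda>\<omega>. of_bool (X t \<omega> = i) * of_bool (X (t + h) \<omega> = j) :: real"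
  have f: "?f \<in> borel_measurable (background M X)" by measurable
  have "(LINT \<omega>|M. ?f \<omega> * of_bool (counts T m t (t + h) \<omega>)) = (LINT \<omega>|M. ?f \<omega> * pois m (cum t (t + h) \<omega>))"
    using poisson_counts[OF f, of 1 "\<lambda>i. if i = 0 then t else t + h" 1 "\<lambda>_. m"] assms by simp
  then show ?thesis by (simp add: slot_def mult_ac)
qed

text \<open>
Given \<open>X t = i\<close>, the events of the next cell are independent of the past.  A set of the
generator is decomposed according to the vector of counts on a grid that contains all its
epochs.  Within one part of the decomposition the conditions on the arrival epochs are
either void or contradictory, and the counts can be replaced by Poisson probabilities: those
of the grid depend on the history only, the last one on the future only, and
\<open>markov_future\<close> separates them.
\<close>

lemma orth_past:
  assumes t: "0 \<le> t" "0 < h"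
  shows "orth M (sets (past t)) (\<lambda>\<omega>. prob {\<omega>\<in>space M. X t \<omega> = i} * slot m t h i j \<omega>
            - (LINT \<omega>|M. slot m t h i j \<omega>) * of_bool (X t \<omega> = i))"
proof -
  define p where "p = prob {\<omega>\<in>space M. X t \<omega> = i}"
  define e where "e = (LINT \<omega>|M. slot m t h i j \<omega>)"
  define D where "D \<omega> = p * slot m t h i j \<omega> - e * of_bool (X t \<omega> = i)" for \<omega>
  have [measurable]: "X t \<in> measurable M (count_space UNIV)" "X (t + h) \<in> measurable M (count_space UNIV)"
    using t by (auto intro!: X_meas)
  note [measurable] = slot_meas[OF t(1) less_imp_le[OF t(2)]]
  have ints: "integrable M (slot m t h i j)"
    using slot_bounds by (intro integrable_bounded[where C=1]) auto
  have inti: "integrable M (\<lambda>\<omega>. of_bool (X t \<omega> = i) :: real)"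
    by (intro integrable_bounded[where C=1]) auto
  have intD: "integrable M D" unfolding D_def using ints inti by auto
  have pE: "(LINT \<omega>|M. of_bool (X t \<omega> = i)) = p" unfolding p_def using t by (intro expectation_of_bool X_sets)
  have D0: "(LINT \<omega>|M. D \<omega>) = 0"
    unfolding D_def using ints inti by (simp add: pE flip: e_def)
  have stable: "Int_stable (past_sets t)"
  proof (rule Int_stableI)
    fix a b assume "a \<in> past_sets t" "b \<in> past_sets t"
    then obtain H R H' R' where a: "a = {\<omega>\<in>H. \<forall>(n, c)\<in>R. T n \<omega> \<le> c}" "H \<in> sets (history M X t)" "finite R" "R \<subseteq> {1..} \<times> {0..t}"
      and b: "b = {\<omega>\<in>H'. \<forall>(n, c)\<in>R'. T n \<omega> \<le> c}" "H' \<in> sets (history M X t)" "finite R'" "R' \<subseteq> {1..} \<times> {0..t}"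
      unfolding past_sets_def by blast
    have "a \<inter> b = {\<omega>\<in>H \<inter> H'. \<forall>(n, c)\<in>R \<union> R'. T n \<omega> \<le> c}" unfolding a b by auto
    then show "a \<inter> b \<in> past_sets t" unfolding past_sets_def using a b
      by (intro CollectI exI[of _ "H \<inter> H'"] exI[of _ "R \<union> R'"]) auto
  qed
  have "orth M (past_sets t) D"
    unfolding orth_def
  proof
    fix A assume A_in: "A \<in> past_sets t"
    then obtain H R where A: "A = {\<omega>\<in>H. \<forall>(n, c)\<in>R. T n \<omega> \<le> c}" and H: "H \<in> sets (history M X t)"
      and R: "finite R" "R \<subseteq> {1..} \<times> {0..t}" unfolding past_sets_def by blast
    have AM [measurable]: "A \<in> sets M" using A_in past_sets_sub by auto
    have HM [measurable]: "H \<in> sets M" by (rule history_sets[OF H])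
    have HS: "H \<subseteq> space M" using HM by (rule sets.sets_into_space)
    have "finite (snd ` R)" "snd ` R \<subseteq> {0..t}" using R by auto
    from ex_grid[OF this t(1)] obtain k \<tau> where \<tau>: "\<tau> 0 = 0" "\<tau> k = t" "\<And>i. i < k \<Longrightarrow> \<tau> i < \<tau> (Suc i)"
      and mem: "\<And>c. c \<in> snd ` R \<Longrightarrow> \<exists>p\<le>k. c = \<tau> p" by metis
    let ?cell = "\<lambda>mv \<omega>. \<forall>i<k. counts T (mv i) (\<tau> i) (\<tau> (Suc i)) \<omega>"
    \<comment> \<open>The count vectors are enumerated through their codes; requiring \<open>to_nat\<close> of the vector to be \<open>q\<close> makes the parts disjoint.\<close>
    define A' where "A' q = {\<omega>\<in>space M. \<omega> \<in> A \<and> length (from_nat q :: nat list) = k \<and>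
        to_nat (from_nat q :: nat list) = q \<and> ?cell (\<lambda>i. (from_nat q :: nat list) ! i) \<omega>}" for q
    have A'M: "A' q \<in> sets M" for q unfolding A'_def by measurable
    have disj: "A' q \<inter> A' q' = {}" if "q \<noteq> q'" for q q'
    proof (rule ccontr)
      assume "A' q \<inter> A' q' \<noteq> {}"
      then obtain \<omega> where "\<omega> \<in> A' q" "\<omega> \<in> A' q'" by auto
      then have "(from_nat q :: nat list) = from_nat q'"
        by (intro nth_equalityI) (auto simp: A'_def counts_def)
      then have "to_nat (from_nat q :: nat list) = to_nat (from_nat q' :: nat list)" by simp
      with \<open>\<omega> \<in> A' q\<close> \<open>\<omega> \<in> A' q'\<close> show False using that by (simp add: A'_def)
    qed
    have zero: "(LINT \<omega>|M. indicator (A' q) \<omega> * D \<omega>) = 0" for q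
    proof -
      define mv where "mv i = (from_nat q :: nat list) ! i" for i
      from mem obtain pc where pc: "\<And>c. c \<in> snd ` R \<Longrightarrow> pc c \<le> k \<and> c = \<tau> (pc c)" by metis
      define ok where "ok \<longleftrightarrow> length (from_nat q :: nat list) = k \<and> to_nat (from_nat q :: nat list) = q \<and>
        (\<forall>(n, c)\<in>R. n \<le> Suc (\<Sum>i<pc c. mv i))"
      have A'_iff: "\<omega> \<in> A' q \<longleftrightarrow> ok \<and> \<omega> \<in> H \<and> ?cell mv \<omega>" for \<omega>
      proof -
        have "(\<forall>(n, c)\<in>R. T n \<omega> \<le> c) \<longleftrightarrow> (\<forall>(n, c)\<in>R. n \<le> Suc (\<Sum>i<pc c. mv i))"
          if "\<omega> \<in> space M" "?cell mv \<omega>"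
        proof (intro ball_cong refl, clarify)
          fix n c assume nc: "(n, c) \<in> R"
          have "pc c \<le> k" "c = \<tau> (pc c)" using pc[of c] nc by force+
          moreover have "1 \<le> n" using nc R by auto
          ultimately show "(T n \<omega> \<le> c) = (n \<le> Suc (\<Sum>i<pc c. mv i))"
            using arrival_le_grid[of \<tau> k mv \<omega> "pc c" n] \<tau> that by auto
        qed
        then show ?thesis using HS unfolding A'_def ok_def A mv_def by auto
      qed
      show ?thesis
      proof (cases ok)
        case False
        then have "A' q = {}" using A'_iff by auto
        then show ?thesis by simp
      next
        case True
        \<comment> \<open>The grid of the past, extended by the cell under consideration.\<close>
        define \<tau>' where "\<tau>' = \<tau>(Suc k := t + h)"
        define m' where "m' = (\<lambda>i. if i < k then mv i else m)"
        have \<tau>'_inc: "\<tau>' i < \<tau>' (Suc i)" if "i < Suc k" for i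
          using that \<tau> t by (cases "i = k") (auto simp: \<tau>'_def)
        have cell': "?cell mv \<omega> \<and> counts T m t (t + h) \<omega> \<longleftrightarrow> (\<forall>i<Suc k. counts T (m' i) (\<tau>' i) (\<tau>' (Suc i)) \<omega>)" for \<omega>
          using \<tau> by (auto simp: less_Suc_eq m'_def \<tau>'_def)
        define g where "g \<omega> = indicator H \<omega> * (\<Prod>i<k. pois (mv i) (cum (\<tau> i) (\<tau> (Suc i)) \<omega>))" for \<omega>
        have \<tau>_le: "\<tau> i \<le> \<tau> j" if "i \<le> j" "j \<le> k" for i j
          using that
        proof (induction j)
          case (Suc j) then show ?case using \<tau>(3)[of j] by (cases "i = Suc j") auto
        qed simp
        have cumH: "cum (\<tau> i) (\<tau> (Suc i)) \<in> borel_measurable (history M X t)" if "i < k" for i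
          using cum_history[of "\<tau> i" "\<tau> (Suc i)"] subalgebra_history_mono[of "\<tau> (Suc i)" t M X]
            \<tau>_le[of 0 i] \<tau>_le[of "Suc i" k] \<tau> that by (auto intro: measurable_from_subalg)
        have gH: "g \<in> borel_measurable (history M X t)"
          unfolding g_def
        proof (intro borel_measurable_times borel_measurable_prod)
          show "indicator H \<in> borel_measurable (history M X t)" using H by simp
          fix i assume "i \<in> {..<k}"
          then have [measurable]: "cum (\<tau> i) (\<tau> (Suc i)) \<in> borel_measurable (history M X t)" by (intro cumH) auto
          show "(\<lambda>\<omega>. pois (mv i) (cum (\<tau> i) (\<tau> (Suc i)) \<omega>)) \<in> borel_measurable (history M X t)" by measurable
        qed
        have gb: "\<bar>g \<omega>\<bar> \<le> 1" if "\<omega> \<in> space M" for \<omega>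
        proof -
          have "\<bar>\<Prod>i<k. pois (mv i) (cum (\<tau> i) (\<tau> (Suc i)) \<omega>)\<bar> \<le> 1"
            unfolding abs_prod
          proof (rule prod_le_1, safe)
            fix i assume "i < k"
            then have "0 < cum (\<tau> i) (\<tau> (Suc i)) \<omega>" using that \<tau> \<tau>_le[of 0 i] by (intro cum_pos) auto
            then show "\<bar>pois (mv i) (cum (\<tau> i) (\<tau> (Suc i)) \<omega>)\<bar> \<le> 1" by (intro pois_le_1) auto
          qed auto
          then show ?thesis by (auto simp: g_def indicator_def abs_mult)
        qed
        have [measurable]: "X t \<in> measurable (background M X) (count_space UNIV)"
          "X (t + h) \<in> measurable (background M X) (count_space UNIV)"
          using t by (auto intro!: X_background)
        have [measurable]: "H \<in> sets (background M X)"
          using H subalgebra_background_history[of M X t] by (auto simp: subalgebra_def)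
        have 1: "(LINT \<omega>|M. indicator H \<omega> * of_bool (?cell mv \<omega>) * slot m t h i j \<omega>)
            = (LINT \<omega>|M. g \<omega> * of_bool (X t \<omega> = i) * (pois m (cum t (t + h) \<omega>) * of_bool (X (t + h) \<omega> = j)))"
        proof -
          let ?f = "\<lambda>\<omega>. indicator H \<omega> * of_bool (X t \<omega> = i) * of_bool (X (t + h) \<omega> = j) :: real"
          have "(LINT \<omega>|M. indicator H \<omega> * of_bool (?cell mv \<omega>) * slot m t h i j \<omega>)
            = (LINT \<omega>|M. ?f \<omega> * of_bool (\<forall>i<Suc k. counts T (m' i) (\<tau>' i) (\<tau>' (Suc i)) \<omega>))"
            unfolding cell'[symmetric] slot_def by (rule Bochner_Integration.integral_cong) auto
          also have "\<dots> = (LINT \<omega>|M. ?f \<omega> * (\<Prod>i<Suc k. pois (m' i) (cum (\<tau>' i) (\<tau>' (Suc i)) \<omega>)))"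
            by (rule poisson_counts[where C=1]) (use \<tau> \<tau>'_inc in \<open>auto simp: \<tau>'_def indicator_def\<close>)
          also have "(\<lambda>\<omega>. \<Prod>i<Suc k. pois (m' i) (cum (\<tau>' i) (\<tau>' (Suc i)) \<omega>))
             = (\<lambda>\<omega>. (\<Prod>i<k. pois (mv i) (cum (\<tau> i) (\<tau> (Suc i)) \<omega>)) * pois m (cum t (t + h) \<omega>))"
            using \<tau> by (auto simp: fun_eq_iff m'_def \<tau>'_def intro!: prod.cong)
          finally show ?thesis by (simp add: g_def mult_ac)
        qed
        have 2: "(LINT \<omega>|M. indicator H \<omega> * of_bool (?cell mv \<omega>) * of_bool (X t \<omega> = i))
            = (LINT \<omega>|M. g \<omega> * of_bool (X t \<omega> = i))"
        proof -
          let ?f = "\<lambda>\<omega>. indicator H \<omega> * of_bool (X t \<omega> = i) :: real"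
          have "(LINT \<omega>|M. ?f \<omega> * of_bool (?cell mv \<omega>))
            = (LINT \<omega>|M. ?f \<omega> * (\<Prod>i<k. pois (mv i) (cum (\<tau> i) (\<tau> (Suc i)) \<omega>)))"
            by (rule poisson_counts[where C=1]) (use \<tau> in \<open>auto simp: indicator_def\<close>)
          then show ?thesis by (simp add: g_def mult_ac)
        qed
        have cm: "Measurable.pred M (?cell mv)" by measurable
        note [measurable] = cm
        have "(LINT \<omega>|M. indicator (A' q) \<omega> * D \<omega>)
           = (LINT \<omega>|M. p * (indicator H \<omega> * of_bool (?cell mv \<omega>) * slot m t h i j \<omega>)
               - e * (indicator H \<omega> * of_bool (?cell mv \<omega>) * of_bool (X t \<omega> = i)))"
          by (rule Bochner_Integration.integral_cong)
             (auto simp: indicator_def A'_iff True D_def)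
        also have "\<dots> = p * (LINT \<omega>|M. indicator H \<omega> * of_bool (?cell mv \<omega>) * slot m t h i j \<omega>)
               - e * (LINT \<omega>|M. indicator H \<omega> * of_bool (?cell mv \<omega>) * of_bool (X t \<omega> = i))"
        proof (subst Bochner_Integration.integral_diff)
          show "integrable M (\<lambda>\<omega>. p * (indicator H \<omega> * of_bool (?cell mv \<omega>) * slot m t h i j \<omega>))"
            by (intro integrable_mult_right integrable_bounded[where C=1])
               (use slot_bounds in \<open>auto simp: indicator_def\<close>)
          show "integrable M (\<lambda>\<omega>. e * (indicator H \<omega> * of_bool (?cell mv \<omega>) * of_bool (X t \<omega> = i)))"
            by (intro integrable_mult_right integrable_bounded[where C=1]) (auto simp: indicator_def)
        qed simp
        also have "\<dots> = 0"
          using markov_future[OF gH gb t, of i m j] unfolding 1 2 expectation_slot[OF t, symmetric] p_def[symmetric] e_def[symmetric]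
          by (simp add: mult.commute)
        finally show ?thesis .
      qed
    qed
    have "AE \<omega> in M. \<forall>i\<in>{..<k}. finite (arrivals_in T (\<tau> i) (\<tau> (Suc i)) \<omega>)"
    proof (rule AE_finite_allI)
      fix i assume i: "i \<in> {..<k}"
      have "0 \<le> \<tau> i" if "i \<le> k" for i using that
      proof (induction i)
        case (Suc i) then show ?case using \<tau>(3)[of i] by auto
      qed (simp add: \<tau>)
      then show "AE \<omega> in M. finite (arrivals_in T (\<tau> i) (\<tau> (Suc i)) \<omega>)"
        using i \<tau> by (intro AE_counts_finite) auto
    qed simp
    then have cover: "AE \<omega> in M. indicator A \<omega> * D \<omega> = indicator (\<Union>q. A' q) \<omega> * D \<omega>"
      using AE_space
    proof eventually_elim
      case (elim \<omega>)
      define mv where "mv = map (\<lambda>i. card (arrivals_in T (\<tau> i) (\<tau> (Suc i)) \<omega>)) [0..<k]"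
      have "\<omega> \<in> A' (to_nat mv)" if "\<omega> \<in> A"
        using that elim unfolding A'_def by (auto simp: mv_def counts_def)
      moreover have "\<omega> \<in> A" if "\<omega> \<in> A' q" for q using that by (simp add: A'_def)
      ultimately show ?case by (auto simp: indicator_def)
    qed
    have UM: "(\<Union>q. A' q) \<in> sets M" using A'M by auto
    have "(LINT \<omega>|M. indicator A \<omega> * D \<omega>) = (LINT \<omega>|M. indicator (\<Union>q. A' q) \<omega> * D \<omega>)"
      by (rule integral_cong_AE[OF _ _ cover]) (use intD UM in auto)
    also have "\<dots> = (LINT \<omega>:(\<Union>q. A' q)|M. D \<omega>)" by (simp add: set_lebesgue_integral_def)
    also have "\<dots> = (\<Sum>q. (LINT \<omega>:(A' q)|M. D \<omega>))"
      using disj A'M integrable_mult_indicator[OF UM intD]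
      by (intro lebesgue_integral_countable_add) (auto simp: set_integrable_def)
    also have "\<dots> = 0" using zero by (simp add: set_lebesgue_integral_def)
    finally show "(LINT \<omega>|M. indicator A \<omega> * D \<omega>) = 0" .
  qed
  then show ?thesis
    unfolding sets_past p_def[symmetric] e_def[symmetric]
    using orth_sigma_sets[OF intD D0 past_sets_sub stable] by (simp add: D_def[abs_def])
qed

section \<open>Arrival states and services\<close>

abbreviation Y :: "nat \<Rightarrow> 'w \<Rightarrow> 'n" where "Y \<equiv> arrival_state X T"

abbreviation BA :: "'w measure" where "BA \<equiv> background_arrivals M X T"

lemma space_BA [simp]: "space BA = space M"
  unfolding background_arrivals_def by (auto intro!: space_measure_of)

lemma T_sets: "1 \<le> n \<Longrightarrow> {\<omega>\<in>space M. T n \<omega> \<le> c} \<in> sets M"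
proof -
  assume "1 \<le> n"
  then have [measurable]: "T n \<in> borel_measurable M" by (rule T_meas)
  show ?thesis by measurable
qed

lemma sets_BA: "sets BA = sigma_sets (space M)
     ({{\<omega>\<in>space M. X u \<omega> = i} | u i. 0 \<le> u} \<union> {{\<omega>\<in>space M. T n \<omega> \<le> c} | n c. 1 \<le> n})"
  unfolding background_arrivals_def by (intro sets_measure_of) auto

lemma subalgebra_BA: "subalgebra M BA"
  unfolding subalgebra_def sets_BA using X_sets T_sets
  by (auto intro!: sets.sigma_sets_subset)

lemma T_BA: "1 \<le> n \<Longrightarrow> T n \<in> borel_measurable BA"
  by (subst borel_measurable_iff_le) (auto simp: sets_BA intro!: sigma_sets.Basic)

lemma X_BA: "0 \<le> u \<Longrightarrow> X u \<in> measurable BA (count_space UNIV)"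
  by (intro measurable_countI) (auto simp: sets_BA intro!: sigma_sets.Basic)

lemma subalgebra_BA_background: "subalgebra BA (background M X)"
  unfolding subalgebra_def sets_BA sets_background by (auto intro!: sigma_sets_mono')

lemma subalgebra_BA_past: "subalgebra BA (past t)"
proof -
  have "past_sets t \<subseteq> sets BA"
  proof
    fix A assume "A \<in> past_sets t"
    then obtain H R where A: "A = {\<omega>\<in>H. \<forall>(n, c)\<in>R. T n \<omega> \<le> c}" and H: "H \<in> sets (history M X t)"
      and R: "finite R" "R \<subseteq> {1..} \<times> {0..t}" unfolding past_sets_def by blast
    have [measurable]: "H \<in> sets BA"
      using H subalgebra_background_history[of M X t] subalgebra_BA_background by (auto simp: subalgebra_def)
    have sub: "H \<subseteq> space M" using history_sets[OF H] by (rule sets.sets_into_space)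
    have "Measurable.pred BA (\<lambda>\<omega>. \<forall>x\<in>R. T (fst x) \<omega> \<le> snd x)"
    proof (rule pred_intros_finite(3)[OF R(1)])
      fix x assume "x \<in> R"
      then have [measurable]: "T (fst x) \<in> borel_measurable BA" using R by (intro T_BA) auto
      show "Measurable.pred BA (\<lambda>\<omega>. T (fst x) \<omega> \<le> snd x)" by measurable
    qed
    then have "{\<omega>\<in>space BA. \<omega> \<in> H \<and> (\<forall>x\<in>R. T (fst x) \<omega> \<le> snd x)} \<in> sets BA" by measurable
    also have "{\<omega>\<in>space BA. \<omega> \<in> H \<and> (\<forall>x\<in>R. T (fst x) \<omega> \<le> snd x)} = A"
      unfolding A using sub by (auto simp: case_prod_beta)
    finally show "A \<in> sets BA" .
  qed
  then show ?thesis using sets.sigma_sets_subset[of "past_sets t" BA] by (simp add: subalgebra_def sets_past)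
qed

lemma subalgebra_past_history: "subalgebra (past t) (history M X t)"
proof -
  have "H \<in> sigma_sets (space M) (past_sets t)" if H: "H \<in> sets (history M X t)" for H
    using H unfolding past_sets_def by (intro sigma_sets.Basic CollectI exI[of _ H] exI[of _ "{}"]) auto
  then show ?thesis by (auto simp: subalgebra_def sets_past)
qed

lemma X_past: "0 \<le> u \<Longrightarrow> u \<le> t \<Longrightarrow> X u \<in> measurable (past t) (count_space UNIV)"
  using subalgebra_past_history X_history by (rule measurable_from_subalg)

lemma T_past_sets:
  assumes "1 \<le> n" "0 \<le> c" "c \<le> t"
  shows "{\<omega>\<in>space M. T n \<omega> \<le> c} \<in> sets (past t)"
  unfolding sets_past past_sets_def using assms
  by (intro sigma_sets.Basic CollectI exI[of _ "space M"] exI[of _ "{(n, c)}"])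
     (auto simp: sets.top[of "history M X t", simplified])

lemma min_T_past:
  assumes n: "1 \<le> n" and t: "0 \<le> t"
  shows "(\<lambda>\<omega>. min (T n \<omega>) t) \<in> borel_measurable (past t)"
proof (subst borel_measurable_iff_le, intro allI)
  fix c
  consider "c < 0" | "0 \<le> c" "c < t" | "t \<le> c" by linarith
  then have "{\<omega>\<in>space M. min (T n \<omega>) t \<le> c} \<in> sets (past t)"
  proof cases
    case 1
    then have "{\<omega>\<in>space M. min (T n \<omega>) t \<le> c} = {}" using T_nonneg[of _ n] n t by force
    then show ?thesis by (simp only: sets.empty_sets)
  next
    case 2
    then have "{\<omega>\<in>space M. min (T n \<omega>) t \<le> c} = {\<omega>\<in>space M. T n \<omega> \<le> c}" by auto
    then show ?thesis using T_past_sets[of n c t] n 2 by simp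
  next
    case 3
    then have "{\<omega>\<in>space M. min (T n \<omega>) t \<le> c} = space (past t)" by auto
    then show ?thesis by (simp only: sets.top)
  qed
  then show "{\<omega>\<in>space (past t). min (T n \<omega>) t \<le> c} \<in> sets (past t)" by simp
qed

text \<open>
The state at a random epoch is reached through approximations of the epoch from the right; those
with values on a grid take countably many values, which yields measurability.
\<close>

lemma X_approx:
  assumes w: "\<omega> \<in> space M" and u: "0 \<le> u"
    and v: "\<And>q. u \<le> v q" "v \<longlonglongrightarrow> u"
  shows "\<forall>\<^sub>F q in sequentially. X (v q) \<omega> = X u \<omega>"
proof -
  from X_rc[OF w u] obtain b where b: "b > u" "\<And>y. u < y \<Longrightarrow> y < b \<Longrightarrow> X y \<omega> = X u \<omega>"
    by (auto simp: eventually_at_right_field)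
  have "\<forall>\<^sub>F q in sequentially. v q < b" using v(2) b(1) by (rule order_tendstoD)
  then show ?thesis
  proof eventually_elim
    case (elim q) then show ?case using b v(1)[of q] by (cases "v q = u") auto
  qed
qed

lemma ceiling_grid:
  fixes u :: real
  shows "u \<le> \<lceil>u * Suc q\<rceil> / Suc q" "\<lceil>u * Suc q\<rceil> / Suc q < u + 1 / Suc q"
proof -
  have "u * Suc q \<le> \<lceil>u * Suc q\<rceil>" "\<lceil>u * Suc q\<rceil> < u * Suc q + 1" by linarith+
  then show "u \<le> \<lceil>u * Suc q\<rceil> / Suc q" "\<lceil>u * Suc q\<rceil> / Suc q < u + 1 / Suc q"
    by (simp_all add: pos_le_divide_eq pos_divide_less_eq distrib_right)
qed

lemma ceiling_grid_lim:
  fixes u :: real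
  shows "(\<lambda>q. \<lceil>u * Suc q\<rceil> / Suc q) \<longlonglongrightarrow> u"
proof (rule tendsto_sandwich[of "\<lambda>_. u" _ _ "\<lambda>q. u + 1 / Suc q"])
  have "(\<lambda>q. u + 1 / Suc q) \<longlonglongrightarrow> u + 0"
    by (intro tendsto_intros LIMSEQ_Suc[OF lim_const_over_n])
  then show "(\<lambda>q. u + 1 / Suc q) \<longlonglongrightarrow> u" by simp
  show "\<forall>\<^sub>F q in sequentially. u \<le> \<lceil>u * Suc q\<rceil> / Suc q"
    by (intro always_eventually allI ceiling_grid)
  show "\<forall>\<^sub>F q in sequentially. \<lceil>u * Suc q\<rceil> / Suc q \<le> u + 1 / Suc q"
    by (intro always_eventually allI less_imp_le ceiling_grid)
qed simp

lemma X_at_T_past: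
  assumes n: "1 \<le> n" and t: "0 \<le> t"
  shows "(\<lambda>\<omega>. X (min (T n \<omega>) t) \<omega>) \<in> measurable (past t) (count_space UNIV)"
proof (rule measurable_countI)
  fix i
  define u where "u \<omega> = min (T n \<omega>) t" for \<omega>
  define v where "v q \<omega> = min (real (nat \<lceil>u \<omega> * Suc q\<rceil>) / Suc q) t" for q \<omega>
  have u [measurable]: "u \<in> borel_measurable (past t)" unfolding u_def using min_T_past[OF n t] .
  have u0: "0 \<le> u \<omega>" "u \<omega> \<le> t" if "\<omega> \<in> space M" for \<omega> using T_nonneg[OF that n] t by (auto simp: u_def)
  have vM [measurable]: "(\<lambda>\<omega>. X (v q \<omega>) \<omega>) \<in> measurable (past t) (count_space UNIV)" for q
  proof -
    have "(\<lambda>\<omega>. (\<lambda>k \<omega>. X (min (real k / Suc q) t) \<omega>) (nat \<lceil>u \<omega> * Suc q\<rceil>) \<omega>) \<in> measurable (past t) (count_space UNIV)"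
    proof (rule measurable_compose_countable[where f="\<lambda>k \<omega>. X (min (real k / Suc q) t) \<omega>"])
      show "X (min (real k / Suc q) t) \<in> measurable (past t) (count_space UNIV)" for k
        using t by (intro X_past) auto
      show "(\<lambda>\<omega>. nat \<lceil>u \<omega> * real (Suc q)\<rceil>) \<in> measurable (past t) (count_space UNIV)" by measurable
    qed
    then show ?thesis by (simp add: v_def)
  qed
  have ev: "\<forall>\<^sub>F q in sequentially. X (v q \<omega>) \<omega> = X (u \<omega>) \<omega>" if w: "\<omega> \<in> space M" for \<omega>
  proof (rule X_approx[OF w u0(1)[OF w]])
    have nn: "real (nat \<lceil>u \<omega> * Suc q\<rceil>) = \<lceil>u \<omega> * Suc q\<rceil>" for q using u0[OF w] by simp
    show "u \<omega> \<le> v q \<omega>" for q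
      using ceiling_grid(1)[of "u \<omega>" q] u0[OF w] unfolding v_def nn by simp
    have "(\<lambda>q. v q \<omega>) \<longlonglongrightarrow> min (u \<omega>) t"
      unfolding v_def nn by (intro tendsto_intros ceiling_grid_lim)
    then show "(\<lambda>q. v q \<omega>) \<longlonglongrightarrow> u \<omega>" using u0[OF w] by simp
  qed
  have "{\<omega>\<in>space M. X (u \<omega>) \<omega> = i} = {\<omega>\<in>space (past t). \<exists>q0. \<forall>q\<ge>q0. X (v q \<omega>) \<omega> = i}"
  proof (intro Collect_cong, safe)
    fix \<omega> assume "\<omega> \<in> space M" "i = X (u \<omega>) \<omega>"
    then show "\<exists>q0. \<forall>q\<ge>q0. X (v q \<omega>) \<omega> = X (u \<omega>) \<omega>"
      using ev[of \<omega>] by (auto simp: eventually_sequentially)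
  next
    fix \<omega> q0 assume "\<omega> \<in> space (past t)" "\<forall>q\<ge>q0. X (v q \<omega>) \<omega> = i"
    then have w: "\<omega> \<in> space M" and "\<forall>\<^sub>F q in sequentially. X (v q \<omega>) \<omega> = i" by (auto simp: eventually_sequentially)
    from eventually_conj[OF this(2) ev[OF w]] have "\<forall>\<^sub>F q in sequentially. X (u \<omega>) \<omega> = i"
      by (rule eventually_mono) auto
    then show "X (u \<omega>) \<omega> = i" by simp
  qed auto
  also have "\<dots> \<in> sets (past t)" by measurable
  finally show "{\<omega>\<in>space (past t). X (min (T n \<omega>) t) \<omega> = i} \<in> sets (past t)" by (simp add: u_def)
qed

lemma Y_BA: "1 \<le> n \<Longrightarrow> Y n \<in> measurable BA (count_space UNIV)"
proof (rule measurable_countI)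
  fix i assume n: "1 \<le> n"
  have [measurable]: "T n \<in> borel_measurable BA" using n by (rule T_BA)
  have [measurable]: "(\<lambda>\<omega>. X (min (T n \<omega>) (real m)) \<omega>) \<in> measurable BA (count_space UNIV)" for m :: nat
    using subalgebra_BA_past X_at_T_past[OF n of_nat_0_le_iff[of m]] by (rule measurable_from_subalg)
  have "Y n \<omega> = i \<longleftrightarrow> (\<exists>m::nat. T n \<omega> \<le> real m \<and> X (min (T n \<omega>) (real m)) \<omega> = i)" for \<omega>
    using real_arch_simple[of "T n \<omega>"] by (auto simp: arrival_state_def min_absorb1)
  then have "{\<omega>\<in>space BA. Y n \<omega> = i} = {\<omega>\<in>space BA. \<exists>m::nat. T n \<omega> \<le> real m \<and> X (min (T n \<omega>) (real m)) \<omega> = i}" by auto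
  also have "\<dots> \<in> sets BA" by measurable
  finally show "{\<omega>\<in>space BA. Y n \<omega> = i} \<in> sets BA" .
qed

lemma Y_meas: "1 \<le> n \<Longrightarrow> Y n \<in> measurable M (count_space UNIV)"
  using subalgebra_BA Y_BA by (rule measurable_from_subalg)

lemma S_meas: "1 \<le> n \<Longrightarrow> S n \<in> borel_measurable M"
  using services by (auto simp: modulated_services_def)

lemma S_le_meas: "Measurable.pred M (\<lambda>\<omega>. \<forall>k\<in>{1..n}. S k \<omega> \<le> x k)"
proof (rule pred_intros_finite(3))
  fix k assume "k \<in> {1..n}"
  then have [measurable]: "S k \<in> borel_measurable M" by (intro S_meas) auto
  show "Measurable.pred M (\<lambda>\<omega>. S k \<omega> \<le> x k)" by measurable
qed simp

abbreviation service_cdf :: "nat \<Rightarrow> (nat \<Rightarrow> real) \<Rightarrow> 'w \<Rightarrow> real" where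
  "service_cdf n x \<omega> \<equiv> (\<Prod>k=1..n. cdf (B (Y k \<omega>)) (x k))"

lemma cdf_B_bounds: "0 \<le> cdf (B i) x" "cdf (B i) x \<le> 1"
proof -
  have rd: "real_distribution (B i)" using service[of i] by (simp add: service_law_def)
  show "0 \<le> cdf (B i) x" "cdf (B i) x \<le> 1"
    using finite_borel_measure.cdf_nonneg[OF real_distribution.finite_borel_measure_M[OF rd]]
      real_distribution.cdf_bounded_prob[OF rd] by auto
qed

lemma service_integral:
  assumes f: "f \<in> borel_measurable BA" "\<And>\<omega>. \<omega> \<in> space M \<Longrightarrow> \<bar>f \<omega>\<bar> \<le> C"
  shows "(LINT \<omega>|M. f \<omega> * of_bool (\<forall>k\<in>{1..n}. S k \<omega> \<le> x k)) = (LINT \<omega>|M. f \<omega> * service_cdf n x \<omega>)"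
proof -
  interpret F: finite_measure_subalgebra M BA using subalgebra_BA by unfold_locales
  have fM [measurable]: "f \<in> borel_measurable M" using subalgebra_BA f(1) by (rule measurable_from_subalg)
  let ?A = "{\<omega>\<in>space M. \<forall>k\<in>{1..n}. S k \<omega> \<le> x k}"
  have A: "?A \<in> sets M"
    using S_le_meas[of n x] by measurable
  have ce: "AE \<omega> in M. real_cond_exp M BA (indicator ?A) \<omega> = service_cdf n x \<omega>"
    using services unfolding modulated_services_def by blast
  have pm: "(\<lambda>\<omega>. service_cdf n x \<omega>) \<in> borel_measurable M"
  proof (intro borel_measurable_prod)
    fix k assume "k \<in> {1..n}"
    then have "Y k \<in> measurable M (count_space UNIV)" by (intro Y_meas) auto
    then show "(\<lambda>\<omega>. cdf (B (Y k \<omega>)) (x k)) \<in> borel_measurable M"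
      by (rule measurable_compose) simp
  qed
  have int: "integrable M (\<lambda>\<omega>. f \<omega> * indicator ?A \<omega>)"
    using f(2) bound_nonneg[of f C] A by (intro integrable_bounded[where C=C]) (auto simp: indicator_def)
  have "(LINT \<omega>|M. f \<omega> * of_bool (\<forall>k\<in>{1..n}. S k \<omega> \<le> x k)) = (LINT \<omega>|M. f \<omega> * indicator ?A \<omega>)"
    by (rule Bochner_Integration.integral_cong) (auto simp: indicator_def)
  also have "\<dots> = (LINT \<omega>|M. f \<omega> * real_cond_exp M BA (indicator ?A) \<omega>)"
    using int f A by (intro F.real_cond_exp_intg(2)[symmetric]) auto
  also have "\<dots> = (LINT \<omega>|M. f \<omega> * service_cdf n x \<omega>)"
    by (rule integral_cong_AE) (use ce pm in auto)
  finally show ?thesis .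
qed

text \<open>
The conditional law of the services is given for the first \<open>n\<close> customers jointly, therefore
the generator constrains all of them.
\<close>

definition with_services_sets :: "nat \<Rightarrow> 'w measure \<Rightarrow> 'w set set" where
  "with_services_sets n G = {{\<omega>\<in>A. \<forall>k\<in>{1..n}. S k \<omega> \<le> x k} | A x. A \<in> sets G}"

definition with_services :: "nat \<Rightarrow> 'w measure \<Rightarrow> 'w measure" where
  "with_services n G = sigma (space M) (with_services_sets n G)"

context
  fixes G :: "'w measure"
  assumes G: "subalgebra M G"
begin

lemma with_services_sets_sub: "with_services_sets n G \<subseteq> sets M"
proof
  fix E assume "E \<in> with_services_sets n G"
  then obtain A x where E: "E = {\<omega>\<in>A. \<forall>k\<in>{1..n}. S k \<omega> \<le> x k}" and A: "A \<in> sets G"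
    unfolding with_services_sets_def by blast
  have [measurable]: "A \<in> sets M" using A G by (auto simp: subalgebra_def)
  note [measurable] = S_le_meas
  have "{\<omega>\<in>space M. \<omega> \<in> A \<and> (\<forall>k\<in>{1..n}. S k \<omega> \<le> x k)} \<in> sets M" by measurable
  also have "{\<omega>\<in>space M. \<omega> \<in> A \<and> (\<forall>k\<in>{1..n}. S k \<omega> \<le> x k)} = E"
    unfolding E using sets.sets_into_space[of A M] by auto
  finally show "E \<in> sets M" .
qed

lemma space_with_services: "space (with_services n G) = space M"
  using with_services_sets_sub[of n] sets.sets_into_space by (auto simp: with_services_def intro!: space_measure_of)

lemma sets_with_services: "sets (with_services n G) = sigma_sets (space M) (with_services_sets n G)"
  using with_services_sets_sub[of n] sets.sets_into_space by (auto simp: with_services_def intro!: sets_measure_of)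

lemma subalgebra_with_services: "subalgebra M (with_services n G)"
  using with_services_sets_sub[of n]
  by (auto simp: subalgebra_def sets_with_services space_with_services intro!: sets.sigma_sets_subset)

lemma services_le_nat: "\<exists>m::nat. \<forall>k\<in>{1..n}. S k \<omega> \<le> real m"
proof -
  obtain m :: nat where m: "Max (insert 0 ((\<lambda>k. S k \<omega>) ` {1..n})) \<le> real m" using real_arch_simple by blast
  then show ?thesis by (intro exI[of _ m]) auto
qed

lemma subalgebra_with_services_base: "subalgebra (with_services n G) G"
  unfolding subalgebra_def
proof (intro conjI subsetI)
  show "space G = space (with_services n G)" using G by (simp add: space_with_services subalgebra_def)
  fix A assume A: "A \<in> sets G"
  have "A = (\<Union>m::nat. {\<omega>\<in>A. \<forall>k\<in>{1..n}. S k \<omega> \<le> real m})" using services_le_nat by auto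
  also have "\<dots> \<in> sets (with_services n G)"
  proof -
    have "{\<omega>\<in>A. \<forall>k\<in>{1..n}. S k \<omega> \<le> real m} \<in> with_services_sets n G" for m :: nat
      unfolding with_services_sets_def using A
      by (intro CollectI exI[of _ A] exI[of _ "\<lambda>_. real m"]) simp
    then show ?thesis unfolding sets_with_services by (intro sigma_sets.Union sigma_sets.Basic)
  qed
  finally show "A \<in> sets (with_services n G)" .
qed

lemma S_with_services:
  assumes k: "k \<in> {1..n}"
  shows "S k \<in> borel_measurable (with_services n G)"
proof (subst borel_measurable_iff_le, intro allI)
  fix c
  have top: "space M \<in> sets G" using G sets.top[of G] by (simp add: subalgebra_def)
  have "{\<omega>\<in>space M. S k \<omega> \<le> c} = (\<Union>m::nat. {\<omega>\<in>space M. \<forall>l\<in>{1..n}. S l \<omega> \<le> (if l = k then c else real m)})"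
  proof (intro set_eqI iffI)
    fix \<omega> assume w: "\<omega> \<in> {\<omega>\<in>space M. S k \<omega> \<le> c}"
    obtain m :: nat where "\<forall>k\<in>{1..n}. S k \<omega> \<le> real m" using services_le_nat by blast
    then show "\<omega> \<in> (\<Union>m::nat. {\<omega>\<in>space M. \<forall>l\<in>{1..n}. S l \<omega> \<le> (if l = k then c else real m)})"
      using w by auto
  qed (use k in force)
  also have "\<dots> \<in> sets (with_services n G)"
  proof -
    have "{\<omega>\<in>space M. \<forall>l\<in>{1..n}. S l \<omega> \<le> (if l = k then c else real m)} \<in> with_services_sets n G" for m :: nat
      unfolding with_services_sets_def using top
      by (intro CollectI exI[of _ "space M"] exI[of _ "\<lambda>l. if l = k then c else real m"]) simp
    then show ?thesis unfolding sets_with_services by (intro sigma_sets.Union sigma_sets.Basic)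
  qed
  finally show "{\<omega>\<in>space (with_services n G). S k \<omega> \<le> c} \<in> sets (with_services n G)"
    by (simp add: space_with_services)
qed

lemma Int_stable_with_services_sets: "Int_stable (with_services_sets n G)"
proof (rule Int_stableI)
  fix a b assume "a \<in> with_services_sets n G" "b \<in> with_services_sets n G"
  then obtain A x A' x' where a: "a = {\<omega>\<in>A. \<forall>k\<in>{1..n}. S k \<omega> \<le> x k}" "A \<in> sets G"
    and b: "b = {\<omega>\<in>A'. \<forall>k\<in>{1..n}. S k \<omega> \<le> x' k}" "A' \<in> sets G"
    unfolding with_services_sets_def by blast
  have "a \<inter> b = {\<omega>\<in>A \<inter> A'. \<forall>k\<in>{1..n}. S k \<omega> \<le> min (x k) (x' k)}" unfolding a b by auto
  then show "a \<inter> b \<in> with_services_sets n G" unfolding with_services_sets_def using a b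
    by (intro CollectI exI[of _ "A \<inter> A'"] exI[of _ "\<lambda>k. min (x k) (x' k)"]) auto
qed

end

text \<open>
The whole space is not in the generator, but it is an increasing limit of sets of the
generator with large bounds on the services.
\<close>

lemma orth_with_servicesI:
  assumes GM: "subalgebra M G" and intD: "integrable M D"
    and zero: "\<And>A x. A \<in> sets G \<Longrightarrow>
      (LINT \<omega>|M. indicator A \<omega> * of_bool (\<forall>k\<in>{1..n}. S k \<omega> \<le> x k) * D \<omega>) = 0"
  shows "orth M (sets (with_services n G)) D"
proof -
  have sp: "space M \<in> sets G" using GM sets.top[of G] by (simp add: subalgebra_def)
  note [measurable] = S_le_meas
  have [measurable]: "D \<in> borel_measurable M" using intD by auto
  have "(\<lambda>m. LINT \<omega>|M. indicator (space M) \<omega> * of_bool (\<forall>k\<in>{1..n}. S k \<omega> \<le> real m) * D \<omega>)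
      \<longlonglongrightarrow> (LINT \<omega>|M. D \<omega>)"
  proof (rule integral_dominated_convergence[where w="\<lambda>\<omega>. norm (D \<omega>)"])
    show "AE \<omega> in M. (\<lambda>m. indicator (space M) \<omega> * of_bool (\<forall>k\<in>{1..n}. S k \<omega> \<le> real m) * D \<omega>) \<longlonglongrightarrow> D \<omega>"
    proof (rule AE_I2)
      fix \<omega> assume w: "\<omega> \<in> space M"
      obtain m0 :: nat where m0: "\<forall>k\<in>{1..n}. S k \<omega> \<le> real m0" using services_le_nat[OF GM] by blast
      have "\<forall>\<^sub>F m in sequentially. indicator (space M) \<omega> * of_bool (\<forall>k\<in>{1..n}. S k \<omega> \<le> real m) * D \<omega> = D \<omega>"
        using eventually_ge_at_top[of m0]
      proof eventually_elim
        case (elim m)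
        then have "real m0 \<le> real m" by simp
        then have "\<forall>k\<in>{1..n}. S k \<omega> \<le> real m" using m0 by (blast intro: order_trans)
        then show ?case using w by simp
      qed
      then show "(\<lambda>m. indicator (space M) \<omega> * of_bool (\<forall>k\<in>{1..n}. S k \<omega> \<le> real m) * D \<omega>) \<longlonglongrightarrow> D \<omega>"
        by (rule tendsto_eventually)
    qed
    show "(\<lambda>\<omega>. indicator (space M) \<omega> * of_bool (\<forall>k\<in>{1..n}. S k \<omega> \<le> real m) * D \<omega>) \<in> borel_measurable M" for m :: nat
      by measurable
  qed (use intD in \<open>auto simp: indicator_def\<close>)
  then have D0: "(LINT \<omega>|M. D \<omega>) = 0" unfolding zero[OF sp] by (simp add: LIMSEQ_const_iff)
  have "orth M (with_services_sets n G) D"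
    unfolding orth_def
  proof
    fix E assume "E \<in> with_services_sets n G"
    then obtain A x where E: "E = {\<omega>\<in>A. \<forall>k\<in>{1..n}. S k \<omega> \<le> x k}" and A: "A \<in> sets G"
      unfolding with_services_sets_def by blast
    have "(LINT \<omega>|M. indicator E \<omega> * D \<omega>)
        = (LINT \<omega>|M. indicator A \<omega> * of_bool (\<forall>k\<in>{1..n}. S k \<omega> \<le> x k) * D \<omega>)"
      by (rule Bochner_Integration.integral_cong) (auto simp: E indicator_def)
    then show "(LINT \<omega>|M. indicator E \<omega> * D \<omega>) = 0" using zero[OF A] by simp
  qed
  then show ?thesis unfolding sets_with_services[OF GM]
    by (rule orth_sigma_sets[OF intD D0 with_services_sets_sub[OF GM] Int_stable_with_services_sets[OF GM]])
qed

text \<open>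
Conditioning on the background and the arrivals turns the constraint on the services into the
factor \<open>service_cdf n x\<close>.  If this factor is known to \<open>G\<close> wherever \<open>D\<close> does not vanish,
then it can be pulled out.
\<close>

lemma orth_services:
  assumes G: "subalgebra BA G" and D: "D \<in> borel_measurable BA" "\<And>\<omega>. \<omega> \<in> space M \<Longrightarrow> \<bar>D \<omega>\<bar> \<le> C"
    and o: "orth M (sets G) D"
    and local: "\<And>x. \<exists>f. f \<in> borel_measurable G \<and>
      (\<forall>\<omega>\<in>space M. \<bar>f \<omega>\<bar> \<le> 1 \<and> f \<omega> * D \<omega> = service_cdf n x \<omega> * D \<omega>)"
  shows "orth M (sets (with_services n G)) D"
proof (rule orth_with_servicesI)
  show GM: "subalgebra M G" using G subalgebra_BA by (auto simp: subalgebra_def)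
  have DM [measurable]: "D \<in> borel_measurable M" using subalgebra_BA D(1) by (rule measurable_from_subalg)
  show intD: "integrable M D" using D(2) by (intro integrable_bounded[where C=C]) auto
  fix A x assume A: "A \<in> sets G"
  obtain f where f: "f \<in> borel_measurable G" "\<And>\<omega>. \<omega> \<in> space M \<Longrightarrow> \<bar>f \<omega>\<bar> \<le> 1"
    "\<And>\<omega>. \<omega> \<in> space M \<Longrightarrow> f \<omega> * D \<omega> = service_cdf n x \<omega> * D \<omega>" using local[of x] by blast
  have ABA [measurable]: "A \<in> sets BA" using A G by (auto simp: subalgebra_def)
  note [measurable] = D(1)
  have "(LINT \<omega>|M. indicator A \<omega> * of_bool (\<forall>k\<in>{1..n}. S k \<omega> \<le> x k) * D \<omega>)
      = (LINT \<omega>|M. indicator A \<omega> * D \<omega> * of_bool (\<forall>k\<in>{1..n}. S k \<omega> \<le> x k))"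
    by (rule Bochner_Integration.integral_cong) auto
  also have "\<dots> = (LINT \<omega>|M. indicator A \<omega> * D \<omega> * service_cdf n x \<omega>)"
  proof (rule service_integral[where C=C])
    show "(\<lambda>\<omega>. indicator A \<omega> * D \<omega>) \<in> borel_measurable BA" by measurable
    show "\<bar>indicator A \<omega> * D \<omega>\<bar> \<le> C" if "\<omega> \<in> space M" for \<omega>
      using D(2)[OF that] bound_nonneg[of D C] D(2) by (auto simp: indicator_def)
  qed
  also have "\<dots> = (LINT \<omega>|M. indicator A \<omega> * f \<omega> * D \<omega>)"
  proof (rule Bochner_Integration.integral_cong)
    fix \<omega> assume w: "\<omega> \<in> space M"
    show "indicator A \<omega> * D \<omega> * service_cdf n x \<omega> = indicator A \<omega> * f \<omega> * D \<omega>"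
      using arg_cong[OF f(3)[OF w], of "\<lambda>z. indicator A \<omega> * z"] by (simp only: mult_ac)
  qed simp
  also have "\<dots> = 0"
    by (rule orth_integral_real[OF GM o intD, where C=1]) (use A f in \<open>auto simp: indicator_def\<close>)
  finally show "(LINT \<omega>|M. indicator A \<omega> * of_bool (\<forall>k\<in>{1..n}. S k \<omega> \<le> x k) * D \<omega>) = 0" .
qed

text \<open>
Given \<open>Y\<close>, a service time is independent of the background, the arrivals and all earlier
services: the conditional law of \<open>n + 1\<close> services differs from that of \<open>n\<close> services by one
factor, which is constant on \<open>Y (n + 1) = j\<close>.
\<close>

lemma service_orth:
  "orth M (sets (with_services n BA))
     (\<lambda>\<omega>. of_bool (Y (Suc n) \<omega> = j) * (of_bool (S (Suc n) \<omega> \<le> c) - cdf (B j) c))"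
proof (rule orth_with_servicesI[OF subalgebra_BA])
  have [measurable]: "Y (Suc n) \<in> measurable M (count_space UNIV)" "S (Suc n) \<in> borel_measurable M"
    by (auto intro!: Y_meas S_meas)
  have [measurable]: "Y (Suc n) \<in> measurable BA (count_space UNIV)" by (auto intro!: Y_BA)
  show "integrable M (\<lambda>\<omega>. of_bool (Y (Suc n) \<omega> = j) * (of_bool (S (Suc n) \<omega> \<le> c) - cdf (B j) c))"
    using cdf_B_bounds[of j c] by (intro integrable_bounded[where C=1]) auto
  fix A x assume A [measurable]: "A \<in> sets BA"
  let ?f = "\<lambda>\<omega>. indicator A \<omega> * of_bool (Y (Suc n) \<omega> = j) :: real"
  let ?x = "x(Suc n := c)"
  have f1: "?f \<in> borel_measurable BA" by measurable
  have AM [measurable]: "A \<in> sets M" using A subalgebra_BA by (auto simp: subalgebra_def)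
  note [measurable] = S_le_meas
  have f2: "\<bar>?f \<omega>\<bar> \<le> 1" if "\<omega> \<in> space M" for \<omega>
    by (auto simp: indicator_def)
  note f = f1 f2
  have all: "(\<forall>k\<in>{1..Suc n}. S k \<omega> \<le> ?x k) \<longleftrightarrow> (\<forall>k\<in>{1..n}. S k \<omega> \<le> x k) \<and> S (Suc n) \<omega> \<le> c" for \<omega>
    by (auto simp: atLeastAtMostSuc_conv)
  have "(LINT \<omega>|M. indicator A \<omega> * of_bool (\<forall>k\<in>{1..n}. S k \<omega> \<le> x k) * (of_bool (Y (Suc n) \<omega> = j) * (of_bool (S (Suc n) \<omega> \<le> c) - cdf (B j) c)))
      = (LINT \<omega>|M. ?f \<omega> * of_bool (\<forall>k\<in>{1..Suc n}. S k \<omega> \<le> ?x k)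
            - cdf (B j) c * (?f \<omega> * of_bool (\<forall>k\<in>{1..n}. S k \<omega> \<le> x k)))"
    unfolding all by (rule Bochner_Integration.integral_cong) (auto simp: indicator_def)
  also have "\<dots> = (LINT \<omega>|M. ?f \<omega> * of_bool (\<forall>k\<in>{1..Suc n}. S k \<omega> \<le> ?x k))
            - cdf (B j) c * (LINT \<omega>|M. ?f \<omega> * of_bool (\<forall>k\<in>{1..n}. S k \<omega> \<le> x k))"
  proof (subst Bochner_Integration.integral_diff)
    show "integrable M (\<lambda>\<omega>. ?f \<omega> * of_bool (\<forall>k\<in>{1..Suc n}. S k \<omega> \<le> ?x k))"
    proof (rule integrable_bounded[where C=1])
      have [measurable]: "Measurable.pred M (\<lambda>\<omega>. \<forall>k\<in>{1..Suc n}. S k \<omega> \<le> ?x k)" by (rule S_le_meas)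
      show "(\<lambda>\<omega>. ?f \<omega> * of_bool (\<forall>k\<in>{1..Suc n}. S k \<omega> \<le> ?x k)) \<in> borel_measurable M" by measurable
    qed (simp add: indicator_def)
    show "integrable M (\<lambda>\<omega>. cdf (B j) c * (?f \<omega> * of_bool (\<forall>k\<in>{1..n}. S k \<omega> \<le> x k)))"
    proof (intro integrable_mult_right integrable_bounded[where C=1])
      show "(\<lambda>\<omega>. ?f \<omega> * of_bool (\<forall>k\<in>{1..n}. S k \<omega> \<le> x k)) \<in> borel_measurable M" by measurable
    qed (simp add: indicator_def)
  qed simp
  also have "\<dots> = (LINT \<omega>|M. ?f \<omega> * service_cdf (Suc n) ?x \<omega>) - cdf (B j) c * (LINT \<omega>|M. ?f \<omega> * service_cdf n x \<omega>)"
    by (simp only: service_integral[OF f])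
  also have "(LINT \<omega>|M. ?f \<omega> * service_cdf (Suc n) ?x \<omega>) = (LINT \<omega>|M. cdf (B j) c * (?f \<omega> * service_cdf n x \<omega>))"
  proof (rule Bochner_Integration.integral_cong)
    fix \<omega>
    have "(\<Prod>k=1..n. cdf (B (Y k \<omega>)) (?x k)) = (\<Prod>k=1..n. cdf (B (Y k \<omega>)) (x k))" by (rule prod.cong) auto
    then show "?f \<omega> * service_cdf (Suc n) ?x \<omega> = cdf (B j) c * (?f \<omega> * service_cdf n x \<omega>)"
      by (simp add: prod.nat_ivl_Suc')
  qed simp
  finally show "(LINT \<omega>|M. indicator A \<omega> * of_bool (\<forall>k\<in>{1..n}. S k \<omega> \<le> x k) * (of_bool (Y (Suc n) \<omega> = j) * (of_bool (S (Suc n) \<omega> \<le> c) - cdf (B j) c))) = 0"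
    by simp
qed

lemma S_nonneg: "AE \<omega> in M. 0 \<le> S (Suc n) \<omega>"
proof -
  have [measurable]: "Y (Suc n) \<in> measurable M (count_space UNIV)" "S (Suc n) \<in> borel_measurable M"
    by (auto intro!: Y_meas S_meas)
  have neg: "AE \<omega> in M. \<not> (Y (Suc n) \<omega> = j \<and> S (Suc n) \<omega> \<le> c)" if c: "c < 0" for j c
  proof -
    have c0: "cdf (B j) c = 0" using service[of j] c by (simp add: service_law_def)
    have sp: "space M \<in> sets (with_services n BA)"
      using sets.top[of "with_services n BA"] by (simp add: space_with_services[OF subalgebra_BA])
    let ?D = "\<lambda>\<omega>. of_bool (Y (Suc n) \<omega> = j) * of_bool (S (Suc n) \<omega> \<le> c) :: real"
    have "(LINT \<omega>|M. ?D \<omega>) = (LINT \<omega>|M. indicator (space M) \<omega> * ?D \<omega>)"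
      by (rule Bochner_Integration.integral_cong) auto
    also have "\<dots> = 0" using service_orth[of n j c] sp by (simp add: orth_def c0)
    finally have "(LINT \<omega>|M. ?D \<omega>) = 0" .
    moreover have "integrable M ?D" by (intro integrable_bounded[where C=1]) auto
    ultimately have "AE \<omega> in M. ?D \<omega> = 0" by (subst (asm) integral_nonneg_eq_0_iff_AE) auto
    then show ?thesis by eventually_elim auto
  qed
  have "AE \<omega> in M. \<forall>m::nat. \<forall>j. \<not> (Y (Suc n) \<omega> = j \<and> S (Suc n) \<omega> \<le> - inverse (real (Suc m)))"
    by (subst AE_all_countable, rule allI, subst AE_all_countable) (use neg in auto)
  then show ?thesis
  proof eventually_elim
    case (elim \<omega>)
    show ?case
    proof (rule ccontr)
      assume "\<not> 0 \<le> S (Suc n) \<omega>"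
      then obtain m :: nat where "inverse (real (Suc m)) < - S (Suc n) \<omega>" using reals_Archimedean[of "- S (Suc n) \<omega>"] by auto
      then show False using elim by (auto dest: spec[of _ m])
    qed
  qed
qed

text \<open>
By \<open>service_orth\<close> the law of the service under conditioning on an event of the past and on
\<open>Y = j\<close> has the distribution function of \<open>B j\<close>, hence it is \<open>B j\<close>; this gives the
transform on events, and then against functions.
\<close>

lemma service_transform:
  fixes f :: "'w \<Rightarrow> complex"
  assumes f: "f \<in> borel_measurable (with_services n BA)" "\<And>\<omega>. \<omega> \<in> space M \<Longrightarrow> norm (f \<omega>) \<le> C" and s: "0 \<le> Re s"
  shows "(LINT \<omega>|M. f \<omega> * of_bool (Y (Suc n) \<omega> = j) * exp (- s * of_real (S (Suc n) \<omega>)))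
       = LST (B j) s * (LINT \<omega>|M. f \<omega> * of_bool (Y (Suc n) \<omega> = j))"
proof -
  let ?F = "with_services n BA"
  have YM [measurable]: "Y (Suc n) \<in> measurable M (count_space UNIV)" and SM [measurable]: "S (Suc n) \<in> borel_measurable M"
    by (auto intro!: Y_meas S_meas)
  have sub: "subalgebra M ?F" by (rule subalgebra_with_services[OF subalgebra_BA])
  have fM [measurable]: "f \<in> borel_measurable M" using sub f(1) by (rule measurable_from_subalg)
  define e where "e \<omega> = exp (- s * of_real (S (Suc n) \<omega>))" for \<omega>
  have eM [measurable]: "e \<in> borel_measurable M" unfolding e_def by measurable
  have e1: "AE \<omega> in M. norm (e \<omega>) \<le> 1"
    using S_nonneg[of n] by eventually_elim (use s in \<open>simp add: e_def\<close>)
  define b where "b = LST (B j) s"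
  have main: "(LINT \<omega>|M. indicator E \<omega> *\<^sub>R (of_bool (Y (Suc n) \<omega> = j) * e \<omega>))
      = b * prob {\<omega>\<in>space M. \<omega> \<in> E \<and> Y (Suc n) \<omega> = j}" if E: "E \<in> sets ?F" for E
  proof -
    have EM [measurable]: "E \<in> sets M" using E sub by (auto simp: subalgebra_def)
    define A where "A = {\<omega>\<in>space M. \<omega> \<in> E \<and> Y (Suc n) \<omega> = j}"
    have AM [measurable]: "A \<in> sets M" unfolding A_def by measurable
    have IA: "(LINT \<omega>|M. indicator E \<omega> *\<^sub>R (of_bool (Y (Suc n) \<omega> = j) * e \<omega>)) = (LINT \<omega>|M. indicator A \<omega> *\<^sub>R e \<omega>)"
      by (rule Bochner_Integration.integral_cong) (auto simp: A_def indicator_def)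
    show ?thesis
    proof (cases "prob A = 0")
      case True
      then have "AE \<omega> in M. \<omega> \<notin> A" using prob_eq_0[OF AM] by simp
      then have "(LINT \<omega>|M. indicator A \<omega> *\<^sub>R e \<omega>) = (LINT \<omega>|M. 0)"
        by (intro integral_cong_AE) (auto elim!: eventually_mono simp: indicator_def)
      then show ?thesis using True IA by (simp add: A_def)
    next
      case False
      then have pA: "0 < prob A" by (simp add: zero_less_measure_iff)
      have eA: "emeasure M A \<noteq> 0" "emeasure M A \<noteq> \<infinity>" using pA by (auto simp: emeasure_eq_measure)
      define U where "U = uniform_measure M A"
      interpret U: prob_space U unfolding U_def using eA by (rule prob_space_uniform_measure)
      have sU [measurable_cong]: "sets U = sets M" by (simp add: U_def)
      have SU: "S (Suc n) \<in> borel_measurable U" using SM sU by (simp cong: measurable_cong_sets)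
      have rdj: "real_distribution (B j)" using service[of j] by (simp add: service_law_def)
      have "distr U borel (S (Suc n)) = B j"
      proof (rule cdf_unique[OF U.real_distribution_distr rdj])
        show "S (Suc n) \<in> borel_measurable U" by (rule SU)
        show "cdf (distr U borel (S (Suc n))) = cdf (B j)"
        proof
          fix c
          let ?c = "{\<omega>\<in>space M. S (Suc n) \<omega> \<le> c}"
          have cM: "?c \<in> sets M" by measurable
          have "cdf (distr U borel (S (Suc n))) c = measure U (S (Suc n) -` {..c} \<inter> space U)"
            unfolding cdf_def using SU by (subst measure_distr) auto
          also have "S (Suc n) -` {..c} \<inter> space U = ?c" by (auto simp: U_def)
          also have "measure U ?c = prob (A \<inter> ?c) / prob A"
            unfolding U_def using eA cM by (rule measure_uniform_measure)
          also have "prob (A \<inter> ?c) = cdf (B j) c * prob A"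
          proof -
            have "0 = (LINT \<omega>|M. indicator E \<omega> * (of_bool (Y (Suc n) \<omega> = j) * (of_bool (S (Suc n) \<omega> \<le> c) - cdf (B j) c)))"
              using service_orth[of n j c] E by (simp add: orth_def)
            also have "\<dots> = (LINT \<omega>|M. indicator (A \<inter> ?c) \<omega> - cdf (B j) c * indicator A \<omega>)"
              by (rule Bochner_Integration.integral_cong) (auto simp: A_def indicator_def)
            also have "\<dots> = prob (A \<inter> ?c) - cdf (B j) c * prob A"
              using AM cM by (subst Bochner_Integration.integral_diff) (auto simp: emeasure_eq_measure)
            finally show ?thesis by simp
          qed
          finally show "cdf (distr U borel (S (Suc n))) c = cdf (B j) c" using pA by simp
        qed
      qed
      then have "b = (LINT x|distr U borel (S (Suc n)). exp (- s * of_real x))" by (simp add: b_def LST_def)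
      also have "\<dots> = (LINT \<omega>|U. e \<omega>)"
        unfolding e_def using SU by (subst integral_distr) auto
      also have "U = density M (\<lambda>\<omega>. ennreal (indicator A \<omega> / prob A))"
        unfolding U_def uniform_measure_def
        by (intro density_cong AE_I2) (use pA in \<open>auto simp: indicator_def emeasure_eq_measure divide_ennreal simp flip: ennreal_1\<close>)
      also have "(LINT \<omega>|\<dots>. e \<omega>) = (LINT \<omega>|M. (indicator A \<omega> / prob A) *\<^sub>R e \<omega>)"
        by (rule integral_density) auto
      also have "\<dots> = (LINT \<omega>|M. indicator A \<omega> *\<^sub>R e \<omega>) / prob A"
        by (simp add: scaleR_conv_of_real)
      finally show ?thesis using pA IA by (simp add: A_def)
    qed
  qed
  define \<Delta> where "\<Delta> \<omega> = of_bool (Y (Suc n) \<omega> = j) * (e \<omega> - b)" for \<omega>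
  have \<Delta>M [measurable]: "\<Delta> \<in> borel_measurable M" unfolding \<Delta>_def by measurable
  have \<Delta>int: "integrable M \<Delta>"
  proof (rule integrable_const_bound[where B="1 + norm b"])
    show "AE \<omega> in M. norm (\<Delta> \<omega>) \<le> 1 + norm b"
      using e1 by eventually_elim (auto simp: \<Delta>_def intro!: order_trans[OF norm_triangle_ineq4])
  qed simp
  have \<Delta>0: "(LINT \<omega>|M. indicator E \<omega> *\<^sub>R \<Delta> \<omega>) = 0" if E: "E \<in> sets ?F" for E
  proof -
    have EM [measurable]: "E \<in> sets M" using E sub by (auto simp: subalgebra_def)
    have i1: "integrable M (\<lambda>\<omega>. indicator E \<omega> *\<^sub>R (of_bool (Y (Suc n) \<omega> = j) * e \<omega>))"
      by (rule integrable_const_bound[where B=1]) (use e1 in \<open>auto elim!: eventually_mono simp: indicator_def\<close>)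
    have i2: "integrable M (\<lambda>\<omega>. b * of_real (indicator {\<omega>\<in>space M. \<omega> \<in> E \<and> Y (Suc n) \<omega> = j} \<omega>))"
      by (intro integrable_mult_right integrable_bounded[where C=1]) (auto simp: indicator_def)
    have "(LINT \<omega>|M. indicator E \<omega> *\<^sub>R \<Delta> \<omega>) = (LINT \<omega>|M. indicator E \<omega> *\<^sub>R (of_bool (Y (Suc n) \<omega> = j) * e \<omega>)
        - b * of_real (indicator {\<omega>\<in>space M. \<omega> \<in> E \<and> Y (Suc n) \<omega> = j} \<omega>))"
      by (rule Bochner_Integration.integral_cong) (auto simp: \<Delta>_def indicator_def)
    also have "\<dots> = 0" using main[OF E] by (subst Bochner_Integration.integral_diff[OF i1 i2]) simp
    finally show ?thesis .
  qed
  have int': "integrable M (\<lambda>\<omega>. indicator E \<omega> *\<^sub>R \<Delta> \<omega>)" if "E \<in> sets ?F" for E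
    using that sub by (intro integrable_mult_indicator \<Delta>int) (auto simp: subalgebra_def)
  have oR: "orth M (sets ?F) (\<lambda>\<omega>. Re (\<Delta> \<omega>))" unfolding orth_def
  proof
    fix E assume E: "E \<in> sets ?F"
    show "(LINT \<omega>|M. indicator E \<omega> * Re (\<Delta> \<omega>)) = 0"
      using integral_Re[OF int'[OF E]] \<Delta>0[OF E] by simp
  qed
  have oI: "orth M (sets ?F) (\<lambda>\<omega>. Im (\<Delta> \<omega>))" unfolding orth_def
  proof
    fix E assume E: "E \<in> sets ?F"
    show "(LINT \<omega>|M. indicator E \<omega> * Im (\<Delta> \<omega>)) = 0"
      using integral_Im[OF int'[OF E]] \<Delta>0[OF E] by simp
  qed
  have fint: "integrable M (\<lambda>\<omega>. f \<omega> * g \<omega>)" if g: "integrable M g" for g :: "'w \<Rightarrow> complex"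
  proof (rule Bochner_Integration.integrable_bound)
    show "integrable M (\<lambda>\<omega>. C * norm (g \<omega>))" using g by simp
    show "AE \<omega> in M. norm (f \<omega> * g \<omega>) \<le> norm (C * norm (g \<omega>))"
      using f(2) bound_nonneg[of f C] by (auto simp: norm_mult intro!: AE_I2 mult_right_mono)
  qed (use g in auto)
  have RI: "integrable M (\<lambda>\<omega>. Re (\<Delta> \<omega>))" "integrable M (\<lambda>\<omega>. Im (\<Delta> \<omega>))" using \<Delta>int by auto
  have "(LINT \<omega>|M. f \<omega> * \<Delta> \<omega>) = (LINT \<omega>|M. f \<omega> * of_real (Re (\<Delta> \<omega>)) + \<i> * (f \<omega> * of_real (Im (\<Delta> \<omega>))))"
    by (rule Bochner_Integration.integral_cong, simp, subst complex_eq[of "\<Delta> _"]) (simp add: algebra_simps)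
  also have "\<dots> = 0"
    using fint[of "\<lambda>\<omega>. of_real (Re (\<Delta> \<omega>))"] fint[of "\<lambda>\<omega>. of_real (Im (\<Delta> \<omega>))"] RI
      orth_integral[OF sub oR RI(1) f] orth_integral[OF sub oI RI(2) f]
    by (subst Bochner_Integration.integral_add) auto
  finally have z: "(LINT \<omega>|M. f \<omega> * \<Delta> \<omega>) = 0" .
  have i1: "integrable M (\<lambda>\<omega>. f \<omega> * of_bool (Y (Suc n) \<omega> = j))"
    by (rule fint) (rule integrable_bounded[where C=1], auto)
  have "(LINT \<omega>|M. f \<omega> * of_bool (Y (Suc n) \<omega> = j) * e \<omega>)
      = (LINT \<omega>|M. f \<omega> * \<Delta> \<omega> + b * (f \<omega> * of_bool (Y (Suc n) \<omega> = j)))"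
    by (rule Bochner_Integration.integral_cong) (auto simp: \<Delta>_def algebra_simps)
  also have "\<dots> = b * (LINT \<omega>|M. f \<omega> * of_bool (Y (Suc n) \<omega> = j))"
    using fint[OF \<Delta>int] i1 z by (subst Bochner_Integration.integral_add) auto
  finally show ?thesis by (simp add: e_def b_def)
qed

end

section \<open>One small time step\<close>

text \<open>
These are the Poisson probabilities of 0 and 1; that they are Lipschitz continuous allows the
random intensity to be replaced by that of a frozen background.
\<close>

lemma exp_neg_lipschitz:
  fixes x y :: real
  assumes "0 \<le> x" "0 \<le> y"
  shows "\<bar>exp (- x) - exp (- y)\<bar> \<le> \<bar>x - y\<bar>" "\<bar>x * exp (- x) - y * exp (- y)\<bar> \<le> \<bar>x - y\<bar>"
proof -
  have "norm (exp (- x) - exp (- y)) \<le> 1 * norm (x - y)"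
    by (rule field_differentiable_bound[where S="{0..}" and f'="\<lambda>z. - exp (- z)"])
       (use assms in \<open>auto intro!: derivative_eq_intros\<close>)
  then show "\<bar>exp (- x) - exp (- y)\<bar> \<le> \<bar>x - y\<bar>" by simp
  have "norm (x * exp (- x) - y * exp (- y)) \<le> 1 * norm (x - y)"
  proof (rule field_differentiable_bound[where S="{0..}" and f'="\<lambda>z. (1 - z) * exp (- z)"])
    show "((\<lambda>z. z * exp (- z)) has_field_derivative (1 - z) * exp (- z)) (at z within {0..})" for z :: real
      by (auto intro!: derivative_eq_intros simp: algebra_simps)
    show "norm ((1 - z) * exp (- z)) \<le> 1" if "z \<in> {0..}" for z :: real
    proof -
      have z: "0 \<le> z" using that by simp
      have "\<bar>1 - z\<bar> \<le> 1 + z" using z by auto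
      also have "1 + z \<le> exp z" by (rule exp_ge_add_one_self)
      finally have "\<bar>1 - z\<bar> * exp (- z) \<le> exp z * exp (- z)" by (intro mult_right_mono) auto
      then show ?thesis by (simp add: abs_mult flip: exp_add)
    qed
  qed (use assms in auto)
  then show "\<bar>x * exp (- x) - y * exp (- y)\<bar> \<le> \<bar>x - y\<bar>" by simp
qed

lemma norm_of_bool_eq: "norm (of_bool b :: 'a::real_normed_algebra_1) = of_bool b"
  by (cases b) auto

context queue
begin

lemma P_row: "0 \<le> t \<Longrightarrow> (\<Sum>j\<in>UNIV. P t $ i $ j) = 1" and P_nonneg: "0 \<le> t \<Longrightarrow> 0 \<le> P t $ i $ j"
  using semigroup by (auto simp: transition_semigroup_def)

lemma P_deriv: "((\<lambda>h. (P h $ i $ j - of_bool (i = j)) / h) \<longlongrightarrow> Q $ i $ j) (at_right 0)"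
proof -
  have "((\<lambda>h. ((1 / h) *\<^sub>R (P h - mat 1)) $ i $ j) \<longlongrightarrow> Q $ i $ j) (at_right 0)"
    using generator unfolding has_generator_def by (intro tendsto_vec_nth)
  then show ?thesis by (simp add: mat_def of_bool_def)
qed

lemma P_cont: "((\<lambda>h. P h $ i $ j) \<longlongrightarrow> of_bool (i = j)) (at_right 0)"
proof -
  have "((\<lambda>h. of_bool (i = j) + h * ((P h $ i $ j - of_bool (i = j)) / h)) \<longlongrightarrow> of_bool (i = j) + 0 * Q $ i $ j) (at_right 0)"
    by (intro tendsto_intros P_deriv)
  then have "((\<lambda>h. of_bool (i = j) + h * ((P h $ i $ j - of_bool (i = j)) / h)) \<longlongrightarrow> of_bool (i = j)) (at_right 0)"
    by simp
  then show ?thesis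
    by (rule Lim_transform_eventually) (auto simp: eventually_at_right_field intro!: exI[of _ 1])
qed

lemma Q_row: "(\<Sum>j\<in>UNIV. Q $ i $ j) = 0"
proof -
  have "((\<lambda>h. \<Sum>j\<in>UNIV. (P h $ i $ j - of_bool (i = j)) / h) \<longlongrightarrow> (\<Sum>j\<in>UNIV. Q $ i $ j)) (at_right 0)"
    by (intro tendsto_intros P_deriv)
  moreover have "\<forall>\<^sub>F h in at_right 0. (\<Sum>j\<in>UNIV. (P h $ i $ j - of_bool (i = j)) / h) = 0"
    unfolding eventually_at_right_field
    by (intro exI[of _ 1]) (auto simp: sum_subtractf P_row simp flip: sum_divide_distrib)
  ultimately have "((\<lambda>h. 0) \<longlongrightarrow> (\<Sum>j\<in>UNIV. Q $ i $ j)) (at_right (0::real))"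
    by (rule Lim_transform_eventually)
  then show ?thesis by (simp add: tendsto_const_iff)
qed

lemma Q_offdiag: "i \<noteq> j \<Longrightarrow> 0 \<le> Q $ i $ j"
proof (rule tendsto_lowerbound[OF P_deriv])
  assume "i \<noteq> j"
  then show "\<forall>\<^sub>F h in at_right 0. 0 \<le> (P h $ i $ j - of_bool (i = j)) / h"
    unfolding eventually_at_right_field by (intro exI[of _ 1]) (auto simp: P_nonneg)
qed simp

abbreviation pX :: "real \<Rightarrow> 'n \<Rightarrow> real" where "pX t i \<equiv> prob {\<omega>\<in>space M. X t \<omega> = i}"

lemma pX_eq: "0 \<le> t \<Longrightarrow> (LINT \<omega>|M. of_bool (X t \<omega> = i)) = pX t i"
  by (intro expectation_of_bool X_sets)

lemma two_states:
  assumes "0 \<le> t" "0 \<le> h"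
  shows "(LINT \<omega>|M. of_bool (X t \<omega> = i) * of_bool (X (t + h) \<omega> = j)) = pX t i * P h $ i $ j"
  using markov_step[of "\<lambda>_. 1" t 1 h i j] assms by (simp add: pX_eq)

lemma leave_prob:
  assumes "0 \<le> t" "0 \<le> h"
  shows "(LINT \<omega>|M. of_bool (X t \<omega> = i) * of_bool (X (t + h) \<omega> \<noteq> i)) = pX t i * (1 - P h $ i $ i)"
proof -
  have [measurable]: "X t \<in> measurable M (count_space UNIV)" "X (t + h) \<in> measurable M (count_space UNIV)"
    using assms by (auto intro!: X_meas)
  have "(LINT \<omega>|M. of_bool (X t \<omega> = i) * of_bool (X (t + h) \<omega> \<noteq> i))
      = (LINT \<omega>|M. of_bool (X t \<omega> = i) - of_bool (X t \<omega> = i) * (of_bool (X (t + h) \<omega> = i) :: real))"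
    by (rule Bochner_Integration.integral_cong) auto
  also have "\<dots> = pX t i - pX t i * P h $ i $ i"
    using assms by (subst Bochner_Integration.integral_diff)
      (auto simp: pX_eq two_states intro!: integrable_bounded[where C=1])
  finally show ?thesis by (simp add: algebra_simps)
qed

text \<open>
The mean deviation of the intensity from that of a background frozen in \<open>i\<close> is of smaller
order than \<open>h\<close>, uniformly in \<open>t\<close>: it is at most the mean time spent outside \<open>i\<close>, and by the
Markov property the chain has left \<open>i\<close> at a given epoch with a probability that tends to 0
with \<open>h\<close>.
\<close>

lemma cum_deviation:
  assumes t: "0 \<le> t" "0 < h" and stay: "\<And>u. 0 < u \<Longrightarrow> u \<le> h \<Longrightarrow> 1 - P u $ i $ i \<le> \<epsilon>"
  shows "(LINT \<omega>|M. of_bool (X t \<omega> = i) * \<bar>cum t (t + h) \<omega> - h * lam i\<bar>) \<le> h * lmax * \<epsilon> * pX t i"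
proof -
  define R where "R q \<omega> = (\<Sum>k=1..Suc q. h / Suc q * lam (X (t + k * (h / Suc q)) \<omega>))" for q \<omega>
  have R_lim: "(\<lambda>q. R q \<omega>) \<longlonglongrightarrow> cum t (t + h) \<omega>" if "\<omega> \<in> space M" for \<omega>
    using cum_limit[of t "t + h" \<omega>] t that by (simp add: R_def)
  have XM [measurable]: "X (t + k * (h / Suc q)) \<in> measurable M (count_space UNIV)" for k q :: nat
    using t by (intro X_meas) auto
  have [measurable]: "X t \<in> measurable M (count_space UNIV)" using t by (intro X_meas)
  have RM [measurable]: "R q \<in> borel_measurable M" for q
    unfolding R_def by (intro borel_measurable_sum) measurable
  have cM [measurable]: "cum t (t + h) \<in> borel_measurable M" using t by (intro cum_measurable) auto
  have dev: "\<bar>R q \<omega> - h * lam i\<bar> \<le> (\<Sum>k=1..Suc q. h / Suc q * lmax * of_bool (X (t + k * (h / Suc q)) \<omega> \<noteq> i))" for q \<omega>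
  proof -
    have "h * lam i = (\<Sum>k=1..Suc q. h / Suc q * lam i)" by (simp only: sum_constant card_atLeastAtMost) simp
    then have "R q \<omega> - h * lam i = (\<Sum>k=1..Suc q. h / Suc q * (lam (X (t + k * (h / Suc q)) \<omega>) - lam i))"
      unfolding R_def by (simp only: sum_subtractf[symmetric] right_diff_distrib)
    also have "\<bar>\<dots>\<bar> \<le> (\<Sum>k=1..Suc q. \<bar>h / Suc q * (lam (X (t + k * (h / Suc q)) \<omega>) - lam i)\<bar>)" by (rule sum_abs)
    also have "\<dots> \<le> (\<Sum>k=1..Suc q. h / Suc q * lmax * of_bool (X (t + k * (h / Suc q)) \<omega> \<noteq> i))"
    proof (rule sum_mono)
      fix k assume "k \<in> {1..Suc q}"
      have "\<bar>lam (X (t + k * (h / Suc q)) \<omega>) - lam i\<bar> \<le> lmax * of_bool (X (t + k * (h / Suc q)) \<omega> \<noteq> i)"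
        using lam_pos[of i] lam_pos[of "X (t + k * (h / Suc q)) \<omega>"] lam_le[of i] lam_le[of "X (t + k * (h / Suc q)) \<omega>"]
        by (cases "X (t + k * (h / Suc q)) \<omega> = i") auto
      then have "h / Suc q * \<bar>lam (X (t + k * (h / Suc q)) \<omega>) - lam i\<bar> \<le> h / Suc q * (lmax * of_bool (X (t + k * (h / Suc q)) \<omega> \<noteq> i))"
        using t by (intro mult_left_mono) auto
      then show "\<bar>h / Suc q * (lam (X (t + k * (h / Suc q)) \<omega>) - lam i)\<bar> \<le> h / Suc q * lmax * of_bool (X (t + k * (h / Suc q)) \<omega> \<noteq> i)"
        using t by (simp add: abs_mult mult.assoc)
    qed
    finally show ?thesis .
  qed
  have bound: "\<bar>R q \<omega> - h * lam i\<bar> \<le> h * lmax" for q \<omega>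
  proof -
    have "(\<Sum>k=1..Suc q. h / Suc q * lmax * of_bool (X (t + k * (h / Suc q)) \<omega> \<noteq> i)) \<le> (\<Sum>k=1..Suc q. h / Suc q * lmax)"
      using t lmax_pos by (intro sum_mono) (auto simp: of_bool_def)
    also have "\<dots> = h * lmax" by (simp only: sum_constant card_atLeastAtMost) simp
    finally show ?thesis using dev[of q \<omega>] by linarith
  qed
  have "(\<lambda>q. LINT \<omega>|M. of_bool (X t \<omega> = i) * \<bar>R q \<omega> - h * lam i\<bar>) \<longlonglongrightarrow> (LINT \<omega>|M. of_bool (X t \<omega> = i) * \<bar>cum t (t + h) \<omega> - h * lam i\<bar>)"
  proof (rule integral_dominated_convergence[where w="\<lambda>_. h * lmax"])
    show "AE \<omega> in M. (\<lambda>q. of_bool (X t \<omega> = i) * \<bar>R q \<omega> - h * lam i\<bar>) \<longlonglongrightarrow> of_bool (X t \<omega> = i) * \<bar>cum t (t + h) \<omega> - h * lam i\<bar>"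
      by (intro AE_I2 tendsto_intros R_lim)
    show "AE \<omega> in M. norm (of_bool (X t \<omega> = i) * \<bar>R q \<omega> - h * lam i\<bar>) \<le> h * lmax" for q
      using bound t lmax_pos by (intro AE_I2) auto
  qed auto
  then show ?thesis
  proof (rule LIMSEQ_le_const2, intro exI allI impI)
    fix q
    have int: "integrable M (\<lambda>\<omega>. of_bool (X t \<omega> = i) * (of_bool (X (t + k * (h / Suc q)) \<omega> \<noteq> i) :: real))" for k :: nat
    proof (rule integrable_bounded[where C=1])
      show "(\<lambda>\<omega>. of_bool (X t \<omega> = i) * (of_bool (X (t + k * (h / Suc q)) \<omega> \<noteq> i) :: real)) \<in> borel_measurable M"
        by measurable
    qed simp
    have "(LINT \<omega>|M. of_bool (X t \<omega> = i) * \<bar>R q \<omega> - h * lam i\<bar>)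
       \<le> (LINT \<omega>|M. (\<Sum>k=1..Suc q. h / Suc q * lmax * (of_bool (X t \<omega> = i) * of_bool (X (t + k * (h / Suc q)) \<omega> \<noteq> i))))"
    proof (rule integral_mono)
      show "integrable M (\<lambda>\<omega>. of_bool (X t \<omega> = i) * \<bar>R q \<omega> - h * lam i\<bar>)"
        using bound t lmax_pos by (intro integrable_bounded[where C="h * lmax"]) auto
      show "integrable M (\<lambda>\<omega>. (\<Sum>k=1..Suc q. h / Suc q * lmax * (of_bool (X t \<omega> = i) * of_bool (X (t + k * (h / Suc q)) \<omega> \<noteq> i))))"
        by (intro Bochner_Integration.integrable_sum integrable_mult_right int)
      show "of_bool (X t \<omega> = i) * \<bar>R q \<omega> - h * lam i\<bar>
        \<le> (\<Sum>k=1..Suc q. h / Suc q * lmax * (of_bool (X t \<omega> = i) * of_bool (X (t + k * (h / Suc q)) \<omega> \<noteq> i)))" for \<omega>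
        using dev[of q \<omega>] by (cases "X t \<omega> = i") (simp_all del: sum.cl_ivl_Suc)
    qed
    also have "\<dots> = (\<Sum>k=1..Suc q. h / Suc q * lmax * (LINT \<omega>|M. of_bool (X t \<omega> = i) * of_bool (X (t + k * (h / Suc q)) \<omega> \<noteq> i)))"
      using int by (subst Bochner_Integration.integral_sum) (auto simp del: sum.cl_ivl_Suc)
    also have "\<dots> \<le> (\<Sum>k=1..Suc q. h / Suc q * lmax * (pX t i * \<epsilon>))"
    proof (intro sum_mono mult_left_mono)
      fix k assume k: "k \<in> {1..Suc q}"
      have kh: "0 < k * (h / Suc q)" "k * (h / Suc q) \<le> h"
        using grid_point_le(2)[OF k, of 0 h] t k by auto
      have "(LINT \<omega>|M. of_bool (X t \<omega> = i) * of_bool (X (t + k * (h / Suc q)) \<omega> \<noteq> i)) = pX t i * (1 - P (k * (h / Suc q)) $ i $ i)"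
        using t kh by (intro leave_prob) auto
      also have "\<dots> \<le> pX t i * \<epsilon>" using stay[OF kh] by (intro mult_left_mono) auto
      finally show "(LINT \<omega>|M. of_bool (X t \<omega> = i) * of_bool (X (t + k * (h / Suc q)) \<omega> \<noteq> i)) \<le> pX t i * \<epsilon>" .
    qed (use t lmax_pos in auto)
    also have "\<dots> = h * lmax * \<epsilon> * pX t i" by (simp only: sum_constant card_atLeastAtMost) simp
    finally show "(LINT \<omega>|M. of_bool (X t \<omega> = i) * \<bar>R q \<omega> - h * lam i\<bar>) \<le> h * lmax * \<epsilon> * pX t i" .
  qed
qed

text \<open>
The leading terms of the probabilities of a cell with no arrival (\<open>m = 0\<close>) and with one
arrival (\<open>m = 1\<close>).
\<close>

definition rate :: "nat \<Rightarrow> real \<Rightarrow> 'n \<Rightarrow> 'n \<Rightarrow> real" where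
  "rate m h i j = (if m = 0 then of_bool (i = j) * (1 - h * lam i) + h * Q $ i $ j
                   else of_bool (i = j) * h * lam i)"

lemma rate_limit:
  assumes "m \<le> 1"
  shows "((\<lambda>h. (P h $ i $ j * pois m (h * lam i) - rate m h i j) / h) \<longlongrightarrow> 0) (at_right 0)"
proof -
  have e: "((\<lambda>h. (exp (- (h * lam i)) - 1) / h) \<longlongrightarrow> - lam i) (at_right 0)"
  proof -
    have "((\<lambda>h. exp (- (h * lam i))) has_field_derivative - lam i) (at 0)"
      by (auto intro!: derivative_eq_intros)
    then have "((\<lambda>h. (exp (- (h * lam i)) - 1) / h) \<longlongrightarrow> - lam i) (at 0)"
      by (simp add: has_field_derivative_iff)
    then show ?thesis by (rule tendsto_within_subset) auto
  qed
  have e1: "((\<lambda>h. exp (- (h * lam i))) \<longlongrightarrow> exp (- (0 * lam i))) (at_right 0)" by (intro tendsto_intros)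
  consider "m = 0" | "m = 1" using assms by linarith
  then show ?thesis
  proof cases
    case 1
    have "((\<lambda>h. (P h $ i $ j - of_bool (i = j)) / h + P h $ i $ j * ((exp (- (h * lam i)) - 1) / h)
        + of_bool (i = j) * lam i - Q $ i $ j) \<longlongrightarrow> Q $ i $ j + of_bool (i = j) * (- lam i) + of_bool (i = j) * lam i - Q $ i $ j) (at_right 0)"
      by (intro tendsto_intros P_deriv P_cont e)
    then have "((\<lambda>h. (P h $ i $ j - of_bool (i = j)) / h + P h $ i $ j * ((exp (- (h * lam i)) - 1) / h)
        + of_bool (i = j) * lam i - Q $ i $ j) \<longlongrightarrow> 0) (at_right 0)" by simp
    then show ?thesis
      by (rule Lim_transform_eventually)
         (auto simp: eventually_at_right_field 1 pois_def rate_def field_simps intro!: exI[of _ 1])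
  next
    case 2
    have "((\<lambda>h. P h $ i $ j * lam i * exp (- (h * lam i)) - of_bool (i = j) * lam i)
       \<longlongrightarrow> of_bool (i = j) * lam i * exp (- (0 * lam i)) - of_bool (i = j) * lam i) (at_right 0)"
      by (intro tendsto_intros P_cont e1)
    then have "((\<lambda>h. P h $ i $ j * lam i * exp (- (h * lam i)) - of_bool (i = j) * lam i) \<longlongrightarrow> 0) (at_right 0)" by simp
    then show ?thesis
      by (rule Lim_transform_eventually)
         (auto simp: eventually_at_right_field 2 pois_def rate_def field_simps intro!: exI[of _ 1])
  qed
qed

text \<open>
Replacing the intensity by that of a frozen background costs \<open>o(h)\<close> by \<open>cum_deviation\<close>;
what remains is the expansion of \<open>P h\<close> and of the Poisson probabilities at \<open>h = 0\<close>.  The error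
is relative to the probability of the initial state, so that the errors of many cells can be
added.
\<close>

lemma slot_estimate:
  assumes \<epsilon>: "0 < \<epsilon>" and m: "m \<le> 1"
  shows "\<forall>\<^sub>F h in at_right 0. \<forall>t\<ge>0. \<forall>i j.
     \<bar>(LINT \<omega>|M. slot m t h i j \<omega>) - pX t i * rate m h i j\<bar> \<le> \<epsilon> * h * pX t i"
proof -
  define \<epsilon>1 where "\<epsilon>1 = \<epsilon> / 2 / lmax"
  have \<epsilon>1: "0 < \<epsilon>1" "lmax * \<epsilon>1 = \<epsilon> / 2" using \<epsilon> lmax_pos by (auto simp: \<epsilon>1_def)
  have "\<forall>\<^sub>F h in at_right 0. 1 - \<epsilon>1 < P h $ i $ i" for i
    by (rule order_tendstoD(1)[OF P_cont]) (use \<epsilon>1 in simp)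
  then have "\<forall>\<^sub>F h in at_right 0. \<forall>i. 1 - \<epsilon>1 < P h $ i $ i" by (rule eventually_all_finite)
  then obtain b where b: "0 < b" "\<And>h i. 0 < h \<Longrightarrow> h < b \<Longrightarrow> 1 - \<epsilon>1 < P h $ i $ i"
    by (auto simp: eventually_at_right_field)
  have "\<forall>\<^sub>F h in at_right 0. \<bar>(P h $ i $ j * pois m (h * lam i) - rate m h i j) / h\<bar> < \<epsilon> / 2" for i j
    by (rule order_tendstoD(2)[OF tendsto_rabs_zero[OF rate_limit[OF m, of i j]]]) (use \<epsilon> in simp)
  then have lim: "\<forall>\<^sub>F h in at_right 0. \<forall>i j. \<bar>(P h $ i $ j * pois m (h * lam i) - rate m h i j) / h\<bar> < \<epsilon> / 2"
    by (intro eventually_all_finite)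
  have "\<forall>\<^sub>F h in at_right 0. 0 < h \<and> h < b" using b(1) by (auto simp: eventually_at_right_field)
  then show ?thesis using lim
  proof eventually_elim
    case (elim h)
    then have h: "0 < h" "h < b" by auto
    show ?case
    proof (intro allI impI)
      fix t i j assume t: "0 \<le> (t::real)"
      have [measurable]: "X t \<in> measurable M (count_space UNIV)" "X (t + h) \<in> measurable M (count_space UNIV)"
        using t h by (auto intro!: X_meas)
      have [measurable]: "cum t (t + h) \<in> borel_measurable M" using t h by (intro cum_measurable) auto
      let ?a = "\<lambda>\<omega>. of_bool (X t \<omega> = i) * of_bool (X (t + h) \<omega> = j) :: real"
      let ?c = "cum t (t + h)"
      have c: "0 \<le> ?c \<omega>" "?c \<omega> \<le> h * lmax" if "\<omega> \<in> space M" for \<omega>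
        using cum_pos[of t "t + h" \<omega>] cum_bounds(2)[of t "t + h" \<omega> lmin lmax] t h lmin_le lam_le that by auto
      have hl: "0 \<le> h * lam i" using h lam_pos[of i] by auto
      have lip: "\<bar>pois m (?c \<omega>) - pois m (h * lam i)\<bar> \<le> \<bar>?c \<omega> - h * lam i\<bar>" if "\<omega> \<in> space M" for \<omega>
        using exp_neg_lipschitz[OF c(1)[OF that] hl] m by (cases m) (auto simp: pois_def)
      have intp: "integrable M (\<lambda>\<omega>. ?a \<omega> * pois m (?c \<omega>))"
        by (intro integrable_bounded[where C=1]) (use pois_le_1 c(1) in auto)
      have inta: "integrable M (\<lambda>\<omega>. ?a \<omega> * pois m (h * lam i))"
        by (intro integrable_mult_left integrable_bounded[where C=1]) auto
      have "(LINT \<omega>|M. slot m t h i j \<omega>) = (LINT \<omega>|M. ?a \<omega> * pois m (?c \<omega>))"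
        using expectation_slot[OF t h(1)] by (simp add: mult_ac)
      moreover have "(LINT \<omega>|M. ?a \<omega> * pois m (h * lam i)) = pX t i * (P h $ i $ j * pois m (h * lam i))"
        using two_states[of t h i j] t h by simp
      ultimately have "\<bar>(LINT \<omega>|M. slot m t h i j \<omega>) - pX t i * (P h $ i $ j * pois m (h * lam i))\<bar>
          = \<bar>LINT \<omega>|M. ?a \<omega> * pois m (?c \<omega>) - ?a \<omega> * pois m (h * lam i)\<bar>"
        using intp inta by (subst Bochner_Integration.integral_diff) auto
      also have "\<dots> \<le> (LINT \<omega>|M. \<bar>?a \<omega> * pois m (?c \<omega>) - ?a \<omega> * pois m (h * lam i)\<bar>)" by (rule integral_abs_bound)
      also have "\<dots> \<le> (LINT \<omega>|M. of_bool (X t \<omega> = i) * \<bar>?c \<omega> - h * lam i\<bar>)"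
      proof (rule integral_mono)
        show "integrable M (\<lambda>\<omega>. \<bar>?a \<omega> * pois m (?c \<omega>) - ?a \<omega> * pois m (h * lam i)\<bar>)"
          using intp inta by (intro integrable_abs Bochner_Integration.integrable_diff)
        show "integrable M (\<lambda>\<omega>. of_bool (X t \<omega> = i) * \<bar>?c \<omega> - h * lam i\<bar>)"
        proof (rule integrable_bounded[where C="h * lmax"])
          fix \<omega> assume w: "\<omega> \<in> space M"
          have "h * lam i \<le> h * lmax" using h lam_le by (intro mult_left_mono) auto
          then have "\<bar>?c \<omega> - h * lam i\<bar> \<le> h * lmax" using c[OF w] hl by auto
          then show "norm (of_bool (X t \<omega> = i) * \<bar>?c \<omega> - h * lam i\<bar>) \<le> h * lmax" by auto
        qed simp
        show "\<bar>?a \<omega> * pois m (?c \<omega>) - ?a \<omega> * pois m (h * lam i)\<bar> \<le> of_bool (X t \<omega> = i) * \<bar>?c \<omega> - h * lam i\<bar>"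
          if "\<omega> \<in> space M" for \<omega> using lip[OF that] by (auto simp: of_bool_def)
      qed
      also have "\<dots> \<le> h * lmax * \<epsilon>1 * pX t i"
      proof (rule cum_deviation[OF t h(1)])
        fix u assume "0 < u" "u \<le> h"
        then have "1 - \<epsilon>1 < P u $ i $ i" using h by (intro b(2)) auto
        then show "1 - P u $ i $ i \<le> \<epsilon>1" by simp
      qed
      also have "\<dots> = \<epsilon> / 2 * h * pX t i" using \<epsilon>1(2) by (simp add: mult_ac)
      finally have 1: "\<bar>(LINT \<omega>|M. slot m t h i j \<omega>) - pX t i * (P h $ i $ j * pois m (h * lam i))\<bar> \<le> \<epsilon> / 2 * h * pX t i" .
      have "\<bar>P h $ i $ j * pois m (h * lam i) - rate m h i j\<bar> \<le> \<epsilon> / 2 * h"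
        using elim(2)[rule_format, of i j] h by (simp add: abs_divide field_simps)
      then have "pX t i * \<bar>P h $ i $ j * pois m (h * lam i) - rate m h i j\<bar> \<le> pX t i * (\<epsilon> / 2 * h)"
        by (intro mult_left_mono) auto
      then have 2: "\<bar>pX t i * (P h $ i $ j * pois m (h * lam i)) - pX t i * rate m h i j\<bar> \<le> \<epsilon> / 2 * h * pX t i"
        by (simp only: abs_mult right_diff_distrib[symmetric] abs_of_nonneg[OF measure_nonneg] mult.commute[of "pX t i" "\<epsilon> / 2 * h"])
      have "\<epsilon> * h * pX t i = \<epsilon> / 2 * h * pX t i + \<epsilon> / 2 * h * pX t i" by simp
      with 1 2 show "\<bar>(LINT \<omega>|M. slot m t h i j \<omega>) - pX t i * rate m h i j\<bar> \<le> \<epsilon> * h * pX t i"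
        by linarith
    qed
  qed
qed

lemma slot_BA:
  assumes "0 \<le> t" "0 \<le> h" shows "slot m t h i j \<in> borel_measurable BA"
proof -
  have [measurable]: "X t \<in> measurable BA (count_space UNIV)" "X (t + h) \<in> measurable BA (count_space UNIV)"
    using assms by (auto intro!: X_BA)
  have [measurable]: "Measurable.pred BA (counts T m t (t + h))" using T_BA by (rule pred_counts)
  show ?thesis unfolding slot_def by measurable
qed

text \<open>
The service laws of the customers present depend on their arrival states, which belong to the
past at time \<open>t\<close> provided the \<open>n\<close>th customer has arrived by then.  This is why \<open>f\<close> has
to vanish for \<open>t < T n\<close>.
\<close>

lemma one_step_exact:
  fixes f :: "'w \<Rightarrow> complex"
  assumes n: "1 \<le> n" and t: "0 \<le> t" "0 < h"
    and f: "f \<in> borel_measurable (with_services n (past t))" "\<And>\<omega>. \<omega> \<in> space M \<Longrightarrow> norm (f \<omega>) \<le> C"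
    and supp: "\<And>\<omega>. \<omega> \<in> space M \<Longrightarrow> t < T n \<omega> \<Longrightarrow> f \<omega> = 0"
  shows "of_real (pX t i) * (LINT \<omega>|M. f \<omega> * of_real (slot m t h i j \<omega>))
     = of_real (LINT \<omega>|M. slot m t h i j \<omega>) * (LINT \<omega>|M. f \<omega> * of_bool (X t \<omega> = i))"
proof -
  let ?p = "pX t i" and ?e = "LINT \<omega>|M. slot m t h i j \<omega>"
  define D' where "D' \<omega> = ?p * slot m t h i j \<omega> - ?e * of_bool (X t \<omega> = i)" for \<omega>
  define D where "D \<omega> = of_bool (T n \<omega> \<le> t) * D' \<omega>" for \<omega>
  have th: "0 \<le> h" using t by simp
  note [measurable] = slot_BA[OF t(1) th, of m i j]
  have e1: "\<bar>?e\<bar> \<le> 1"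
    using norm_expectation_le[where C=1, OF slot_meas[OF t(1) th, of m i j]] slot_bounds by simp
  have D'BA: "D' \<in> borel_measurable BA"
  proof -
    have [measurable]: "X t \<in> measurable BA (count_space UNIV)" using t by (intro X_BA)
    show ?thesis unfolding D'_def by measurable
  qed
  have DBA: "D \<in> borel_measurable BA"
  proof -
    note [measurable] = D'BA T_BA[OF n]
    show ?thesis unfolding D_def by measurable
  qed
  have Db: "\<bar>D \<omega>\<bar> \<le> 2" for \<omega>
  proof -
    have "\<bar>?p * slot m t h i j \<omega>\<bar> \<le> 1 * 1" unfolding abs_mult using slot_bounds by (intro mult_mono) auto
    moreover have "\<bar>?e * of_bool (X t \<omega> = i)\<bar> \<le> 1 * 1" unfolding abs_mult using e1 by (intro mult_mono) auto
    ultimately show ?thesis unfolding D_def D'_def by auto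
  qed
  have oD: "orth M (sets (past t)) D"
    unfolding orth_def
  proof
    fix E assume E: "E \<in> sets (past t)"
    have TE: "{\<omega>\<in>space M. T n \<omega> \<le> t} \<inter> E \<in> sets (past t)" using E T_past_sets[OF n t(1) order_refl] by auto
    have "(LINT \<omega>|M. indicator E \<omega> * D \<omega>) = (LINT \<omega>|M. indicator ({\<omega>\<in>space M. T n \<omega> \<le> t} \<inter> E) \<omega> * D' \<omega>)"
      by (rule Bochner_Integration.integral_cong) (auto simp: D_def indicator_def)
    also have "\<dots> = 0" using orth_past[OF t, of i m j] TE unfolding D'_def orth_def by blast
    finally show "(LINT \<omega>|M. indicator E \<omega> * D \<omega>) = 0" .
  qed
  have o: "orth M (sets (with_services n (past t))) D"
  proof (rule orth_services[OF subalgebra_BA_past DBA Db oD])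
    fix x
    \<comment> \<open>The factor contributed by the services, written with truncated arrival epochs.\<close>
    define g where "g \<omega> = (\<Prod>k=1..n. cdf (B (X (min (T k \<omega>) t) \<omega>)) (x k))" for \<omega>
    have "g \<in> borel_measurable (past t)"
      unfolding g_def
    proof (intro borel_measurable_prod)
      fix k assume "k \<in> {1..n}"
      then have "(\<lambda>\<omega>. X (min (T k \<omega>) t) \<omega>) \<in> measurable (past t) (count_space UNIV)"
        using t by (intro X_at_T_past) auto
      then show "(\<lambda>\<omega>. cdf (B (X (min (T k \<omega>) t) \<omega>)) (x k)) \<in> borel_measurable (past t)"
        by (rule measurable_compose) simp
    qed
    moreover have "\<bar>g \<omega>\<bar> \<le> 1" for \<omega>
      unfolding g_def abs_prod by (rule prod_le_1) (auto simp: cdf_B_bounds)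
    moreover have "g \<omega> * D \<omega> = service_cdf n x \<omega> * D \<omega>" if w: "\<omega> \<in> space M" for \<omega>
    proof (cases "T n \<omega> \<le> t")
      case True
      have "T k \<omega> \<le> t" if "k \<in> {1..n}" for k using T_less[OF w, of k n] that True by (cases "k = n") auto
      then have "g \<omega> = service_cdf n x \<omega>" unfolding g_def arrival_state_def by (intro prod.cong) (auto simp: min_absorb1)
      then show ?thesis by simp
    qed (simp add: D_def)
    ultimately show "\<exists>f. f \<in> borel_measurable (past t) \<and> (\<forall>\<omega>\<in>space M. \<bar>f \<omega>\<bar> \<le> 1 \<and> f \<omega> * D \<omega> = service_cdf n x \<omega> * D \<omega>)"
      by blast
  qed
  have sub: "subalgebra M (with_services n (past t))" by (rule subalgebra_with_services[OF subalgebra_past])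
  have [measurable]: "D \<in> borel_measurable M" using subalgebra_BA DBA by (rule measurable_from_subalg)
  have [measurable]: "f \<in> borel_measurable M" using sub f(1) by (rule measurable_from_subalg)
  note [measurable] = slot_meas[OF t(1) th]
  have [measurable]: "X t \<in> measurable M (count_space UNIV)" using t by (intro X_meas)
  have intD: "integrable M D" using Db by (intro integrable_bounded[where C=2]) auto
  have C0: "0 \<le> C" using bound_nonneg[of f C] f by auto
  have i1: "integrable M (\<lambda>\<omega>. f \<omega> * of_real (slot m t h i j \<omega>))"
  proof (rule integrable_bounded[where C=C])
    fix \<omega> assume "\<omega> \<in> space M"
    then show "norm (f \<omega> * of_real (slot m t h i j \<omega>)) \<le> C"
      using f(2)[of \<omega>] C0 slot_01[of m t h i j \<omega>] by auto
  qed measurable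
  have i2: "integrable M (\<lambda>\<omega>. f \<omega> * of_bool (X t \<omega> = i))"
    using f(2) C0 by (intro integrable_bounded[where C=C]) auto
  have "0 = (LINT \<omega>|M. f \<omega> * of_real (D \<omega>))"
    by (rule orth_integral[OF sub o intD f, symmetric])
  also have "\<dots> = (LINT \<omega>|M. of_real ?p * (f \<omega> * of_real (slot m t h i j \<omega>)) - of_real ?e * (f \<omega> * of_bool (X t \<omega> = i)))"
  proof (rule Bochner_Integration.integral_cong)
    fix \<omega> assume w: "\<omega> \<in> space M"
    show "f \<omega> * of_real (D \<omega>) = of_real ?p * (f \<omega> * of_real (slot m t h i j \<omega>)) - of_real ?e * (f \<omega> * of_bool (X t \<omega> = i))"
      using supp[OF w] by (cases "T n \<omega> \<le> t") (auto simp: D_def D'_def algebra_simps)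
  qed simp
  also have "\<dots> = of_real ?p * (LINT \<omega>|M. f \<omega> * of_real (slot m t h i j \<omega>)) - of_real ?e * (LINT \<omega>|M. f \<omega> * of_bool (X t \<omega> = i))"
    using i1 i2 by (subst Bochner_Integration.integral_diff) auto
  finally show ?thesis by simp
qed

text \<open>
Since the exact cell probabilities are conditionally independent of \<open>f\<close>, the estimate for
them carries over with the same relative error.
\<close>

lemma one_step:
  assumes \<epsilon>: "0 < \<epsilon>" and m: "m \<le> 1"
  shows "\<forall>\<^sub>F h in at_right 0. \<forall>t\<ge>0. \<forall>n\<ge>1. \<forall>f C i j.
     f \<in> borel_measurable (with_services n (past t)) \<longrightarrow> (\<forall>\<omega>\<in>space M. norm (f \<omega>) \<le> C) \<longrightarrow>
     (\<forall>\<omega>\<in>space M. t < T n \<omega> \<longrightarrow> f \<omega> = 0) \<longrightarrow>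
     norm ((LINT \<omega>|M. f \<omega> * of_real (slot m t h i j \<omega>)) - of_real (rate m h i j) * (LINT \<omega>|M. f \<omega> * of_bool (X t \<omega> = i)))
       \<le> \<epsilon> * h * (LINT \<omega>|M. norm (f \<omega> :: complex) * of_bool (X t \<omega> = i))"
proof -
  have "\<forall>\<^sub>F h in at_right 0. 0 < (h::real)" by (simp add: eventually_at_right_less)
  with slot_estimate[OF \<epsilon> m] show ?thesis
  proof eventually_elim
    case (elim h)
    show ?case
    proof (intro allI impI)
      fix t :: real and n :: nat and f :: "'w \<Rightarrow> complex" and C i j
      assume t: "0 \<le> t" and n: "1 \<le> n" and f: "f \<in> borel_measurable (with_services n (past t))" "\<forall>\<omega>\<in>space M. norm (f \<omega>) \<le> C"
        and supp: "\<forall>\<omega>\<in>space M. t < T n \<omega> \<longrightarrow> f \<omega> = 0"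
      let ?F = "LINT \<omega>|M. f \<omega> * of_real (slot m t h i j \<omega>)" and ?G = "LINT \<omega>|M. f \<omega> * of_bool (X t \<omega> = i)"
      let ?N = "LINT \<omega>|M. norm (f \<omega>) * of_bool (X t \<omega> = i)"
      let ?p = "pX t i" and ?e = "LINT \<omega>|M. slot m t h i j \<omega>"
      have [measurable]: "f \<in> borel_measurable M"
        using subalgebra_with_services[OF subalgebra_past] f(1) by (rule measurable_from_subalg)
      have [measurable]: "X t \<in> measurable M (count_space UNIV)" using t by (intro X_meas)
      have [measurable]: "slot m t h i j \<in> borel_measurable M" using t elim by (intro slot_meas) auto
      have G: "norm ?G \<le> ?N"
        using integral_norm_bound[of M "\<lambda>\<omega>. f \<omega> * of_bool (X t \<omega> = i)"] by (simp add: norm_mult norm_of_bool_eq)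
      have N0: "0 \<le> ?N" by (intro Bochner_Integration.integral_nonneg) auto
      have eq: "of_real ?p * ?F = of_real ?e * ?G"
        using one_step_exact[OF n t elim(2) f(1)] f(2) supp by blast
      have est: "\<bar>?e - ?p * rate m h i j\<bar> \<le> \<epsilon> * h * ?p" using elim(1) t by blast
      show "norm (?F - of_real (rate m h i j) * ?G) \<le> \<epsilon> * h * ?N"
      proof (cases "?p = 0")
        case True
        then have ae: "AE \<omega> in M. X t \<omega> \<noteq> i" using X_sets[OF t] by (auto simp: prob_eq_0)
        have "?F = (LINT \<omega>|M. 0)"
        proof (rule integral_cong_AE)
          show "AE \<omega> in M. f \<omega> * of_real (slot m t h i j \<omega>) = 0"
            using ae by eventually_elim (simp add: slot_def)
        qed auto
        moreover have "?G = (LINT \<omega>|M. 0)"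
          by (rule integral_cong_AE) (use ae in \<open>auto elim!: eventually_mono\<close>)
        ultimately show ?thesis using N0 \<epsilon> elim by simp
      next
        case False
        then have p: "0 < ?p" by (simp add: zero_less_measure_iff)
        have "of_real ?p * (?F - of_real (rate m h i j) * ?G) = of_real (?e - ?p * rate m h i j) * ?G"
          using eq by (simp add: algebra_simps)
        then have "?p * norm (?F - of_real (rate m h i j) * ?G) = \<bar>?e - ?p * rate m h i j\<bar> * norm ?G"
        proof -
          assume "of_real ?p * (?F - of_real (rate m h i j) * ?G) = of_real (?e - ?p * rate m h i j) * ?G"
          from arg_cong[OF this, of norm] show ?thesis
            unfolding norm_mult norm_of_real by (simp only: abs_of_pos[OF p])
        qed
        also have "\<dots> \<le> (\<epsilon> * h * ?p) * ?N" using est G by (intro mult_mono) auto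
        finally have "?p * norm (?F - of_real (rate m h i j) * ?G) \<le> ?p * (\<epsilon> * h * ?N)" by (simp add: mult_ac)
        then show ?thesis using p by simp
      qed
    qed
  qed
qed

end

section \<open>The discretised evolution between two arrivals\<close>

text \<open>
The transform of the workload at time \<open>t\<close> when no customer arrives before \<open>t\<close> and the
workload reaches 0 at time \<open>x\<close>.
\<close>

definition drift :: "real \<Rightarrow> complex \<Rightarrow> complex \<Rightarrow> real \<Rightarrow> complex" where
  "drift x s \<eta> t = exp (- s * of_real (max 0 (x - t)) - \<eta> * of_real t)"

lemma norm_drift_le: "0 \<le> Re s \<Longrightarrow> 0 \<le> Re \<eta> \<Longrightarrow> 0 \<le> t \<Longrightarrow> norm (drift x s \<eta> t) \<le> 1"
proof -
  assume *: "0 \<le> Re s" "0 \<le> Re \<eta>" "0 \<le> t"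
  have "0 \<le> Re s * max 0 (x - t)" "0 \<le> Re \<eta> * t" using * by auto
  then show ?thesis by (simp add: drift_def)
qed

lemma norm_exp_minus_one:
  fixes z :: complex
  assumes "norm z \<le> R"
  shows "norm (exp z - 1) \<le> exp R * norm z" "norm (exp z - 1 - z) \<le> exp R * (norm z)\<^sup>2"
proof -
  have R: "exp \<bar>Re z\<bar> \<le> exp R" using abs_Re_le_cmod[of z] assms by simp
  have "norm (exp z - (\<Sum>k\<le>0. z ^ k / fact k)) \<le> exp \<bar>Re z\<bar> * norm z ^ Suc 0 / fact 0" by (rule Taylor_exp)
  also have "\<dots> \<le> exp R * norm z" using R by (simp add: mult_right_mono)
  finally show "norm (exp z - 1) \<le> exp R * norm z" by simp
  have "norm (exp z - (\<Sum>k\<le>1. z ^ k / fact k)) \<le> exp \<bar>Re z\<bar> * norm z ^ Suc 1 / fact 1" by (rule Taylor_exp)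
  also have "\<dots> \<le> exp R * (norm z)\<^sup>2" using R by (simp add: mult_right_mono power2_eq_square)
  finally show "norm (exp z - 1 - z) \<le> exp R * (norm z)\<^sup>2" by (simp add: algebra_simps)
qed

text \<open>
The derivative of \<open>drift\<close> with respect to \<open>t\<close> is \<open>(s - \<eta>) drift\<close> while the server is busy and
\<open>- \<eta> drift\<close> while it is idle.  The correction term, which accounts for the idle period, is \<open>s\<close>
times an expression that is free of \<open>s\<close>.  The single cell that contains \<open>x\<close> has a first order
error only.
\<close>

lemma drift_step:
  fixes s \<eta> :: complex
  assumes s: "0 \<le> Re s" and \<eta>: "0 \<le> Re \<eta>"
  obtains C where "0 \<le> C"
    "\<And>x t h. 0 \<le> t \<Longrightarrow> 0 < h \<Longrightarrow> h \<le> 1 \<Longrightarrow> norm (drift x s \<eta> (t + h) - drift x s \<eta> t) \<le> C * h"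
    "\<And>x t h. 0 \<le> t \<Longrightarrow> 0 < h \<Longrightarrow> h \<le> 1 \<Longrightarrow>
      norm (drift x s \<eta> (t + h) - (drift x s \<eta> t * (1 + of_real h * (s - \<eta>))
          - s * of_real h * (of_bool (x \<le> t) * exp (- \<eta> * of_real t))))
        \<le> C * h\<^sup>2 + C * h * of_bool (t < x \<and> x < t + h)"
proof -
  define R where "R = norm s + norm \<eta>"
  define E where "E = exp R"
  have R0: "0 \<le> R" and E1: "1 \<le> E" by (auto simp: R_def E_def)
  define C where "C = 2 * E * R + R + E * R\<^sup>2"
  have ER: "0 \<le> E * R" using R0 E1 by simp
  have C0: "0 \<le> C" unfolding C_def using R0 E1 by auto
  have ex: "norm (exp z - 1) \<le> E * R * h" "norm (exp z - 1 - z) \<le> E * R\<^sup>2 * h\<^sup>2"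
    if z: "norm z \<le> R * h" and h: "0 < h" "h \<le> 1" for z :: complex and h
  proof -
    have zR: "norm z \<le> R" using z h R0 mult_left_mono[of h 1 R] by simp
    have "exp R * norm z \<le> exp R * (R * h)" using z by (intro mult_left_mono) auto
    from order_trans[OF norm_exp_minus_one(1)[OF zR] this] show "norm (exp z - 1) \<le> E * R * h" by (simp add: E_def mult.assoc)
    have "(norm z)\<^sup>2 \<le> (R * h)\<^sup>2" using z by (intro power_mono) auto
    then have "exp R * (norm z)\<^sup>2 \<le> exp R * (R * h)\<^sup>2" by (intro mult_left_mono) auto
    from order_trans[OF norm_exp_minus_one(2)[OF zR] this] show "norm (exp z - 1 - z) \<le> E * R\<^sup>2 * h\<^sup>2"
      by (simp add: E_def mult.assoc power_mult_distrib)
  qed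
  have nz: "norm (- \<eta> * of_real h) \<le> R * h" "norm ((s - \<eta>) * of_real h) \<le> R * h"
    "\<And>y. 0 \<le> y \<Longrightarrow> y \<le> h \<Longrightarrow> norm (- s * of_real y) \<le> R * h" if "0 < h" for h
  proof -
    show "norm (- \<eta> * of_real h) \<le> R * h" using that by (simp add: norm_mult R_def)
    show "norm ((s - \<eta>) * of_real h) \<le> R * h"
      using that norm_triangle_ineq4[of s \<eta>] by (simp add: norm_mult R_def)
    show "norm (- s * of_real y) \<le> R * h" if "0 \<le> y" "y \<le> h" for y
      using that by (simp add: norm_mult R_def) (intro mult_mono, auto)
  qed
  have le: "norm (exp (- \<eta> * of_real t)) \<le> 1" if "0 \<le> t" for t using that \<eta> by simp
  have both: "norm (drift x s \<eta> (t + h) - drift x s \<eta> t) \<le> 2 * E * R * h \<and>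
     norm (drift x s \<eta> (t + h) - (drift x s \<eta> t * (1 + of_real h * (s - \<eta>))
          - s * of_real h * (of_bool (x \<le> t) * exp (- \<eta> * of_real t))))
        \<le> C * h\<^sup>2 + C * h * of_bool (t < x \<and> x < t + h)" if t: "0 \<le> t" and h: "0 < h" "h \<le> 1" for x t h
  proof -
    have ERh: "0 \<le> E * R * h" "0 \<le> E * R\<^sup>2 * h\<^sup>2" using ER E1 h by auto
    have Ch: "E * R\<^sup>2 * h\<^sup>2 \<le> C * h\<^sup>2" unfolding C_def using ER R0 by (intro mult_right_mono) auto
    have fin: "z \<le> C * h\<^sup>2 + C * h * of_bool b" if "z \<le> 1 * (E * R\<^sup>2 * h\<^sup>2)" for z b
    proof -
      have "0 \<le> C * h * of_bool b" using C0 h by simp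
      then show ?thesis using that Ch by linarith
    qed
    consider "x \<le> t" | "t + h \<le> x" | "t < x" "x < t + h" by linarith
    then show ?thesis
    proof cases
      case 1
      have a: "drift x s \<eta> (t + h) = exp (- \<eta> * of_real t) * exp (- \<eta> * of_real h)"
        using 1 h by (simp add: drift_def algebra_simps flip: exp_add)
      have b: "drift x s \<eta> t = exp (- \<eta> * of_real t)" using 1 by (simp add: drift_def)
      have "drift x s \<eta> (t + h) - drift x s \<eta> t = exp (- \<eta> * of_real t) * (exp (- \<eta> * of_real h) - 1)"
        unfolding a b by (simp add: algebra_simps)
      then have d1: "norm (drift x s \<eta> (t + h) - drift x s \<eta> t) \<le> 1 * (E * R * h)"
        using ex(1)[OF nz(1) h] le[OF t] h by (simp only: norm_mult) (intro mult_mono, auto)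
      have "drift x s \<eta> (t + h) - (drift x s \<eta> t * (1 + of_real h * (s - \<eta>))
          - s * of_real h * (of_bool (x \<le> t) * exp (- \<eta> * of_real t)))
         = exp (- \<eta> * of_real t) * (exp (- \<eta> * of_real h) - 1 - (- \<eta> * of_real h))"
        unfolding a b using 1 by (simp add: algebra_simps)
      then have "norm (drift x s \<eta> (t + h) - (drift x s \<eta> t * (1 + of_real h * (s - \<eta>))
          - s * of_real h * (of_bool (x \<le> t) * exp (- \<eta> * of_real t)))) \<le> 1 * (E * R\<^sup>2 * h\<^sup>2)"
        using ex(2)[OF nz(1) h] le[OF t] h by (simp only: norm_mult) (intro mult_mono, auto)
      from fin[OF this, of "t < x \<and> x < t + h"] d1 ERh show ?thesis by (intro conjI) linarith+
    next
      case 2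
      have a: "drift x s \<eta> (t + h) = drift x s \<eta> t * exp ((s - \<eta>) * of_real h)"
        using 2 h by (simp add: drift_def algebra_simps flip: exp_add)
      have b: "norm (drift x s \<eta> t) \<le> 1" using norm_drift_le s \<eta> t by auto
      have "drift x s \<eta> (t + h) - drift x s \<eta> t = drift x s \<eta> t * (exp ((s - \<eta>) * of_real h) - 1)"
        unfolding a by (simp add: algebra_simps)
      then have d1: "norm (drift x s \<eta> (t + h) - drift x s \<eta> t) \<le> 1 * (E * R * h)"
        using ex(1)[OF nz(2) h] b h by (simp only: norm_mult) (intro mult_mono, auto)
      have "drift x s \<eta> (t + h) - (drift x s \<eta> t * (1 + of_real h * (s - \<eta>))
          - s * of_real h * (of_bool (x \<le> t) * exp (- \<eta> * of_real t)))
         = drift x s \<eta> t * (exp ((s - \<eta>) * of_real h) - 1 - (s - \<eta>) * of_real h)"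
        unfolding a using 2 h by (simp add: algebra_simps)
      then have "norm (drift x s \<eta> (t + h) - (drift x s \<eta> t * (1 + of_real h * (s - \<eta>))
          - s * of_real h * (of_bool (x \<le> t) * exp (- \<eta> * of_real t)))) \<le> 1 * (E * R\<^sup>2 * h\<^sup>2)"
        using ex(2)[OF nz(2) h] b h by (simp only: norm_mult) (intro mult_mono, auto)
      from fin[OF this, of "t < x \<and> x < t + h"] d1 ERh show ?thesis by (intro conjI) linarith+
    next
      case 3
      have "drift x s \<eta> (t + h) - drift x s \<eta> t
          = exp (- \<eta> * of_real t) * ((exp (- \<eta> * of_real h) - 1) - (exp (- s * of_real (x - t)) - 1))"
        using 3 h by (simp add: drift_def algebra_simps flip: exp_add)
      also have "norm \<dots> \<le> 1 * (E * R * h + E * R * h)"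
      proof -
        have e1: "norm (exp (- \<eta> * of_real h) - 1) \<le> E * R * h" by (rule ex(1)[OF nz(1)]) (rule h)+
        have e2: "norm (exp (- s * of_real (x - t)) - 1) \<le> E * R * h" using 3 h by (intro ex(1) nz(3)) auto
        show ?thesis unfolding norm_mult
          by (rule mult_mono[OF le[OF t] order_trans[OF norm_triangle_ineq4 add_mono[OF e1 e2]]]) auto
      qed
      finally have d: "norm (drift x s \<eta> (t + h) - drift x s \<eta> t) \<le> 2 * E * R * h" by simp
      have "drift x s \<eta> (t + h) - (drift x s \<eta> t * (1 + of_real h * (s - \<eta>))
          - s * of_real h * (of_bool (x \<le> t) * exp (- \<eta> * of_real t)))
         = (drift x s \<eta> (t + h) - drift x s \<eta> t) - drift x s \<eta> t * ((s - \<eta>) * of_real h)"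
        using 3 by (simp add: algebra_simps)
      also have "norm \<dots> \<le> 2 * E * R * h + 1 * (R * h)"
      proof (rule order_trans[OF norm_triangle_ineq4 add_mono[OF d]])
        show "norm (drift x s \<eta> t * ((s - \<eta>) * of_real h)) \<le> 1 * (R * h)"
          unfolding norm_mult[of "drift x s \<eta> t"]
          using norm_drift_le[OF s \<eta> t] nz(2)[OF h(1)] by (intro mult_mono) auto
      qed
      also have "\<dots> \<le> C * h" using E1 h by (simp add: C_def distrib_right)
      also have "\<dots> \<le> C * h\<^sup>2 + C * h * of_bool (t < x \<and> x < t + h)" using 3 C0 by simp
      finally show ?thesis using d by simp
    qed
  qed
  show thesis
  proof (rule that[OF C0])
    fix x t h :: real assume th: "0 \<le> t" "0 < h" "h \<le> 1"
    have "2 * E * R * h \<le> C * h" unfolding C_def using E1 R0 th by (intro mult_right_mono) auto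
    with both[OF th, of x] show "norm (drift x s \<eta> (t + h) - drift x s \<eta> t) \<le> C * h" by linarith
  qed (use both in blast)
qed

lemma workload_measurable:
  assumes "1 \<le> n" "\<And>k. k \<in> {1..n} \<Longrightarrow> T' k \<in> borel_measurable N" "\<And>k. k \<in> {1..<n} \<Longrightarrow> S' k \<in> borel_measurable N"
  shows "workload a w T' S' n \<in> borel_measurable N"
  using assms
proof (induction n rule: dec_induct)
  case base then show ?case by (simp add: measurable_const[of w])
next
  case (step n)
  then obtain k where k: "n = Suc k" by (cases n) auto
  have [measurable]: "workload a w T' S' (Suc k) \<in> borel_measurable N" "T' (Suc k) \<in> borel_measurable N"
    "T' (Suc (Suc k)) \<in> borel_measurable N" "S' (Suc k) \<in> borel_measurable N"
    using step k by auto
  show ?case unfolding k workload.simps[abs_def] by measurable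
qed

lemma workload_cong:
  assumes "\<And>k. k \<in> {1..n} \<Longrightarrow> T' k \<omega> = T k \<omega>"
  shows "workload a w T' S n \<omega> = workload a w T S n \<omega>"
  using assms
proof (induction n)
  case (Suc n)
  then show ?case by (cases n) auto
qed simp

context queue
begin

text \<open>
The \<open>n\<close>th customer is the last one to have arrived by time \<open>t\<close>.
\<close>

definition alive :: "nat \<Rightarrow> real \<Rightarrow> 'w \<Rightarrow> bool" where
  "alive n t \<omega> \<longleftrightarrow> T n \<omega> \<le> t \<and> t < T (Suc n) \<omega>"

text \<open>
The time at which the workload present after the \<open>n\<close>th arrival would be cleared in the
absence of further arrivals.
\<close>

definition empty_at :: "real \<Rightarrow> real \<Rightarrow> nat \<Rightarrow> 'w \<Rightarrow> real" where
  "empty_at a w n \<omega> = a * workload a w T S n \<omega> + S n \<omega> + T n \<omega>"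

text \<open>
The arrival epochs themselves are not known at time \<open>t\<close>, but truncated at \<open>t\<close> they are, and the
truncation has no effect as long as the \<open>n\<close>th customer is the last arrival.
\<close>

lemma alive_measurable:
  fixes \<Phi> :: "real \<Rightarrow> complex"
  assumes n: "1 \<le> n" and t: "0 \<le> t" and \<Phi> [measurable]: "\<Phi> \<in> borel_measurable borel"
  shows "(\<lambda>\<omega>. of_bool (alive n t \<omega>) * \<Phi> (empty_at a w n \<omega>)) \<in> borel_measurable (with_services n (past t))"
proof -
  let ?N = "with_services n (past t)"
  have base: "subalgebra ?N (past t)" by (rule subalgebra_with_services_base[OF subalgebra_past])
  have T': "(\<lambda>\<omega>. min (T k \<omega>) t) \<in> borel_measurable ?N" if "1 \<le> k" for k
    using base min_T_past[OF that t] by (rule measurable_from_subalg)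
  have S': "S k \<in> borel_measurable ?N" if "k \<in> {1..n}" for k
    using S_with_services[OF subalgebra_past that] .
  have [measurable]: "workload a w (\<lambda>k \<omega>. min (T k \<omega>) t) S n \<in> borel_measurable ?N"
    using n T' S' by (intro workload_measurable) auto
  have [measurable]: "(\<lambda>\<omega>. min (T n \<omega>) t) \<in> borel_measurable ?N" "S n \<in> borel_measurable ?N" using n T' S' by auto
  have A: "Measurable.pred ?N (\<lambda>\<omega>. T k \<omega> \<le> t)" if "1 \<le> k" for k
  proof -
    have "{\<omega>\<in>space M. T k \<omega> \<le> t} \<in> sets ?N" using T_past_sets[OF that t order_refl] base by (auto simp: subalgebra_def)
    then show ?thesis by (simp add: pred_def space_with_services[OF subalgebra_past])
  qed
  have [measurable]: "Measurable.pred ?N (\<lambda>\<omega>. T n \<omega> \<le> t)" "Measurable.pred ?N (\<lambda>\<omega>. T (Suc n) \<omega> \<le> t)" using n by (auto intro!: A)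
  have "(\<lambda>\<omega>. of_bool (T n \<omega> \<le> t \<and> \<not> T (Suc n) \<omega> \<le> t) * \<Phi> (a * workload a w (\<lambda>k \<omega>. min (T k \<omega>) t) S n \<omega> + S n \<omega> + min (T n \<omega>) t)) \<in> borel_measurable ?N"
    by measurable
  also have "?this \<longleftrightarrow> (\<lambda>\<omega>. of_bool (alive n t \<omega>) * \<Phi> (empty_at a w n \<omega>)) \<in> borel_measurable ?N"
  proof (rule measurable_cong)
    fix \<omega> assume "\<omega> \<in> space ?N"
    then have w: "\<omega> \<in> space M" by (simp add: space_with_services[OF subalgebra_past])
    show "of_bool (T n \<omega> \<le> t \<and> \<not> T (Suc n) \<omega> \<le> t) * \<Phi> (a * workload a w (\<lambda>k \<omega>. min (T k \<omega>) t) S n \<omega> + S n \<omega> + min (T n \<omega>) t)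
        = of_bool (alive n t \<omega>) * \<Phi> (empty_at a w n \<omega>)"
    proof (cases "T n \<omega> \<le> t")
      case True
      have "min (T k \<omega>) t = T k \<omega>" if "k \<in> {1..n}" for k using T_less[OF w, of k n] that True by (cases "k = n") auto
      then have "workload a w (\<lambda>k \<omega>. min (T k \<omega>) t) S n \<omega> = workload a w T S n \<omega>" by (intro workload_cong) auto
      then show ?thesis using True by (simp add: alive_def empty_at_def not_le)
    qed (simp add: alive_def)
  qed
  finally show ?thesis .
qed

lemma empty_at_meas: "1 \<le> n \<Longrightarrow> empty_at a w n \<in> borel_measurable M"
proof -
  assume n: "1 \<le> n"
  have [measurable]: "T n \<in> borel_measurable M" "S n \<in> borel_measurable M" using n T_meas S_meas by auto
  have [measurable]: "workload a w T S n \<in> borel_measurable M"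
    using n by (intro workload_measurable) (auto intro!: T_meas S_meas)
  show ?thesis unfolding empty_at_def[abs_def] by measurable
qed

lemma alive_meas: "1 \<le> n \<Longrightarrow> Measurable.pred M (alive n t)"
proof -
  assume n: "1 \<le> n"
  have [measurable]: "T n \<in> borel_measurable M" "T (Suc n) \<in> borel_measurable M" using n T_meas by auto
  show ?thesis unfolding alive_def[abs_def] by measurable
qed

lemma alive_counts:
  assumes w: "\<omega> \<in> space M" and n: "1 \<le> n" and h: "0 \<le> h"
  shows "alive n t \<omega> \<Longrightarrow> counts T 0 t (t + h) \<omega> \<longleftrightarrow> t + h < T (Suc n) \<omega>"
    and "alive n t \<omega> \<Longrightarrow> counts T 1 t (t + h) \<omega> \<longleftrightarrow> T (Suc n) \<omega> \<le> t + h \<and> t + h < T (Suc (Suc n)) \<omega>"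
proof -
  assume al: "alive n t \<omega>"
  let ?A = "arrivals_in T t (t + h) \<omega>"
  have mem: "k \<in> ?A \<longleftrightarrow> n < k \<and> T k \<omega> \<le> t + h" for k
  proof -
    have "t < T k \<omega> \<longleftrightarrow> n < k" if "1 \<le> k"
    proof
      assume "t < T k \<omega>"
      then show "n < k" using T_less[OF w that, of n] al by (cases k n rule: linorder_cases) (auto simp: alive_def)
    next
      assume "n < k"
      then have "T (Suc n) \<omega> \<le> T k \<omega>" using T_less[OF w, of "Suc n" k] by (cases "k = Suc n") auto
      then show "t < T k \<omega>" using al by (auto simp: alive_def)
    qed
    then show ?thesis using n by (auto simp: arrivals_in_def)
  qed
  show "counts T 0 t (t + h) \<omega> \<longleftrightarrow> t + h < T (Suc n) \<omega>"
  proof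
    assume "counts T 0 t (t + h) \<omega>"
    then have "?A = {}" by (auto simp: counts_def)
    then show "t + h < T (Suc n) \<omega>" using mem[of "Suc n"] by auto
  next
    assume lt: "t + h < T (Suc n) \<omega>"
    have "?A = {}"
    proof (rule ccontr)
      assume "?A \<noteq> {}"
      then obtain k where "k \<in> ?A" by auto
      then have k: "n < k" "T k \<omega> \<le> t + h" using mem by auto
      then have "T (Suc n) \<omega> \<le> T k \<omega>" using T_less[OF w, of "Suc n" k] by (cases "k = Suc n") auto
      then show False using k lt by auto
    qed
    then show "counts T 0 t (t + h) \<omega>" by (simp add: counts_def)
  qed
  show "counts T 1 t (t + h) \<omega> \<longleftrightarrow> T (Suc n) \<omega> \<le> t + h \<and> t + h < T (Suc (Suc n)) \<omega>"
  proof
    assume c: "counts T 1 t (t + h) \<omega>"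
    then obtain k where k: "?A = {k}" by (auto simp: counts_def card_1_singleton_iff)
    then have k': "n < k" "T k \<omega> \<le> t + h" using mem[of k] by auto
    then have "T (Suc n) \<omega> \<le> T k \<omega>" using T_less[OF w, of "Suc n" k] by (cases "k = Suc n") auto
    then have "Suc n \<in> ?A" using mem[of "Suc n"] k' by auto
    moreover have "Suc (Suc n) \<notin> ?A" using k calculation by auto
    ultimately show "T (Suc n) \<omega> \<le> t + h \<and> t + h < T (Suc (Suc n)) \<omega>" using mem by auto
  next
    assume lt: "T (Suc n) \<omega> \<le> t + h \<and> t + h < T (Suc (Suc n)) \<omega>"
    have "?A = {Suc n}"
    proof (intro equalityI subsetI)
      fix k assume "k \<in> ?A"
      then have k: "n < k" "T k \<omega> \<le> t + h" using mem by auto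
      have "k = Suc n"
      proof (rule ccontr)
        assume "k \<noteq> Suc n"
        then have "T (Suc (Suc n)) \<omega> \<le> T k \<omega>" using k T_less[OF w, of "Suc (Suc n)" k] by (cases "k = Suc (Suc n)") auto
        then show False using k lt by auto
      qed
      then show "k \<in> {Suc n}" by simp
    qed (use lt mem in auto)
    then show "counts T 1 t (t + h) \<omega>" by (simp add: counts_def)
  qed
qed

definition drift_mean :: "real \<Rightarrow> real \<Rightarrow> nat \<Rightarrow> complex \<Rightarrow> complex \<Rightarrow> real \<Rightarrow> real \<Rightarrow> 'n \<Rightarrow> complex" where
  "drift_mean a w n s \<eta> t t' i = (LINT \<omega>|M. of_bool (alive n t \<omega>) * drift (empty_at a w n \<omega>) s \<eta> t' * of_bool (X t \<omega> = i))"

definition idle_mean :: "real \<Rightarrow> real \<Rightarrow> nat \<Rightarrow> complex \<Rightarrow> real \<Rightarrow> 'n \<Rightarrow> complex" where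
  "idle_mean a w n \<eta> t i = (LINT \<omega>|M. of_bool (alive n t \<omega>) * (of_bool (empty_at a w n \<omega> \<le> t) * exp (- \<eta> * of_real t)) * of_bool (X t \<omega> = i))"

definition alive_prob :: "nat \<Rightarrow> real \<Rightarrow> real" where
  "alive_prob n t = (LINT \<omega>|M. of_bool (alive n t \<omega>))"

definition emptying_prob :: "real \<Rightarrow> real \<Rightarrow> nat \<Rightarrow> real \<Rightarrow> real \<Rightarrow> real" where
  "emptying_prob a w n t h = (LINT \<omega>|M. of_bool (t < empty_at a w n \<omega> \<and> empty_at a w n \<omega> < t + h))"

lemma drift_measurable [measurable]: "(\<lambda>x. drift x s \<eta> t) \<in> borel_measurable borel"
  unfolding drift_def by measurable

lemma one_step_alive:
  assumes \<epsilon>: "0 < \<epsilon>" and m: "m \<le> 1"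
  shows "\<forall>\<^sub>F h in at_right 0. \<forall>t\<ge>0. \<forall>n\<ge>1. \<forall>(\<Phi> :: real \<Rightarrow> complex) a w j. \<Phi> \<in> borel_measurable borel \<longrightarrow> (\<forall>x. norm (\<Phi> x) \<le> 1) \<longrightarrow>
     norm ((\<Sum>i\<in>UNIV. LINT \<omega>|M. of_bool (alive n t \<omega>) * \<Phi> (empty_at a w n \<omega>) * of_real (slot m t h i j \<omega>))
        - (\<Sum>i\<in>UNIV. of_real (rate m h i j) * (LINT \<omega>|M. of_bool (alive n t \<omega>) * \<Phi> (empty_at a w n \<omega>) * of_bool (X t \<omega> = i))))
       \<le> \<epsilon> * h * alive_prob n t"
  using one_step[OF \<epsilon> m] eventually_at_right_less[of 0]
proof eventually_elim
  case (elim h)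
  show ?case
  proof (intro allI impI)
    fix t :: real and n :: nat and \<Phi> :: "real \<Rightarrow> complex" and a w j
    assume t: "0 \<le> t" and n: "1 \<le> n" and \<Phi> [measurable]: "\<Phi> \<in> borel_measurable borel" and \<Phi>1: "\<forall>x. norm (\<Phi> x) \<le> 1"
    note [measurable] = alive_meas[OF n] empty_at_meas[OF n]
    have [measurable]: "X t \<in> measurable M (count_space UNIV)" using t by (rule X_meas)
    let ?f = "\<lambda>\<omega>. of_bool (alive n t \<omega>) * \<Phi> (empty_at a w n \<omega>)"
    have f1: "norm (?f \<omega>) \<le> of_bool (alive n t \<omega>)" for \<omega> using \<Phi>1 by auto
    have 1: "norm ((LINT \<omega>|M. ?f \<omega> * of_real (slot m t h i j \<omega>)) - of_real (rate m h i j) * (LINT \<omega>|M. ?f \<omega> * of_bool (X t \<omega> = i)))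
       \<le> \<epsilon> * h * (LINT \<omega>|M. of_bool (alive n t \<omega>) * of_bool (X t \<omega> = i))" for i
    proof -
      have "norm ((LINT \<omega>|M. ?f \<omega> * of_real (slot m t h i j \<omega>)) - of_real (rate m h i j) * (LINT \<omega>|M. ?f \<omega> * of_bool (X t \<omega> = i)))
        \<le> \<epsilon> * h * (LINT \<omega>|M. norm (?f \<omega>) * of_bool (X t \<omega> = i))"
      proof (rule elim(1)[rule_format, OF t n])
        show "?f \<in> borel_measurable (with_services n (past t))" by (rule alive_measurable[OF n t \<Phi>])
        show "norm (?f \<omega>) \<le> 1" for \<omega> using f1[of \<omega>] by (rule order_trans) simp
        show "?f \<omega> = 0" if "t < T n \<omega>" for \<omega> using that by (simp add: alive_def)
      qed
      also have "\<dots> \<le> \<epsilon> * h * (LINT \<omega>|M. of_bool (alive n t \<omega>) * of_bool (X t \<omega> = i))"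
      proof (intro mult_left_mono integral_mono)
        show "integrable M (\<lambda>\<omega>. norm (?f \<omega>) * of_bool (X t \<omega> = i))"
          by (rule integrable_bounded[where C=1], measurable) (use \<Phi>1 in \<open>auto simp: of_bool_def\<close>)
        show "integrable M (\<lambda>\<omega>. of_bool (alive n t \<omega>) * of_bool (X t \<omega> = i) :: real)"
          by (rule integrable_bounded[where C=1], measurable)
        show "norm (?f \<omega>) * of_bool (X t \<omega> = i) \<le> of_bool (alive n t \<omega>) * of_bool (X t \<omega> = i)" for \<omega>
          by (intro mult_right_mono f1) auto
      qed (use \<epsilon> elim in auto)
      finally show ?thesis .
    qed
    have "norm ((\<Sum>i\<in>UNIV. LINT \<omega>|M. ?f \<omega> * of_real (slot m t h i j \<omega>)) - (\<Sum>i\<in>UNIV. of_real (rate m h i j) * (LINT \<omega>|M. ?f \<omega> * of_bool (X t \<omega> = i))))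
      \<le> (\<Sum>i\<in>UNIV. \<epsilon> * h * (LINT \<omega>|M. of_bool (alive n t \<omega>) * of_bool (X t \<omega> = i)))"
      unfolding sum_subtractf[symmetric] by (rule order_trans[OF norm_sum sum_mono]) (rule 1)
    also have "\<dots> = \<epsilon> * h * (LINT \<omega>|M. (\<Sum>i\<in>UNIV. of_bool (alive n t \<omega>) * of_bool (X t \<omega> = i)))"
    proof -
      have "integrable M (\<lambda>\<omega>. of_bool (alive n t \<omega>) * of_bool (X t \<omega> = i) :: real)" for i
        by (rule integrable_bounded[where C=1], measurable)
      then have "(LINT \<omega>|M. (\<Sum>i\<in>UNIV. of_bool (alive n t \<omega>) * of_bool (X t \<omega> = i) :: real))
          = (\<Sum>i\<in>UNIV. LINT \<omega>|M. of_bool (alive n t \<omega>) * of_bool (X t \<omega> = i))"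
        by (intro Bochner_Integration.integral_sum)
      then show ?thesis by (simp only: sum_distrib_left)
    qed
    also have "(\<lambda>\<omega>. (\<Sum>i\<in>UNIV. of_bool (alive n t \<omega>) * of_bool (X t \<omega> = i))) = (\<lambda>\<omega>. of_bool (alive n t \<omega>) :: real)"
      by (auto simp: fun_eq_iff of_bool_def)
    finally show "norm ((\<Sum>i\<in>UNIV. LINT \<omega>|M. ?f \<omega> * of_real (slot m t h i j \<omega>)) - (\<Sum>i\<in>UNIV. of_real (rate m h i j) * (LINT \<omega>|M. ?f \<omega> * of_bool (X t \<omega> = i))))
      \<le> \<epsilon> * h * alive_prob n t" by (simp add: alive_prob_def)
  qed
qed

end

lemma of_real_of_bool_eq [simp]: "of_real (of_bool b) = of_bool b"
  by (cases b) auto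

section \<open>Telescoping over the grid\<close>

text \<open>
The number of the cell \<open>((l - 1) / (q + 1), l / (q + 1)]\<close> that contains \<open>u > 0\<close>; it is 0
for \<open>u = 0\<close>, the epoch of the first arrival.
\<close>

definition cell :: "nat \<Rightarrow> real \<Rightarrow> nat" where "cell q u = nat \<lceil>u * Suc q\<rceil>"

definition grid_pt :: "nat \<Rightarrow> nat \<Rightarrow> real" where "grid_pt q l = real l / real (Suc q)"

lemma grid_pt_nonneg: "0 \<le> grid_pt q l" by (simp add: grid_pt_def)

lemma grid_pt_Suc: "grid_pt q (Suc l) = grid_pt q l + 1 / Suc q"
  by (simp add: grid_pt_def add_divide_distrib)

lemma le_grid_pt_iff: "u \<le> grid_pt q l \<longleftrightarrow> cell q u \<le> l"
  unfolding cell_def grid_pt_def by (simp add: nat_ceiling_le_eq pos_le_divide_eq)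

text \<open>
With \<open>(q + 1)\<^sup>2\<close> cells of length \<open>1 / (q + 1)\<close> the grid becomes finer and exhausts the half
line at the same time, so that only finite sums occur.
\<close>

lemma cell_le_square:
  assumes "0 \<le> u" shows "\<forall>\<^sub>F q in sequentially. cell q u \<le> (Suc q)\<^sup>2"
proof -
  obtain N :: nat where N: "u \<le> real N" using real_arch_simple by blast
  show ?thesis using eventually_ge_at_top[of N]
  proof eventually_elim
    case (elim q)
    have "grid_pt q ((Suc q)\<^sup>2) = real (Suc q)" unfolding grid_pt_def by (simp only: power2_eq_square of_nat_mult) simp
    then have "u \<le> grid_pt q ((Suc q)\<^sup>2)" using N elim by simp
    then show ?case by (simp add: le_grid_pt_iff)
  qed
qed

context queue
begin

lemma grid_pt_cell_lim:
  assumes "0 \<le> u" shows "(\<lambda>q. grid_pt q (cell q u)) \<longlonglongrightarrow> u" "u \<le> grid_pt q (cell q u)"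
proof -
  have "grid_pt q (cell q u) = \<lceil>u * Suc q\<rceil> / Suc q" for q using assms by (simp add: grid_pt_def cell_def)
  then show "(\<lambda>q. grid_pt q (cell q u)) \<longlonglongrightarrow> u" using ceiling_grid_lim[of u] by simp
  show "u \<le> grid_pt q (cell q u)" by (simp add: le_grid_pt_iff)
qed

text \<open>
Each term of the sum compares a state in which customer \<open>n\<close> is the last arrival with the
state one cell later, provided no arrival occurs.  What is left over is the entry, in the cell
after the \<open>n\<close>th arrival, and the end of the grid.
\<close>

lemma telescope_entry:
  fixes F :: "nat \<Rightarrow> 'z::comm_ring_1"
  assumes w: "\<omega> \<in> space M" and n: "1 \<le> n"
  shows "of_bool (cell q (T n \<omega>) \<le> L \<and> grid_pt q (cell q (T n \<omega>)) < T (Suc n) \<omega>) * F (cell q (T n \<omega>))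
     = of_bool (alive n (grid_pt q L) \<omega>) * F L
       + (\<Sum>l<L. of_bool (alive n (grid_pt q l) \<omega>) * F l
            - of_bool (alive n (grid_pt q l) \<omega>) * of_bool (counts T 0 (grid_pt q l) (grid_pt q l + 1 / Suc q) \<omega>) * F (Suc l))"
proof (induction L)
  case 0
  then show ?case by (auto simp: alive_def le_grid_pt_iff)
next
  case (Suc L)
  let ?l = "cell q (T n \<omega>)"
  have c: "of_bool (alive n (grid_pt q L) \<omega>) * of_bool (counts T 0 (grid_pt q L) (grid_pt q L + 1 / Suc q) \<omega>)
      = (of_bool (?l \<le> L \<and> grid_pt q (Suc L) < T (Suc n) \<omega>) :: 'z)"
  proof -
    have "grid_pt q L < u" if "grid_pt q L + 1 / (1 + real q) < u" for u
      by (rule le_less_trans[OF _ that]) simp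
    then show ?thesis using alive_counts(1)[OF w n, of "1 / Suc q" "grid_pt q L"]
      by (auto simp: alive_def le_grid_pt_iff grid_pt_Suc of_bool_def)
  qed
  have "of_bool (?l \<le> Suc L \<and> grid_pt q ?l < T (Suc n) \<omega>) * F ?l
      = of_bool (?l \<le> L \<and> grid_pt q ?l < T (Suc n) \<omega>) * F ?l + of_bool (alive n (grid_pt q (Suc L)) \<omega>) * F (Suc L)
        - of_bool (?l \<le> L \<and> grid_pt q (Suc L) < T (Suc n) \<omega>) * F (Suc L)"
    by (cases "?l = Suc L") (auto simp: alive_def le_grid_pt_iff of_bool_def)
  then show ?case unfolding Suc.IH sum.lessThan_Suc c by (simp only: algebra_simps)
qed

lemma telescope_exit:
  fixes F :: "nat \<Rightarrow> 'z::comm_ring_1"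
  assumes w: "\<omega> \<in> space M" and n: "1 \<le> n"
  shows "(\<Sum>l<L. of_bool (alive n (grid_pt q l) \<omega>) * of_bool (counts T 1 (grid_pt q l) (grid_pt q l + 1 / Suc q) \<omega>) * F l)
    = of_bool (cell q (T n \<omega>) < cell q (T (Suc n) \<omega>) \<and> cell q (T (Suc n) \<omega>) \<le> L
        \<and> grid_pt q (cell q (T (Suc n) \<omega>)) < T (Suc (Suc n)) \<omega>) * F (cell q (T (Suc n) \<omega>) - 1)"
proof -
  let ?l = "cell q (T n \<omega>)" and ?k = "cell q (T (Suc n) \<omega>)"
  let ?c = "?l < ?k \<and> grid_pt q ?k < T (Suc (Suc n)) \<omega>"
  have "of_bool (alive n (grid_pt q l) \<omega>) * of_bool (counts T 1 (grid_pt q l) (grid_pt q l + 1 / Suc q) \<omega>) * F l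
      = (if l = ?k - 1 then of_bool ?c * F l else 0)" for l
  proof -
    have "alive n (grid_pt q l) \<omega> \<and> counts T 1 (grid_pt q l) (grid_pt q l + 1 / Suc q) \<omega> \<longleftrightarrow>
        ?l \<le> l \<and> \<not> ?k \<le> l \<and> ?k \<le> Suc l \<and> grid_pt q (Suc l) < T (Suc (Suc n)) \<omega>"
      using alive_counts(2)[OF w n, of "1 / Suc q" "grid_pt q l"]
      unfolding le_grid_pt_iff[symmetric] grid_pt_Suc by (auto simp: alive_def not_le)
    also have "\<dots> \<longleftrightarrow> l = ?k - 1 \<and> ?c"
      by (cases ?k) (auto simp: le_Suc_eq)
    finally have "of_bool (alive n (grid_pt q l) \<omega>) * of_bool (counts T 1 (grid_pt q l) (grid_pt q l + 1 / Suc q) \<omega>)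
        = (of_bool (l = ?k - 1 \<and> ?c) :: 'z)" by (simp flip: of_bool_conj)
    then show ?thesis by simp
  qed
  then have "(\<Sum>l<L. of_bool (alive n (grid_pt q l) \<omega>) * of_bool (counts T 1 (grid_pt q l) (grid_pt q l + 1 / Suc q) \<omega>) * F l)
      = (if ?k - 1 < L then of_bool ?c * F (?k - 1) else 0)" by simp
  also have "\<dots> = of_bool (?l < ?k \<and> ?k \<le> L \<and> grid_pt q ?k < T (Suc (Suc n)) \<omega>) * F (?k - 1)"
    by (cases ?k) auto
  finally show ?thesis .
qed

text \<open>
The generator of the background killed at the first arrival.
\<close>

definition killed_gen :: "'n \<Rightarrow> 'n \<Rightarrow> real" where "killed_gen i j = Q $ i $ j - of_bool (i = j) * lam i"

lemma rate_0: "rate 0 h i j = of_bool (i = j) + h * killed_gen i j"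
  by (auto simp: rate_def killed_gen_def algebra_simps)

lemma rate_1: "rate 1 h i j = of_bool (i = j) * h * lam i"
  by (simp add: rate_def)

lemma Mmat_entry: "Mmat Q lam z $ i $ j = of_bool (i = j) * z - of_real (killed_gen i j)"
  by (auto simp: Mmat_def mat_def Lam_def diag_def map_matrix_def killed_gen_def)

lemma slot_sum: "(\<Sum>i\<in>UNIV. slot m t h i j \<omega>) = of_bool (counts T m t (t + h) \<omega>) * of_bool (X (t + h) \<omega> = j)"
proof -
  have "(\<Sum>i\<in>UNIV. slot m t h i j \<omega>)
      = (\<Sum>i\<in>UNIV. if X t \<omega> = i then of_bool (counts T m t (t + h) \<omega>) * of_bool (X (t + h) \<omega> = j) else 0)"
    unfolding slot_def by (rule sum.cong) auto
  then show ?thesis by simp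
qed

lemma integral_slot_sum:
  fixes f :: "'w \<Rightarrow> complex"
  assumes [measurable]: "f \<in> borel_measurable M" and f: "\<And>\<omega>. \<omega> \<in> space M \<Longrightarrow> norm (f \<omega>) \<le> 1" and t: "0 \<le> t" "0 \<le> h"
  shows "(\<Sum>i\<in>UNIV. LINT \<omega>|M. f \<omega> * of_real (slot m t h i j \<omega>))
    = (LINT \<omega>|M. f \<omega> * (of_bool (counts T m t (t + h) \<omega>) * of_bool (X (t + h) \<omega> = j)))"
proof -
  have "integrable M (\<lambda>\<omega>. f \<omega> * of_real (slot m t h i j \<omega>))" for i
  proof (rule integrable_bounded[where C=1])
    note [measurable] = slot_meas[OF t, of m i j]
    show "(\<lambda>\<omega>. f \<omega> * of_real (slot m t h i j \<omega>)) \<in> borel_measurable M" by measurable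
    fix \<omega> assume "\<omega> \<in> space M"
    then show "norm (f \<omega> * of_real (slot m t h i j \<omega>)) \<le> 1"
      using f[of \<omega>] slot_01[of m t h i j \<omega>] by auto
  qed
  then have "(\<Sum>i\<in>UNIV. LINT \<omega>|M. f \<omega> * of_real (slot m t h i j \<omega>))
    = (LINT \<omega>|M. (\<Sum>i\<in>UNIV. f \<omega> * of_real (slot m t h i j \<omega>)))"
    by (intro Bochner_Integration.integral_sum[symmetric])
  also have "(\<lambda>\<omega>. (\<Sum>i\<in>UNIV. f \<omega> * of_real (slot m t h i j \<omega>)))
      = (\<lambda>\<omega>. f \<omega> * (of_bool (counts T m t (t + h) \<omega>) * of_bool (X (t + h) \<omega> = j)))"
  proof
    fix \<omega>
    have "(\<Sum>i\<in>UNIV. f \<omega> * of_real (slot m t h i j \<omega>)) = f \<omega> * of_real (\<Sum>i\<in>UNIV. slot m t h i j \<omega>)"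
      by (simp add: sum_distrib_left)
    then show "(\<Sum>i\<in>UNIV. f \<omega> * of_real (slot m t h i j \<omega>)) = f \<omega> * (of_bool (counts T m t (t + h) \<omega>) * of_bool (X (t + h) \<omega> = j))"
      unfolding slot_sum by simp
  qed
  finally show ?thesis .
qed

lemma integral_state_sum:
  fixes f :: "'w \<Rightarrow> complex"
  assumes [measurable]: "f \<in> borel_measurable M" and f: "\<And>\<omega>. \<omega> \<in> space M \<Longrightarrow> norm (f \<omega>) \<le> 1" and t: "0 \<le> t"
  shows "(\<Sum>i\<in>UNIV. LINT \<omega>|M. f \<omega> * of_bool (X t \<omega> = i)) = (LINT \<omega>|M. f \<omega>)"
proof -
  have [measurable]: "X t \<in> measurable M (count_space UNIV)" using t by (rule X_meas)
  have "integrable M (\<lambda>\<omega>. f \<omega> * of_bool (X t \<omega> = i))" for i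
    by (rule integrable_bounded[where C=1], measurable) (use f in auto)
  then have "(\<Sum>i\<in>UNIV. LINT \<omega>|M. f \<omega> * of_bool (X t \<omega> = i)) = (LINT \<omega>|M. (\<Sum>i\<in>UNIV. f \<omega> * of_bool (X t \<omega> = i)))"
    by (intro Bochner_Integration.integral_sum[symmetric])
  also have "(\<lambda>\<omega>. (\<Sum>i\<in>UNIV. f \<omega> * of_bool (X t \<omega> = i))) = f"
  proof
    fix \<omega>
    have "(\<Sum>i\<in>UNIV. f \<omega> * of_bool (X t \<omega> = i)) = (\<Sum>i\<in>UNIV. if X t \<omega> = i then f \<omega> else 0)" by (rule sum.cong) auto
    then show "(\<Sum>i\<in>UNIV. f \<omega> * of_bool (X t \<omega> = i)) = f \<omega>" by simp
  qed
  finally show ?thesis .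
qed

lemma alive_prob_nonneg: "0 \<le> alive_prob n t" unfolding alive_prob_def by (intro Bochner_Integration.integral_nonneg) auto

lemma eventually_mesh:
  assumes "\<forall>\<^sub>F h in at_right 0. R h"
  shows "\<forall>\<^sub>F q in sequentially. R (1 / real (Suc q))"
proof -
  have "filterlim (\<lambda>q. 1 / real (Suc q)) (at_right 0) sequentially"
    by (rule filterlim_at_withinI[OF LIMSEQ_Suc[OF lim_const_over_n]]) auto
  with assms show ?thesis by (rule eventually_compose_filterlim)
qed

text \<open>
A Riemann sum for the mean time between two arrivals.  It is bounded uniformly in the mesh,
because in each cell the next arrival occurs with a conditional probability of at least
\<open>h lmin / 2\<close>, while the telescoping sum of its probabilities is at most 1.  This turns errors \<open>o(h)\<close> per cell
into a total error that vanishes.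
\<close>

lemma occupation_bound:
  assumes n: "1 \<le> n"
  obtains K where "0 \<le> K" "\<forall>\<^sub>F q in sequentially. (\<Sum>l<L q. 1 / Suc q * alive_prob n (grid_pt q l)) \<le> K"
proof -
  note [measurable] = alive_meas[OF n]
  define N where "N = real CARD('n)"
  have N: "0 < N" by (simp add: N_def)
  \<comment> \<open>The errors of all target states together then use up half of the arrival rate.\<close>
  define \<epsilon> where "\<epsilon> = lmin / (2 * N)"
  have \<epsilon>: "0 < \<epsilon>" "N * \<epsilon> = lmin / 2" using lmin_pos N by (auto simp: \<epsilon>_def)
  have "\<forall>\<^sub>F q in sequentially. (\<Sum>l<L q. 1 / Suc q * alive_prob n (grid_pt q l)) \<le> 2 / lmin"
    using eventually_mesh[OF one_step_alive[OF \<epsilon>(1) zero_le_one]]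
  proof eventually_elim
    case (elim q)
    define h where "h = 1 / real (Suc q)"
    have h: "0 < h" by (simp add: h_def)
    have step: "(LINT \<omega>|M. of_bool (alive n (grid_pt q l) \<omega>) * of_bool (counts T 0 (grid_pt q l) (grid_pt q l + h) \<omega>))
        \<le> alive_prob n (grid_pt q l) - h * (lmin / 2) * alive_prob n (grid_pt q l)" for l
    proof -
      let ?t = "grid_pt q l"
      have t: "0 \<le> ?t" by (rule grid_pt_nonneg)
      have [measurable]: "X ?t \<in> measurable M (count_space UNIV)" "X (?t + h) \<in> measurable M (count_space UNIV)"
        using t h by (auto intro!: X_meas)
      define e where "e i = (LINT \<omega>|M. of_bool (alive n ?t \<omega>) * of_bool (X ?t \<omega> = i) :: real)" for i
      define c where "c j = (LINT \<omega>|M. of_bool (alive n ?t \<omega>) * (of_bool (counts T 0 ?t (?t + h) \<omega>) * of_bool (X (?t + h) \<omega> = j)) :: real)" for j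
      have ec: "(LINT \<omega>|M. of_bool (alive n ?t \<omega>) * of_bool (X ?t \<omega> = i)) = complex_of_real (e i)" for i
        unfolding e_def by (subst integral_complex_of_real[symmetric]) simp
      have cc: "(LINT \<omega>|M. of_bool (alive n ?t \<omega>) * (of_bool (counts T 0 ?t (?t + h) \<omega>) * of_bool (X (?t + h) \<omega> = j))) = complex_of_real (c j)" for j
        unfolding c_def by (subst integral_complex_of_real[symmetric]) simp
      have e0: "0 \<le> e i" for i unfolding e_def by (intro Bochner_Integration.integral_nonneg) auto
      have esum: "(\<Sum>i\<in>UNIV. e i) = alive_prob n ?t"
      proof -
        have "complex_of_real (\<Sum>i\<in>UNIV. e i) = (LINT \<omega>|M. of_bool (alive n ?t \<omega>))"
          unfolding of_real_sum ec[symmetric] by (rule integral_state_sum) (auto simp: t)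
        also have "\<dots> = complex_of_real (alive_prob n ?t)"
          unfolding alive_prob_def by (subst integral_complex_of_real[symmetric]) simp
        finally show ?thesis using of_real_eq_iff by blast
      qed
      have cj: "c j \<le> (\<Sum>i\<in>UNIV. rate 0 h i j * e i) + \<epsilon> * h * alive_prob n ?t" for j
      proof -
        have "norm ((\<Sum>i\<in>UNIV. LINT \<omega>|M. of_bool (alive n ?t \<omega>) * 1 * complex_of_real (slot 0 ?t h i j \<omega>))
            - (\<Sum>i\<in>UNIV. of_real (rate 0 h i j) * (LINT \<omega>|M. of_bool (alive n ?t \<omega>) * 1 * of_bool (X ?t \<omega> = i)))) \<le> \<epsilon> * h * alive_prob n ?t"
          using elim[rule_format, OF t n, of "\<lambda>_. 1"] unfolding h_def by simp
        moreover have "(\<Sum>i\<in>UNIV. LINT \<omega>|M. of_bool (alive n ?t \<omega>) * of_real (slot 0 ?t h i j \<omega>)) = complex_of_real (c j)"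
          unfolding cc[symmetric] by (rule integral_slot_sum) (use t h in auto)
        ultimately have "norm (complex_of_real (c j - (\<Sum>i\<in>UNIV. rate 0 h i j * e i))) \<le> \<epsilon> * h * alive_prob n ?t"
          by (simp add: ec)
        then show ?thesis unfolding norm_of_real by linarith
      qed
      have "(\<Sum>j\<in>UNIV. \<Sum>i\<in>UNIV. rate 0 h i j * e i) = (\<Sum>i\<in>UNIV. (1 - h * lam i) * e i)"
      proof (subst sum.swap, rule sum.cong[OF refl])
        fix i
        have "(\<Sum>j\<in>UNIV. rate 0 h i j) = 1 - h * lam i"
          by (simp add: rate_def sum.distrib Q_row flip: sum_distrib_left sum_distrib_right)
        then show "(\<Sum>j\<in>UNIV. rate 0 h i j * e i) = (1 - h * lam i) * e i" by (simp flip: sum_distrib_right)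
      qed
      also have "\<dots> \<le> (\<Sum>i\<in>UNIV. (1 - h * lmin) * e i)"
        using lmin_le h e0 by (intro sum_mono mult_right_mono) (auto intro: mult_left_mono)
      also have "\<dots> = (1 - h * lmin) * alive_prob n ?t" by (simp add: esum flip: sum_distrib_left)
      finally have r: "(\<Sum>j\<in>UNIV. \<Sum>i\<in>UNIV. rate 0 h i j * e i) \<le> (1 - h * lmin) * alive_prob n ?t" .
      have "(LINT \<omega>|M. of_bool (alive n ?t \<omega>) * of_bool (counts T 0 ?t (?t + h) \<omega>)) = (\<Sum>j\<in>UNIV. c j)"
      proof -
        let ?g = "\<lambda>\<omega>. of_bool (alive n ?t \<omega>) * of_bool (counts T 0 ?t (?t + h) \<omega>) :: complex"
        have "complex_of_real (\<Sum>j\<in>UNIV. c j) = (\<Sum>j\<in>UNIV. LINT \<omega>|M. ?g \<omega> * of_bool (X (?t + h) \<omega> = j))"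
          by (simp add: cc[symmetric] mult.assoc)
        also have "\<dots> = (LINT \<omega>|M. ?g \<omega>)" by (rule integral_state_sum) (use t h in auto)
        also have "\<dots> = complex_of_real (LINT \<omega>|M. of_bool (alive n ?t \<omega>) * of_bool (counts T 0 ?t (?t + h) \<omega>))"
          by (subst integral_complex_of_real[symmetric]) simp
        finally show ?thesis using of_real_eq_iff by metis
      qed
      also have "\<dots> \<le> (\<Sum>j\<in>UNIV. (\<Sum>i\<in>UNIV. rate 0 h i j * e i) + \<epsilon> * h * alive_prob n ?t)"
        by (intro sum_mono cj)
      also have "\<dots> = (\<Sum>j\<in>UNIV. \<Sum>i\<in>UNIV. rate 0 h i j * e i) + N * \<epsilon> * h * alive_prob n ?t"
        by (simp add: sum.distrib N_def)
      also have "\<dots> \<le> (1 - h * lmin) * alive_prob n ?t + lmin / 2 * h * alive_prob n ?t"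
        using r by (simp only: \<epsilon>(2))
      finally show ?thesis by (simp add: algebra_simps)
    qed
    let ?a = "\<lambda>l \<omega>. of_bool (alive n (grid_pt q l) \<omega>) :: real"
    let ?c = "\<lambda>l \<omega>. of_bool (alive n (grid_pt q l) \<omega>) * of_bool (counts T 0 (grid_pt q l) (grid_pt q l + h) \<omega>) :: real"
    have ia: "integrable M (?a l)" for l by (rule integrable_bounded[where C=1], measurable)
    have ic: "integrable M (?c l)" for l by (rule integrable_bounded[where C=1], measurable)
    have "alive_prob n (grid_pt q (L q)) + (\<Sum>l<L q. alive_prob n (grid_pt q l) - (LINT \<omega>|M. ?c l \<omega>))
        = (LINT \<omega>|M. ?a (L q) \<omega> + (\<Sum>l<L q. ?a l \<omega> - ?c l \<omega>))"
      unfolding alive_prob_def using ia ic by simp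
    also have "\<dots> \<le> (LINT \<omega>|M. 1)"
    proof (rule integral_mono)
      show "integrable M (\<lambda>\<omega>. ?a (L q) \<omega> + (\<Sum>l<L q. ?a l \<omega> - ?c l \<omega>))"
        by (intro Bochner_Integration.integrable_add Bochner_Integration.integrable_sum Bochner_Integration.integrable_diff ia ic)
      show "?a (L q) \<omega> + (\<Sum>l<L q. ?a l \<omega> - ?c l \<omega>) \<le> 1" if "\<omega> \<in> space M" for \<omega>
      proof -
        have "?a (L q) \<omega> + (\<Sum>l<L q. ?a l \<omega> - ?c l \<omega>)
            = of_bool (cell q (T n \<omega>) \<le> L q \<and> grid_pt q (cell q (T n \<omega>)) < T (Suc n) \<omega>)"
          using telescope_entry[OF that n, of q "L q" "\<lambda>_. 1 :: real"] unfolding h_def mult_1_right by (rule sym)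
        also have "\<dots> \<le> 1" by simp
        finally show ?thesis .
      qed
    qed simp
    finally have 1: "alive_prob n (grid_pt q (L q)) + (\<Sum>l<L q. alive_prob n (grid_pt q l) - (LINT \<omega>|M. ?c l \<omega>)) \<le> 1" by (simp add: prob_space)
    have "(\<Sum>l<L q. h * (lmin / 2) * alive_prob n (grid_pt q l)) \<le> (\<Sum>l<L q. alive_prob n (grid_pt q l) - (LINT \<omega>|M. ?c l \<omega>))"
    proof (rule sum_mono)
      show "h * (lmin / 2) * alive_prob n (grid_pt q l) \<le> alive_prob n (grid_pt q l) - (LINT \<omega>|M. ?c l \<omega>)" for l using step[of l] by linarith
    qed
    also have "\<dots> \<le> 1" using 1 alive_prob_nonneg[of n "grid_pt q (L q)"] by linarith
    finally have "lmin / 2 * (\<Sum>l<L q. h * alive_prob n (grid_pt q l)) \<le> 1" by (simp add: sum_distrib_left mult_ac)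
    then show ?case using lmin_pos by (simp add: h_def field_simps)
  qed
  then show thesis using lmin_pos by (intro that[of "2 / lmin"]) auto
qed

end

section \<open>The limit of vanishing mesh\<close>

lemma tendsto_zero_of_mesh:
  fixes f :: "nat \<Rightarrow> complex"
  assumes "\<And>\<epsilon>. 0 < \<epsilon> \<Longrightarrow> \<forall>\<^sub>F q in sequentially. norm (f q) \<le> \<epsilon> * K + D * (1 / Suc q)" and K: "0 \<le> K"
  shows "f \<longlonglongrightarrow> 0"
proof (rule tendstoI)
  fix e :: real assume e: "0 < e"
  define \<epsilon> where "\<epsilon> = e / (2 * (K + 1))"
  have \<epsilon>: "0 < \<epsilon>" "\<epsilon> * K < e / 2 + e / 2 * 0" using e K by (auto simp: \<epsilon>_def field_simps)
  have "(\<lambda>q. D * (1 / Suc q)) \<longlonglongrightarrow> D * 0" by (intro tendsto_intros LIMSEQ_Suc[OF lim_const_over_n])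
  then have "\<forall>\<^sub>F q in sequentially. D * (1 / Suc q) < e / 2"
    using e by (intro order_tendstoD(2)[of _ "D * 0"]) auto
  with assms(1)[OF \<epsilon>(1)] show "\<forall>\<^sub>F q in sequentially. dist (f q) 0 < e"
  proof eventually_elim
    case (elim q)
    have "norm (f q) < e" using elim \<epsilon>(2) by linarith
    then show ?case by simp
  qed
qed

lemma drift_tendsto:
  assumes "(f \<longlongrightarrow> t) F" shows "((\<lambda>q. drift x s \<eta> (f q)) \<longlongrightarrow> drift x s \<eta> t) F"
  unfolding drift_def using assms by (intro tendsto_intros)

lemma sum_interval_hits:
  assumes "0 < (\<delta>::real)"
  shows "(\<Sum>l<L. of_bool (real l * \<delta> < x \<and> x < real l * \<delta> + \<delta>) :: real) \<le> 1"
proof -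
  have "(\<Sum>l<L. of_bool (real l * \<delta> < x \<and> x < real l * \<delta> + \<delta>) :: real) \<le> (\<Sum>l<L. if l = nat \<lfloor>x / \<delta>\<rfloor> then 1 else 0)"
  proof (rule sum_mono)
    fix l
    have "l = nat \<lfloor>x / \<delta>\<rfloor>" if "real l * \<delta> < x" "x < real l * \<delta> + \<delta>"
    proof -
      have "real l < x / \<delta>" "x / \<delta> < real l + 1" using that assms by (auto simp: field_simps)
      then have "\<lfloor>x / \<delta>\<rfloor> = int l" by (intro floor_unique) auto
      then show ?thesis by simp
    qed
    then show "of_bool (real l * \<delta> < x \<and> x < real l * \<delta> + \<delta>) \<le> (if l = nat \<lfloor>x / \<delta>\<rfloor> then 1 else 0 :: real)" by auto
  qed
  also have "\<dots> \<le> 1" by simp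
  finally show ?thesis .
qed

lemma norm_integral_le:
  fixes f :: "'a \<Rightarrow> 'b::{banach, second_countable_topology}"
  assumes "integrable M f" "integrable M g" "\<And>x. x \<in> space M \<Longrightarrow> norm (f x) \<le> g x"
  shows "norm (\<integral>x. f x \<partial>M) \<le> (\<integral>x. g x \<partial>M)"
  by (rule order_trans[OF integral_norm_bound integral_mono]) (use assms in auto)

context queue
begin

text \<open>
Riemann sums for the discounted mean occupation time of \<open>i\<close> between two arrivals, weighted
with the transform of the workload in the first case and restricted to idle periods in the
second one.
\<close>

definition drift_sum :: "real \<Rightarrow> real \<Rightarrow> nat \<Rightarrow> complex \<Rightarrow> complex \<Rightarrow> nat \<Rightarrow> 'n \<Rightarrow> complex" where
  "drift_sum a w n s \<eta> q i = (\<Sum>l<(Suc q)\<^sup>2. of_real (1 / Suc q) * drift_mean a w n s \<eta> (grid_pt q l) (grid_pt q l) i)"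

definition idle_sum :: "real \<Rightarrow> real \<Rightarrow> nat \<Rightarrow> complex \<Rightarrow> nat \<Rightarrow> 'n \<Rightarrow> complex" where
  "idle_sum a w n \<eta> q i = (\<Sum>l<(Suc q)\<^sup>2. of_real (1 / Suc q) * idle_mean a w n \<eta> (grid_pt q l) i)"

definition post_transform :: "real \<Rightarrow> real \<Rightarrow> nat \<Rightarrow> complex \<Rightarrow> complex \<Rightarrow> 'n \<Rightarrow> complex" where
  "post_transform a w n s \<eta> j = (LINT \<omega>|M. drift (empty_at a w n \<omega>) s \<eta> (T n \<omega>) * of_bool (Y n \<omega> = j))"

definition pre_transform :: "real \<Rightarrow> real \<Rightarrow> nat \<Rightarrow> complex \<Rightarrow> complex \<Rightarrow> 'n \<Rightarrow> complex" where
  "pre_transform a w n s \<eta> j = (LINT \<omega>|M. exp (- s * of_real (workload a w T S n \<omega>) - \<eta> * of_real (T n \<omega>)) * of_bool (Y n \<omega> = j))"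

lemma pre_transform_drift:
  assumes "1 \<le> n"
  shows "pre_transform a w (Suc n) s \<eta> j = (LINT \<omega>|M. drift (empty_at a w n \<omega>) s \<eta> (T (Suc n) \<omega>) * of_bool (Y (Suc n) \<omega> = j))"
proof -
  obtain k where "n = Suc k" using assms by (cases n) auto
  then show ?thesis by (simp add: pre_transform_def drift_def empty_at_def algebra_simps)
qed

context
  fixes a w :: real and n :: nat and s \<eta> :: complex
  assumes n: "1 \<le> n" and s: "0 \<le> Re s" and \<eta>: "0 \<le> Re \<eta>"
begin

lemma drift_le: "0 \<le> t \<Longrightarrow> norm (drift x s \<eta> t) \<le> 1" using norm_drift_le s \<eta> by blast

lemma alive_empty_at_meas [measurable]: "alive n t \<in> measurable M (count_space UNIV)" "empty_at a w n \<in> borel_measurable M"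
  using alive_meas[OF n] empty_at_meas[OF n] by (auto simp: pred_def)

text \<open>
One cell of the balance: by \<open>drift_step\<close> the change of the mean over a cell without arrival
is \<open>- h\<close> times the mean multiplied by \<open>M(\<eta> - s)\<close>, up to the idle time and errors of second
order.
\<close>

lemma cell_balance:
  obtains C where "0 \<le> C" "\<And>t h j. 0 \<le> t \<Longrightarrow> 0 < h \<Longrightarrow> h \<le> 1 \<Longrightarrow>
    norm (drift_mean a w n s \<eta> t t j - (\<Sum>i\<in>UNIV. of_real (rate 0 h i j) * drift_mean a w n s \<eta> t (t + h) i)
       - of_real h * (\<Sum>i\<in>UNIV. drift_mean a w n s \<eta> t t i * Mmat Q lam (\<eta> - s) $ i $ j) - s * of_real h * idle_mean a w n \<eta> t j)
     \<le> C * (h\<^sup>2 * alive_prob n t + h * emptying_prob a w n t h)"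
proof -
  obtain C where C0: "0 \<le> C" and C1: "\<And>x t h. 0 \<le> t \<Longrightarrow> 0 < h \<Longrightarrow> h \<le> 1 \<Longrightarrow> norm (drift x s \<eta> (t + h) - drift x s \<eta> t) \<le> C * h"
    and C2: "\<And>x t h. 0 \<le> t \<Longrightarrow> 0 < h \<Longrightarrow> h \<le> 1 \<Longrightarrow>
      norm (drift x s \<eta> (t + h) - (drift x s \<eta> t * (1 + of_real h * (s - \<eta>))
          - s * of_real h * (of_bool (x \<le> t) * exp (- \<eta> * of_real t))))
        \<le> C * h\<^sup>2 + C * h * of_bool (t < x \<and> x < t + h)"
    using drift_step[OF s \<eta>] by blast
  define G where "G = (\<Sum>i\<in>UNIV. \<Sum>j\<in>UNIV. \<bar>killed_gen i j\<bar>)"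
  have G: "(\<Sum>i\<in>UNIV. \<bar>killed_gen i j\<bar>) \<le> G" for j
    unfolding G_def by (intro sum_mono member_le_sum) auto
  have G0: "0 \<le> G" unfolding G_def by (intro sum_nonneg) auto
  show thesis
  proof (rule that[of "C + G * C"])
    fix t h :: real and j assume th: "0 \<le> t" "0 < h" "h \<le> 1"
    let ?x = "empty_at a w n" and ?A = "\<lambda>\<omega>. alive n t \<omega>"
    let ?y = "\<lambda>i. drift_mean a w n s \<eta> t t i" and ?y' = "\<lambda>i. drift_mean a w n s \<eta> t (t + h) i" and ?k = "\<lambda>i. idle_mean a w n \<eta> t i"
    have [measurable]: "X t \<in> measurable M (count_space UNIV)" using th by (intro X_meas) auto
    have th': "0 \<le> t + h" using th by simp
    have iy: "integrable M (\<lambda>\<omega>. of_bool (?A \<omega>) * drift (?x \<omega>) s \<eta> t' * of_bool (X t \<omega> = i))" if "0 \<le> t'" for t' i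
      by (rule integrable_bounded[where C=1], measurable) (use drift_le[OF that] in \<open>auto simp: of_bool_def\<close>)
    have et: "norm (exp (- \<eta> * of_real t)) \<le> 1" using \<eta> th by simp
    have ik: "integrable M (\<lambda>\<omega>. of_bool (?A \<omega>) * (of_bool (?x \<omega> \<le> t) * exp (- \<eta> * of_real t)) * of_bool (X t \<omega> = i))" for i
      by (rule integrable_bounded[where C=1], measurable) (use et in \<open>auto simp: of_bool_def\<close>)
    have ia: "integrable M (\<lambda>\<omega>. of_bool (?A \<omega>) :: real)" by (rule integrable_bounded[where C=1], measurable)
    have ib: "integrable M (\<lambda>\<omega>. of_bool (t < ?x \<omega> \<and> ?x \<omega> < t + h) :: real)" by (rule integrable_bounded[where C=1], measurable)
    have d1: "norm (?y' i - ?y i) \<le> C * h * alive_prob n t" for i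
    proof -
      have e: "?y' i - ?y i = (LINT \<omega>|M. of_bool (?A \<omega>) * drift (?x \<omega>) s \<eta> (t + h) * of_bool (X t \<omega> = i) - of_bool (?A \<omega>) * drift (?x \<omega>) s \<eta> t * of_bool (X t \<omega> = i))"
        unfolding drift_mean_def using iy[OF th'] iy[OF th(1)] by (rule Bochner_Integration.integral_diff[symmetric])
      have "norm (?y' i - ?y i) \<le> (LINT \<omega>|M. C * h * of_bool (?A \<omega>))"
        unfolding e
      proof (rule norm_integral_le)
        show "norm (of_bool (?A \<omega>) * drift (?x \<omega>) s \<eta> (t + h) * of_bool (X t \<omega> = i) - of_bool (?A \<omega>) * drift (?x \<omega>) s \<eta> t * of_bool (X t \<omega> = i)) \<le> C * h * of_bool (?A \<omega>)" for \<omega>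
          using C1[OF th, of "?x \<omega>"] C0 th by (auto simp: of_bool_def)
      qed (use iy[OF th'] iy[OF th(1)] ia in auto)
      then show ?thesis by (simp add: alive_prob_def)
    qed
    have d2: "norm (?y' j - (?y j * (1 + of_real h * (s - \<eta>)) - s * of_real h * ?k j)) \<le> C * h\<^sup>2 * alive_prob n t + C * h * emptying_prob a w n t h"
    proof -
      let ?I = "\<lambda>\<omega>. of_bool (?A \<omega>) * drift (?x \<omega>) s \<eta> (t + h) * of_bool (X t \<omega> = j)
          - ((of_bool (?A \<omega>) * drift (?x \<omega>) s \<eta> t * of_bool (X t \<omega> = j)) * (1 + of_real h * (s - \<eta>))
             - s * of_real h * (of_bool (?A \<omega>) * (of_bool (?x \<omega> \<le> t) * exp (- \<eta> * of_real t)) * of_bool (X t \<omega> = j)))"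
      have iI: "integrable M ?I"
        by (intro Bochner_Integration.integrable_diff integrable_mult_left integrable_mult_right iy ik th th')
      have e: "?y' j - (?y j * (1 + of_real h * (s - \<eta>)) - s * of_real h * ?k j) = (LINT \<omega>|M. ?I \<omega>)"
        unfolding drift_mean_def idle_mean_def
        by (subst Bochner_Integration.integral_diff, (intro Bochner_Integration.integrable_diff integrable_mult_left integrable_mult_right iy ik th th')+,
            subst Bochner_Integration.integral_diff, (intro Bochner_Integration.integrable_diff integrable_mult_left integrable_mult_right iy ik th th')+)
           simp
      have "norm (LINT \<omega>|M. ?I \<omega>) \<le> (LINT \<omega>|M. C * h\<^sup>2 * of_bool (?A \<omega>) + C * h * of_bool (t < ?x \<omega> \<and> ?x \<omega> < t + h))"
      proof (rule norm_integral_le[OF iI])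
        fix \<omega>
        show "norm (?I \<omega>) \<le> C * h\<^sup>2 * of_bool (?A \<omega>) + C * h * of_bool (t < ?x \<omega> \<and> ?x \<omega> < t + h)"
        proof (cases "?A \<omega> \<and> X t \<omega> = j")
          case True
          then show ?thesis using C2[OF th, of "?x \<omega>"] by simp
        next
          case False
          then have "?I \<omega> = 0" by auto
          then show ?thesis using C0 th by (simp only: norm_zero) (intro add_nonneg_nonneg mult_nonneg_nonneg, auto)
        qed
      qed (use ia ib in auto)
      also have "\<dots> = C * h\<^sup>2 * alive_prob n t + C * h * emptying_prob a w n t h"
        unfolding alive_prob_def emptying_prob_def using ia ib by simp
      finally show ?thesis unfolding e .
    qed
    let ?b2 = "- (?y' j - (?y j * (1 + of_real h * (s - \<eta>)) - s * of_real h * ?k j)) - of_real h * (\<Sum>i\<in>UNIV. of_real (killed_gen i j) * (?y' i - ?y i))"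
    have e: "?y j - (\<Sum>i\<in>UNIV. of_real (rate 0 h i j) * ?y' i) - of_real h * (\<Sum>i\<in>UNIV. ?y i * Mmat Q lam (\<eta> - s) $ i $ j) - s * of_real h * ?k j
       = - (?y' j - (?y j * (1 + of_real h * (s - \<eta>)) - s * of_real h * ?k j)) - of_real h * (\<Sum>i\<in>UNIV. of_real (killed_gen i j) * (?y' i - ?y i))"
    proof -
      have dl: "(\<Sum>i\<in>UNIV. of_bool (i = j) * f i) = (f j :: complex)" for f
      proof -
        have "(\<Sum>i\<in>UNIV. of_bool (i = j) * f i) = (\<Sum>i\<in>UNIV. if i = j then f i else 0)" by (rule sum.cong) auto
        then show ?thesis by simp
      qed
      have 1: "(\<Sum>i\<in>UNIV. of_real (rate 0 h i j) * ?y' i) = ?y' j + of_real h * (\<Sum>i\<in>UNIV. of_real (killed_gen i j) * ?y' i)"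
        unfolding rate_0 by (simp add: distrib_right sum.distrib dl sum_distrib_left mult.assoc)
      have "(\<Sum>i\<in>UNIV. ?y i * Mmat Q lam (\<eta> - s) $ i $ j) = (\<Sum>i\<in>UNIV. of_bool (i = j) * (?y i * (\<eta> - s)) - of_real (killed_gen i j) * ?y i)"
        unfolding Mmat_entry by (rule sum.cong) (auto simp: algebra_simps)
      also have "\<dots> = ?y j * (\<eta> - s) - (\<Sum>i\<in>UNIV. of_real (killed_gen i j) * ?y i)"
        by (simp add: sum_subtractf dl)
      finally have 2: "(\<Sum>i\<in>UNIV. ?y i * Mmat Q lam (\<eta> - s) $ i $ j) = ?y j * (\<eta> - s) - (\<Sum>i\<in>UNIV. of_real (killed_gen i j) * ?y i)" .
      have 3: "(\<Sum>i\<in>UNIV. of_real (killed_gen i j) * (?y' i - ?y i)) = (\<Sum>i\<in>UNIV. of_real (killed_gen i j) * ?y' i) - (\<Sum>i\<in>UNIV. of_real (killed_gen i j) * ?y i)"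
        by (simp add: right_diff_distrib sum_subtractf)
      show ?thesis unfolding 1 2 3 by (simp add: algebra_simps)
    qed
    have "norm ?b2 \<le> (C * h\<^sup>2 * alive_prob n t + C * h * emptying_prob a w n t h) + h * (G * (C * h * alive_prob n t))"
    proof (rule order_trans[OF norm_triangle_ineq4 add_mono])
      show "norm (- (?y' j - (?y j * (1 + of_real h * (s - \<eta>)) - s * of_real h * ?k j))) \<le> C * h\<^sup>2 * alive_prob n t + C * h * emptying_prob a w n t h"
        unfolding norm_minus_cancel by (rule d2)
      have Ca: "0 \<le> C * h * alive_prob n t" using C0 th alive_prob_nonneg by auto
      have "norm (\<Sum>i\<in>UNIV. of_real (killed_gen i j) * (?y' i - ?y i)) \<le> (\<Sum>i\<in>UNIV. \<bar>killed_gen i j\<bar> * (C * h * alive_prob n t))"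
        by (rule order_trans[OF norm_sum sum_mono]) (simp only: norm_mult norm_of_real, intro mult_left_mono d1, simp)
      also have "\<dots> = (\<Sum>i\<in>UNIV. \<bar>killed_gen i j\<bar>) * (C * h * alive_prob n t)" by (simp only: sum_distrib_right)
      also have "\<dots> \<le> G * (C * h * alive_prob n t)" using G Ca by (intro mult_right_mono)
      finally show "norm (of_real h * (\<Sum>i\<in>UNIV. of_real (killed_gen i j) * (?y' i - ?y i))) \<le> h * (G * (C * h * alive_prob n t))"
        using th by (simp only: norm_mult norm_of_real abs_of_pos) (intro mult_left_mono, auto)
    qed
    also have "\<dots> \<le> (C + G * C) * (h\<^sup>2 * alive_prob n t + h * emptying_prob a w n t h)"
    proof -
      have "0 \<le> emptying_prob a w n t h" unfolding emptying_prob_def by (intro Bochner_Integration.integral_nonneg) auto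
      then have "0 \<le> G * C * (h * emptying_prob a w n t h)" using G0 C0 th by (intro mult_nonneg_nonneg) auto
      then show ?thesis by (simp add: algebra_simps power2_eq_square)
    qed
    finally show "norm (?y j - (\<Sum>i\<in>UNIV. of_real (rate 0 h i j) * ?y' i) - of_real h * (\<Sum>i\<in>UNIV. ?y i * Mmat Q lam (\<eta> - s) $ i $ j) - s * of_real h * ?k j)
        \<le> (C + G * C) * (h\<^sup>2 * alive_prob n t + h * emptying_prob a w n t h)" unfolding e .
  qed (use C0 G0 in auto)
qed

lemma emptying_prob_sum: "(\<Sum>l<L. emptying_prob a w n (grid_pt q l) (1 / Suc q)) \<le> 1"
proof -
  have i: "integrable M (\<lambda>\<omega>. of_bool (grid_pt q l < empty_at a w n \<omega> \<and> empty_at a w n \<omega> < grid_pt q l + 1 / Suc q) :: real)" for l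
    by (rule integrable_bounded[where C=1], measurable)
  have "(\<Sum>l<L. emptying_prob a w n (grid_pt q l) (1 / Suc q)) = (LINT \<omega>|M. (\<Sum>l<L. of_bool (grid_pt q l < empty_at a w n \<omega> \<and> empty_at a w n \<omega> < grid_pt q l + 1 / Suc q)))"
    unfolding emptying_prob_def using i by (intro Bochner_Integration.integral_sum[symmetric])
  also have "\<dots> \<le> (LINT \<omega>|M. 1)"
  proof (rule integral_mono)
    show "integrable M (\<lambda>\<omega>. (\<Sum>l<L. of_bool (grid_pt q l < empty_at a w n \<omega> \<and> empty_at a w n \<omega> < grid_pt q l + 1 / Suc q) :: real))"
      using i by (intro Bochner_Integration.integrable_sum)
    show "(\<Sum>l<L. of_bool (grid_pt q l < empty_at a w n \<omega> \<and> empty_at a w n \<omega> < grid_pt q l + 1 / Suc q)) \<le> (1::real)" for \<omega>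
      using sum_interval_hits[of "1 / Suc q" "empty_at a w n \<omega>" L] by (simp add: grid_pt_def)
  qed simp
  finally show ?thesis by (simp add: prob_space)
qed

text \<open>
Contributions of the cell that starts at \<open>grid_pt q l\<close>: at its left end, at its right end if no
arrival occurs, and at the moment of the next arrival if exactly one occurs.  In the last one
the workload is taken at the left end, but the background at the right end, which converges
to the arrival state by right-continuity.
\<close>

definition here_term :: "nat \<Rightarrow> 'n \<Rightarrow> nat \<Rightarrow> 'w \<Rightarrow> complex" where
  "here_term q j l \<omega> = of_bool (alive n (grid_pt q l) \<omega>) * (drift (empty_at a w n \<omega>) s \<eta> (grid_pt q l) * of_bool (X (grid_pt q l) \<omega> = j))"

definition stay_term :: "nat \<Rightarrow> 'n \<Rightarrow> nat \<Rightarrow> 'w \<Rightarrow> complex" where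
  "stay_term q j l \<omega> = of_bool (alive n (grid_pt q l) \<omega>) * of_bool (counts T 0 (grid_pt q l) (grid_pt q l + 1 / Suc q) \<omega>)
      * (drift (empty_at a w n \<omega>) s \<eta> (grid_pt q (Suc l)) * of_bool (X (grid_pt q (Suc l)) \<omega> = j))"

definition leave_term :: "nat \<Rightarrow> 'n \<Rightarrow> nat \<Rightarrow> 'w \<Rightarrow> complex" where
  "leave_term q j l \<omega> = of_bool (alive n (grid_pt q l) \<omega>) * of_bool (counts T 1 (grid_pt q l) (grid_pt q l + 1 / Suc q) \<omega>)
      * (drift (empty_at a w n \<omega>) s \<eta> (grid_pt q l) * of_bool (X (grid_pt q (Suc l)) \<omega> = j))"

lemma X_grid_pt_meas [measurable]: "X (grid_pt q l) \<in> measurable M (count_space UNIV)" by (rule X_meas[OF grid_pt_nonneg])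

lemma here_term_int: "integrable M (here_term q j l)" and stay_term_int: "integrable M (stay_term q j l)" and leave_term_int: "integrable M (leave_term q j l)"
  and here_term_meas [measurable]: "here_term q j l \<in> borel_measurable M" and stay_term_meas [measurable]: "stay_term q j l \<in> borel_measurable M"
  and leave_term_meas [measurable]: "leave_term q j l \<in> borel_measurable M"
proof -
  show m: "here_term q j l \<in> borel_measurable M" "stay_term q j l \<in> borel_measurable M" "leave_term q j l \<in> borel_measurable M"
    unfolding here_term_def stay_term_def leave_term_def by measurable
  have "norm (here_term q j l \<omega>) \<le> 1" "norm (stay_term q j l \<omega>) \<le> 1" "norm (leave_term q j l \<omega>) \<le> 1" for \<omega>
    unfolding here_term_def stay_term_def leave_term_def
    using drift_le[OF grid_pt_nonneg, of "empty_at a w n \<omega>"] by (auto simp: of_bool_def)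
  then show "integrable M (here_term q j l)" "integrable M (stay_term q j l)" "integrable M (leave_term q j l)"
    using m by (auto intro: integrable_bounded[where C=1])
qed

lemma here_term_integral: "(LINT \<omega>|M. here_term q j l \<omega>) = drift_mean a w n s \<eta> (grid_pt q l) (grid_pt q l) j"
  by (simp add: here_term_def drift_mean_def mult.assoc)

lemma stay_term_integral: "(LINT \<omega>|M. stay_term q j l \<omega>)
   = (\<Sum>i\<in>UNIV. LINT \<omega>|M. of_bool (alive n (grid_pt q l) \<omega>) * drift (empty_at a w n \<omega>) s \<eta> (grid_pt q (Suc l)) * of_real (slot 0 (grid_pt q l) (1 / Suc q) i j \<omega>))"
proof (subst integral_slot_sum)
  show "(LINT \<omega>|M. stay_term q j l \<omega>) = (LINT \<omega>|M. of_bool (alive n (grid_pt q l) \<omega>) * drift (empty_at a w n \<omega>) s \<eta> (grid_pt q (Suc l)) *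
          (of_bool (counts T 0 (grid_pt q l) (grid_pt q l + 1 / Suc q) \<omega>) * of_bool (X (grid_pt q l + 1 / Suc q) \<omega> = j)))"
    by (simp only: stay_term_def grid_pt_Suc mult_ac)
  show "norm (of_bool (alive n (grid_pt q l) \<omega>) * drift (empty_at a w n \<omega>) s \<eta> (grid_pt q (Suc l))) \<le> 1" for \<omega>
    using drift_le[OF grid_pt_nonneg, of "empty_at a w n \<omega>" q "Suc l"] by auto
qed (auto simp: grid_pt_nonneg)

lemma leave_term_integral: "(LINT \<omega>|M. leave_term q j l \<omega>)
   = (\<Sum>i\<in>UNIV. LINT \<omega>|M. of_bool (alive n (grid_pt q l) \<omega>) * drift (empty_at a w n \<omega>) s \<eta> (grid_pt q l) * of_real (slot 1 (grid_pt q l) (1 / Suc q) i j \<omega>))"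
proof (subst integral_slot_sum)
  show "(LINT \<omega>|M. leave_term q j l \<omega>) = (LINT \<omega>|M. of_bool (alive n (grid_pt q l) \<omega>) * drift (empty_at a w n \<omega>) s \<eta> (grid_pt q l) *
          (of_bool (counts T 1 (grid_pt q l) (grid_pt q l + 1 / Suc q) \<omega>) * of_bool (X (grid_pt q l + 1 / Suc q) \<omega> = j)))"
    by (simp only: leave_term_def grid_pt_Suc mult_ac)
  show "norm (of_bool (alive n (grid_pt q l) \<omega>) * drift (empty_at a w n \<omega>) s \<eta> (grid_pt q l)) \<le> 1" for \<omega>
    using drift_le[OF grid_pt_nonneg, of "empty_at a w n \<omega>" q l] by auto
qed (auto simp: grid_pt_nonneg)

lemma X_cell_ev:
  assumes w: "\<omega> \<in> space M" and k: "1 \<le> k"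
  shows "\<forall>\<^sub>F q in sequentially. X (grid_pt q (cell q (T k \<omega>))) \<omega> = Y k \<omega>"
  unfolding arrival_state_def using T_nonneg[OF w k] grid_pt_cell_lim[OF T_nonneg[OF w k]]
  by (intro X_approx[OF w]) auto

text \<open>
The sum collapses to the state in the first grid point after the \<open>n\<close>th arrival, which exists
before the next arrival as soon as the mesh is fine enough.
\<close>

lemma entry_lim: "(\<lambda>q. LINT \<omega>|M. here_term q j ((Suc q)\<^sup>2) \<omega> + (\<Sum>l<(Suc q)\<^sup>2. here_term q j l \<omega> - stay_term q j l \<omega>)) \<longlonglongrightarrow> post_transform a w n s \<eta> j"
  unfolding post_transform_def
proof (rule integral_dominated_convergence[where w="\<lambda>_. 1"])
  have [measurable]: "T n \<in> borel_measurable M" "Y n \<in> measurable M (count_space UNIV)" using n by (auto intro: T_meas Y_meas)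
  show "(\<lambda>\<omega>. drift (empty_at a w n \<omega>) s \<eta> (T n \<omega>) * of_bool (Y n \<omega> = j)) \<in> borel_measurable M"
    unfolding drift_def by measurable
  show "(\<lambda>\<omega>. here_term q j ((Suc q)\<^sup>2) \<omega> + (\<Sum>l<(Suc q)\<^sup>2. here_term q j l \<omega> - stay_term q j l \<omega>)) \<in> borel_measurable M" for q
    by measurable
  let ?c = "\<lambda>q \<omega>. cell q (T n \<omega>)"
  have eq: "here_term q j ((Suc q)\<^sup>2) \<omega> + (\<Sum>l<(Suc q)\<^sup>2. here_term q j l \<omega> - stay_term q j l \<omega>)
      = of_bool (?c q \<omega> \<le> (Suc q)\<^sup>2 \<and> grid_pt q (?c q \<omega>) < T (Suc n) \<omega>)
         * (drift (empty_at a w n \<omega>) s \<eta> (grid_pt q (?c q \<omega>)) * of_bool (X (grid_pt q (?c q \<omega>)) \<omega> = j))" if "\<omega> \<in> space M" for q \<omega>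
    unfolding here_term_def stay_term_def
    by (rule telescope_entry[OF that n, of q "(Suc q)\<^sup>2" "\<lambda>l. drift (empty_at a w n \<omega>) s \<eta> (grid_pt q l) * of_bool (X (grid_pt q l) \<omega> = j)", symmetric])
  show "AE \<omega> in M. norm (here_term q j ((Suc q)\<^sup>2) \<omega> + (\<Sum>l<(Suc q)\<^sup>2. here_term q j l \<omega> - stay_term q j l \<omega>)) \<le> 1" for q
  proof (rule AE_I2)
    fix \<omega> assume w: "\<omega> \<in> space M"
    show "norm (here_term q j ((Suc q)\<^sup>2) \<omega> + (\<Sum>l<(Suc q)\<^sup>2. here_term q j l \<omega> - stay_term q j l \<omega>)) \<le> 1"
      unfolding eq[OF w] using drift_le[OF grid_pt_nonneg, of "empty_at a w n \<omega>" q "?c q \<omega>"] by (auto simp: of_bool_def)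
  qed
  show "AE \<omega> in M. (\<lambda>q. here_term q j ((Suc q)\<^sup>2) \<omega> + (\<Sum>l<(Suc q)\<^sup>2. here_term q j l \<omega> - stay_term q j l \<omega>))
      \<longlonglongrightarrow> drift (empty_at a w n \<omega>) s \<eta> (T n \<omega>) * of_bool (Y n \<omega> = j)"
  proof (rule AE_I2)
    fix \<omega> assume w: "\<omega> \<in> space M"
    have T0: "0 \<le> T n \<omega>" using T_nonneg[OF w n] .
    have lim: "(\<lambda>q. grid_pt q (?c q \<omega>)) \<longlonglongrightarrow> T n \<omega>" by (rule grid_pt_cell_lim[OF T0])
    have "(\<lambda>q. drift (empty_at a w n \<omega>) s \<eta> (grid_pt q (?c q \<omega>)) * of_bool (Y n \<omega> = j)) \<longlonglongrightarrow> drift (empty_at a w n \<omega>) s \<eta> (T n \<omega>) * of_bool (Y n \<omega> = j)"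
      by (intro tendsto_intros drift_tendsto lim)
    moreover have "\<forall>\<^sub>F q in sequentially. drift (empty_at a w n \<omega>) s \<eta> (grid_pt q (?c q \<omega>)) * of_bool (Y n \<omega> = j)
        = here_term q j ((Suc q)\<^sup>2) \<omega> + (\<Sum>l<(Suc q)\<^sup>2. here_term q j l \<omega> - stay_term q j l \<omega>)"
      using order_tendstoD(2)[OF lim T_Suc[OF w n]] cell_le_square[OF T0] X_cell_ev[OF w n]
      by eventually_elim (simp add: eq[OF w])
    ultimately show "(\<lambda>q. here_term q j ((Suc q)\<^sup>2) \<omega> + (\<Sum>l<(Suc q)\<^sup>2. here_term q j l \<omega> - stay_term q j l \<omega>))
      \<longlonglongrightarrow> drift (empty_at a w n \<omega>) s \<eta> (T n \<omega>) * of_bool (Y n \<omega> = j)"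
      by (rule Lim_transform_eventually)
  qed
qed simp

lemma exit_lim: "(\<lambda>q. LINT \<omega>|M. (\<Sum>l<(Suc q)\<^sup>2. leave_term q j l \<omega>)) \<longlonglongrightarrow> pre_transform a w (Suc n) s \<eta> j"
  unfolding pre_transform_drift[OF n]
proof (rule integral_dominated_convergence[where w="\<lambda>_. 1"])
  have [measurable]: "T (Suc n) \<in> borel_measurable M" "Y (Suc n) \<in> measurable M (count_space UNIV)" using n by (auto intro: T_meas Y_meas)
  show "(\<lambda>\<omega>. drift (empty_at a w n \<omega>) s \<eta> (T (Suc n) \<omega>) * of_bool (Y (Suc n) \<omega> = j)) \<in> borel_measurable M"
    unfolding drift_def by measurable
  show "(\<lambda>\<omega>. (\<Sum>l<(Suc q)\<^sup>2. leave_term q j l \<omega>)) \<in> borel_measurable M" for q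
    by measurable
  let ?c = "\<lambda>q \<omega>. cell q (T n \<omega>)" and ?d = "\<lambda>q \<omega>. cell q (T (Suc n) \<omega>)"
  have eq: "(\<Sum>l<(Suc q)\<^sup>2. leave_term q j l \<omega>)
      = of_bool (?c q \<omega> < ?d q \<omega> \<and> ?d q \<omega> \<le> (Suc q)\<^sup>2 \<and> grid_pt q (?d q \<omega>) < T (Suc (Suc n)) \<omega>)
         * (drift (empty_at a w n \<omega>) s \<eta> (grid_pt q (?d q \<omega> - 1)) * of_bool (X (grid_pt q (Suc (?d q \<omega> - 1))) \<omega> = j))" if "\<omega> \<in> space M" for q \<omega>
    unfolding leave_term_def
    by (rule telescope_exit[OF that n, of q "\<lambda>l. drift (empty_at a w n \<omega>) s \<eta> (grid_pt q l) * of_bool (X (grid_pt q (Suc l)) \<omega> = j)" "(Suc q)\<^sup>2"])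
  show "AE \<omega> in M. norm (\<Sum>l<(Suc q)\<^sup>2. leave_term q j l \<omega>) \<le> 1" for q
  proof (rule AE_I2)
    fix \<omega> assume w: "\<omega> \<in> space M"
    show "norm (\<Sum>l<(Suc q)\<^sup>2. leave_term q j l \<omega>) \<le> 1"
      unfolding eq[OF w] using drift_le[OF grid_pt_nonneg, of "empty_at a w n \<omega>" q "?d q \<omega> - 1"] by (auto simp: of_bool_def)
  qed
  show "AE \<omega> in M. (\<lambda>q. \<Sum>l<(Suc q)\<^sup>2. leave_term q j l \<omega>)
      \<longlonglongrightarrow> drift (empty_at a w n \<omega>) s \<eta> (T (Suc n) \<omega>) * of_bool (Y (Suc n) \<omega> = j)"
  proof (rule AE_I2)
    fix \<omega> assume w: "\<omega> \<in> space M"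
    have n': "1 \<le> Suc n" by simp
    have T0: "0 \<le> T n \<omega>" "0 \<le> T (Suc n) \<omega>" using T_nonneg[OF w n] T_nonneg[OF w n'] by auto
    have lim: "(\<lambda>q. grid_pt q (?d q \<omega>)) \<longlonglongrightarrow> T (Suc n) \<omega>" and lim0: "(\<lambda>q. grid_pt q (?c q \<omega>)) \<longlonglongrightarrow> T n \<omega>" by (auto intro: grid_pt_cell_lim T0)
    have "(\<lambda>q. grid_pt q (?d q \<omega>) - 1 / Suc q) \<longlonglongrightarrow> T (Suc n) \<omega> - 0"
      by (intro tendsto_intros lim LIMSEQ_Suc[OF lim_const_over_n])
    then have "(\<lambda>q. drift (empty_at a w n \<omega>) s \<eta> (grid_pt q (?d q \<omega>) - 1 / Suc q) * of_bool (Y (Suc n) \<omega> = j))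
        \<longlonglongrightarrow> drift (empty_at a w n \<omega>) s \<eta> (T (Suc n) \<omega> - 0) * of_bool (Y (Suc n) \<omega> = j)"
      by (rule tendsto_mult[OF drift_tendsto tendsto_const])
    moreover have "\<forall>\<^sub>F q in sequentially. drift (empty_at a w n \<omega>) s \<eta> (grid_pt q (?d q \<omega>) - 1 / Suc q) * of_bool (Y (Suc n) \<omega> = j)
        = (\<Sum>l<(Suc q)\<^sup>2. leave_term q j l \<omega>)"
      using order_tendstoD(2)[OF lim T_Suc[OF w n']] order_tendstoD(2)[OF lim0 T_Suc[OF w n]] cell_le_square[OF T0(2)] X_cell_ev[OF w n']
    proof eventually_elim
      case (elim q)
      have lt: "?c q \<omega> < ?d q \<omega>"
      proof (rule ccontr)
        assume "\<not> ?c q \<omega> < ?d q \<omega>"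
        then have "T (Suc n) \<omega> \<le> grid_pt q (?c q \<omega>)" by (simp add: le_grid_pt_iff)
        then show False using elim by simp
      qed
      then have d: "Suc (?d q \<omega> - 1) = ?d q \<omega>" by simp
      have "grid_pt q (?d q \<omega> - 1) = grid_pt q (?d q \<omega>) - 1 / Suc q" using grid_pt_Suc[of q "?d q \<omega> - 1"] unfolding d by simp
      then show ?case using elim lt by (simp only: eq[OF w] d) simp
    qed
    ultimately show "(\<lambda>q. \<Sum>l<(Suc q)\<^sup>2. leave_term q j l \<omega>)
      \<longlonglongrightarrow> drift (empty_at a w n \<omega>) s \<eta> (T (Suc n) \<omega>) * of_bool (Y (Suc n) \<omega> = j)"
      unfolding diff_0_right by (rule Lim_transform_eventually)
  qed
qed simp

lemma here_term_end_lim: "(\<lambda>q. LINT \<omega>|M. here_term q j ((Suc q)\<^sup>2) \<omega>) \<longlonglongrightarrow> 0"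
proof -
  have "(\<lambda>q. LINT \<omega>|M. here_term q j ((Suc q)\<^sup>2) \<omega>) \<longlonglongrightarrow> (LINT \<omega>|M. 0)"
  proof (rule integral_dominated_convergence[where w="\<lambda>_. 1"])
    show "AE \<omega> in M. norm (here_term q j ((Suc q)\<^sup>2) \<omega>) \<le> 1" for q
      unfolding here_term_def using drift_le[OF grid_pt_nonneg] by (intro AE_I2) (auto simp: of_bool_def)
    show "AE \<omega> in M. (\<lambda>q. here_term q j ((Suc q)\<^sup>2) \<omega>) \<longlonglongrightarrow> 0"
    proof (rule AE_I2)
      fix \<omega> assume w: "\<omega> \<in> space M"
      have "\<forall>\<^sub>F q in sequentially. cell q (T (Suc n) \<omega>) \<le> (Suc q)\<^sup>2" using T_nonneg[OF w, of "Suc n"] by (intro cell_le_square) simp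
      then have "\<forall>\<^sub>F q in sequentially. here_term q j ((Suc q)\<^sup>2) \<omega> = 0"
      proof eventually_elim
        case (elim q)
        then have "T (Suc n) \<omega> \<le> grid_pt q ((Suc q)\<^sup>2)" unfolding le_grid_pt_iff .
        then have "\<not> alive n (grid_pt q ((Suc q)\<^sup>2)) \<omega>" unfolding alive_def by linarith
        then show ?case unfolding here_term_def by (simp only: of_bool_eq mult_zero_left)
      qed
      then show "(\<lambda>q. here_term q j ((Suc q)\<^sup>2) \<omega>) \<longlonglongrightarrow> 0" by (rule tendsto_eventually)
    qed
  qed auto
  then show ?thesis by simp
qed

text \<open>
Customers arrive in state \<open>j\<close> at rate \<open>lam j\<close>: the transform at the next arrival is \<open>lam j\<close>
times the mean occupation time.
\<close>

lemma drift_sum_lim: "(\<lambda>q. drift_sum a w n s \<eta> q j) \<longlonglongrightarrow> pre_transform a w (Suc n) s \<eta> j / of_real (lam j)"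
proof -
  obtain K where K: "0 \<le> K" "\<forall>\<^sub>F q in sequentially. (\<Sum>l<(Suc q)\<^sup>2. 1 / Suc q * alive_prob n (grid_pt q l)) \<le> K"
    using occupation_bound[OF n, of "\<lambda>q. (Suc q)\<^sup>2"] by blast
  let ?x = "\<lambda>q. LINT \<omega>|M. (\<Sum>l<(Suc q)\<^sup>2. leave_term q j l \<omega>)"
  have "(\<lambda>q. ?x q - of_real (lam j) * drift_sum a w n s \<eta> q j) \<longlonglongrightarrow> 0"
  proof (rule tendsto_zero_of_mesh[where K=K and D=0])
    fix \<epsilon> :: real assume \<epsilon>: "0 < \<epsilon>"
    show "\<forall>\<^sub>F q in sequentially. norm (?x q - of_real (lam j) * drift_sum a w n s \<eta> q j) \<le> \<epsilon> * K + 0 * (1 / Suc q)"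
      using K(2) eventually_mesh[OF one_step_alive[OF \<epsilon> order_refl]]
    proof eventually_elim
      case (elim q)
      have step: "norm ((LINT \<omega>|M. leave_term q j l \<omega>) - of_real (lam j) * (of_real (1 / Suc q) * drift_mean a w n s \<eta> (grid_pt q l) (grid_pt q l) j)) \<le> \<epsilon> * (1 / Suc q * alive_prob n (grid_pt q l))" for l
      proof -
        have "norm ((\<Sum>i\<in>UNIV. LINT \<omega>|M. of_bool (alive n (grid_pt q l) \<omega>) * drift (empty_at a w n \<omega>) s \<eta> (grid_pt q l) * of_real (slot 1 (grid_pt q l) (1 / Suc q) i j \<omega>))
          - (\<Sum>i\<in>UNIV. of_real (rate 1 (1 / Suc q) i j) * (LINT \<omega>|M. of_bool (alive n (grid_pt q l) \<omega>) * drift (empty_at a w n \<omega>) s \<eta> (grid_pt q l) * of_bool (X (grid_pt q l) \<omega> = i))))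
         \<le> \<epsilon> * (1 / Suc q) * alive_prob n (grid_pt q l)"
          by (rule elim(2)[rule_format, OF grid_pt_nonneg n, of "\<lambda>x. drift x s \<eta> (grid_pt q l)"]) (auto intro: drift_le grid_pt_nonneg)
        moreover have "(\<Sum>i\<in>UNIV. of_real (rate 1 (1 / Suc q) i j) * (LINT \<omega>|M. of_bool (alive n (grid_pt q l) \<omega>) * drift (empty_at a w n \<omega>) s \<eta> (grid_pt q l) * of_bool (X (grid_pt q l) \<omega> = i)))
            = of_real (lam j) * (of_real (1 / Suc q) * drift_mean a w n s \<eta> (grid_pt q l) (grid_pt q l) j)"
        proof -
          have "of_real (rate 1 (1 / Suc q) i j) * drift_mean a w n s \<eta> (grid_pt q l) (grid_pt q l) i
             = (if i = j then of_real (lam j) * (of_real (1 / Suc q) * drift_mean a w n s \<eta> (grid_pt q l) (grid_pt q l) j) else 0)" for i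
            unfolding rate_1 by simp
          then show ?thesis unfolding drift_mean_def[symmetric] by simp
        qed
        ultimately show ?thesis unfolding leave_term_integral by (simp only: mult.assoc)
      qed
      have e: "?x q - of_real (lam j) * drift_sum a w n s \<eta> q j
          = (\<Sum>l<(Suc q)\<^sup>2. (LINT \<omega>|M. leave_term q j l \<omega>) - of_real (lam j) * (of_real (1 / Suc q) * drift_mean a w n s \<eta> (grid_pt q l) (grid_pt q l) j))"
        unfolding drift_sum_def sum_subtractf sum_distrib_left
        using leave_term_int by (subst Bochner_Integration.integral_sum) auto
      have "norm (?x q - of_real (lam j) * drift_sum a w n s \<eta> q j) \<le> (\<Sum>l<(Suc q)\<^sup>2. \<epsilon> * (1 / Suc q * alive_prob n (grid_pt q l)))"
        unfolding e by (rule order_trans[OF norm_sum sum_mono[OF step]])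
      also have "\<dots> = \<epsilon> * (\<Sum>l<(Suc q)\<^sup>2. 1 / Suc q * alive_prob n (grid_pt q l))" by (simp only: sum_distrib_left)
      also have "\<dots> \<le> \<epsilon> * K" using elim(1) \<epsilon> by (intro mult_left_mono) auto
      finally show ?case by simp
    qed
  qed (rule K)
  from tendsto_diff[OF exit_lim[of j] this] have "(\<lambda>q. of_real (lam j) * drift_sum a w n s \<eta> q j) \<longlonglongrightarrow> pre_transform a w (Suc n) s \<eta> j" by simp
  from tendsto_divide[OF this tendsto_const, of "of_real (lam j)"] show ?thesis using lam_pos[of j] by simp
qed

lemma entry_balance: "(\<lambda>q. (LINT \<omega>|M. here_term q j ((Suc q)\<^sup>2) \<omega> + (\<Sum>l<(Suc q)\<^sup>2. here_term q j l \<omega> - stay_term q j l \<omega>))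
     - (LINT \<omega>|M. here_term q j ((Suc q)\<^sup>2) \<omega>)
     - (\<Sum>i\<in>UNIV. drift_sum a w n s \<eta> q i * Mmat Q lam (\<eta> - s) $ i $ j) - s * idle_sum a w n \<eta> q j) \<longlonglongrightarrow> 0"
proof -
  obtain K where K: "0 \<le> K" "\<forall>\<^sub>F q in sequentially. (\<Sum>l<(Suc q)\<^sup>2. 1 / Suc q * alive_prob n (grid_pt q l)) \<le> K"
    using occupation_bound[OF n, of "\<lambda>q. (Suc q)\<^sup>2"] by blast
  obtain C where C0: "0 \<le> C" and C: "\<And>t h j. 0 \<le> t \<Longrightarrow> 0 < h \<Longrightarrow> h \<le> 1 \<Longrightarrow>
    norm (drift_mean a w n s \<eta> t t j - (\<Sum>i\<in>UNIV. of_real (rate 0 h i j) * drift_mean a w n s \<eta> t (t + h) i)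
       - of_real h * (\<Sum>i\<in>UNIV. drift_mean a w n s \<eta> t t i * Mmat Q lam (\<eta> - s) $ i $ j) - s * of_real h * idle_mean a w n \<eta> t j)
     \<le> C * (h\<^sup>2 * alive_prob n t + h * emptying_prob a w n t h)" using cell_balance by blast
  show ?thesis
  proof (rule tendsto_zero_of_mesh[where K=K and D="C * (K + 1)"])
    fix \<epsilon> :: real assume \<epsilon>: "0 < \<epsilon>"
    show "\<forall>\<^sub>F q in sequentially. norm ((LINT \<omega>|M. here_term q j ((Suc q)\<^sup>2) \<omega> + (\<Sum>l<(Suc q)\<^sup>2. here_term q j l \<omega> - stay_term q j l \<omega>))
     - (LINT \<omega>|M. here_term q j ((Suc q)\<^sup>2) \<omega>)
     - (\<Sum>i\<in>UNIV. drift_sum a w n s \<eta> q i * Mmat Q lam (\<eta> - s) $ i $ j) - s * idle_sum a w n \<eta> q j) \<le> \<epsilon> * K + C * (K + 1) * (1 / Suc q)"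
      using K(2) eventually_mesh[OF one_step_alive[OF \<epsilon> zero_le_one]]
    proof eventually_elim
      case (elim q)
      define h where "h = 1 / real (Suc q)"
      have h: "0 < h" "h \<le> 1" by (auto simp: h_def)
      let ?drift_mean = "\<lambda>l i. drift_mean a w n s \<eta> (grid_pt q l) (grid_pt q l) i" and ?drift_mean' = "\<lambda>l i. drift_mean a w n s \<eta> (grid_pt q l) (grid_pt q l + h) i"
      let ?M = "\<lambda>i. Mmat Q lam (\<eta> - s) $ i $ j"
      define b where "b l = ?drift_mean l j - (LINT \<omega>|M. stay_term q j l \<omega>) - of_real h * (\<Sum>i\<in>UNIV. ?drift_mean l i * ?M i) - s * of_real h * idle_mean a w n \<eta> (grid_pt q l) j" for l
      have step: "norm (b l) \<le> \<epsilon> * (h * alive_prob n (grid_pt q l)) + C * h * (h * alive_prob n (grid_pt q l)) + C * h * emptying_prob a w n (grid_pt q l) h" for l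
      proof -
        let ?R = "\<Sum>i\<in>UNIV. of_real (rate 0 h i j) * ?drift_mean' l i"
        have "norm ((\<Sum>i\<in>UNIV. LINT \<omega>|M. of_bool (alive n (grid_pt q l) \<omega>) * drift (empty_at a w n \<omega>) s \<eta> (grid_pt q (Suc l)) * of_real (slot 0 (grid_pt q l) (1 / Suc q) i j \<omega>))
          - (\<Sum>i\<in>UNIV. of_real (rate 0 (1 / Suc q) i j) * (LINT \<omega>|M. of_bool (alive n (grid_pt q l) \<omega>) * drift (empty_at a w n \<omega>) s \<eta> (grid_pt q (Suc l)) * of_bool (X (grid_pt q l) \<omega> = i))))
         \<le> \<epsilon> * (1 / Suc q) * alive_prob n (grid_pt q l)"
          by (rule elim(2)[rule_format, OF grid_pt_nonneg n, of "\<lambda>x. drift x s \<eta> (grid_pt q (Suc l))"]) (auto intro: drift_le grid_pt_nonneg)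
        then have 1: "norm ((LINT \<omega>|M. stay_term q j l \<omega>) - ?R) \<le> \<epsilon> * (h * alive_prob n (grid_pt q l))"
          unfolding stay_term_integral by (simp only: drift_mean_def h_def grid_pt_Suc mult.assoc)
        have 2: "norm (?drift_mean l j - ?R - of_real h * (\<Sum>i\<in>UNIV. ?drift_mean l i * ?M i) - s * of_real h * idle_mean a w n \<eta> (grid_pt q l) j)
           \<le> C * (h\<^sup>2 * alive_prob n (grid_pt q l) + h * emptying_prob a w n (grid_pt q l) h)"
          by (rule C[OF grid_pt_nonneg h])
        have e: "b l = (?drift_mean l j - ?R - of_real h * (\<Sum>i\<in>UNIV. ?drift_mean l i * ?M i) - s * of_real h * idle_mean a w n \<eta> (grid_pt q l) j) - ((LINT \<omega>|M. stay_term q j l \<omega>) - ?R)"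
          by (simp add: b_def)
        have "norm (b l) \<le> C * (h\<^sup>2 * alive_prob n (grid_pt q l) + h * emptying_prob a w n (grid_pt q l) h) + \<epsilon> * (h * alive_prob n (grid_pt q l))"
          unfolding e by (rule order_trans[OF norm_triangle_ineq4 add_mono[OF 2 1]])
        also have "\<dots> = \<epsilon> * (h * alive_prob n (grid_pt q l)) + C * h * (h * alive_prob n (grid_pt q l)) + C * h * emptying_prob a w n (grid_pt q l) h"
          by (simp add: algebra_simps power2_eq_square)
        finally show ?thesis .
      qed
      have "(LINT \<omega>|M. here_term q j ((Suc q)\<^sup>2) \<omega> + (\<Sum>l<(Suc q)\<^sup>2. here_term q j l \<omega> - stay_term q j l \<omega>))
          = (LINT \<omega>|M. here_term q j ((Suc q)\<^sup>2) \<omega>) + (\<Sum>l<(Suc q)\<^sup>2. ?drift_mean l j - (LINT \<omega>|M. stay_term q j l \<omega>))"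
        unfolding here_term_integral[symmetric]
        using here_term_int stay_term_int by (subst Bochner_Integration.integral_add) auto
      moreover have "(\<Sum>i\<in>UNIV. drift_sum a w n s \<eta> q i * ?M i) = (\<Sum>l<(Suc q)\<^sup>2. of_real h * (\<Sum>i\<in>UNIV. ?drift_mean l i * ?M i))"
        unfolding drift_sum_def h_def sum_distrib_left sum_distrib_right by (subst sum.swap) (simp only: mult.assoc)
      moreover have "s * idle_sum a w n \<eta> q j = (\<Sum>l<(Suc q)\<^sup>2. s * of_real h * idle_mean a w n \<eta> (grid_pt q l) j)"
        unfolding idle_sum_def h_def sum_distrib_left by (simp only: mult.assoc)
      ultimately have e: "(LINT \<omega>|M. here_term q j ((Suc q)\<^sup>2) \<omega> + (\<Sum>l<(Suc q)\<^sup>2. here_term q j l \<omega> - stay_term q j l \<omega>))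
         - (LINT \<omega>|M. here_term q j ((Suc q)\<^sup>2) \<omega>) - (\<Sum>i\<in>UNIV. drift_sum a w n s \<eta> q i * ?M i) - s * idle_sum a w n \<eta> q j = (\<Sum>l<(Suc q)\<^sup>2. b l)"
        unfolding b_def sum_subtractf by (simp only:) simp
      have "norm (\<Sum>l<(Suc q)\<^sup>2. b l) \<le> (\<Sum>l<(Suc q)\<^sup>2. \<epsilon> * (h * alive_prob n (grid_pt q l)) + C * h * (h * alive_prob n (grid_pt q l)) + C * h * emptying_prob a w n (grid_pt q l) h)"
        by (rule order_trans[OF norm_sum sum_mono[OF step]])
      also have "\<dots> = (\<epsilon> + C * h) * (\<Sum>l<(Suc q)\<^sup>2. h * alive_prob n (grid_pt q l)) + C * h * (\<Sum>l<(Suc q)\<^sup>2. emptying_prob a w n (grid_pt q l) h)"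
        by (simp only: sum.distrib sum_distrib_left distrib_right)
      also have "\<dots> \<le> (\<epsilon> + C * h) * K + C * h * 1"
        using elim(1) emptying_prob_sum[where L="(Suc q)\<^sup>2" and q=q] C0 h \<epsilon> unfolding h_def[symmetric]
        by (intro add_mono mult_left_mono) auto
      also have "\<dots> = \<epsilon> * K + C * (K + 1) * (1 / Suc q)" by (simp only: h_def[symmetric]) (simp add: algebra_simps)
      finally show ?case unfolding e .
    qed
  qed (rule K)
qed

lemma balance_lim: "(\<lambda>q. s * idle_sum a w n \<eta> q j)
   \<longlonglongrightarrow> post_transform a w n s \<eta> j - (\<Sum>i\<in>UNIV. pre_transform a w (Suc n) s \<eta> i / of_real (lam i) * Mmat Q lam (\<eta> - s) $ i $ j)"
proof -
  let ?E = "\<lambda>q. LINT \<omega>|M. here_term q j ((Suc q)\<^sup>2) \<omega> + (\<Sum>l<(Suc q)\<^sup>2. here_term q j l \<omega> - stay_term q j l \<omega>)"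
  let ?A = "\<lambda>q. LINT \<omega>|M. here_term q j ((Suc q)\<^sup>2) \<omega>"
  let ?Y = "\<lambda>q. \<Sum>i\<in>UNIV. drift_sum a w n s \<eta> q i * Mmat Q lam (\<eta> - s) $ i $ j"
  have "(\<lambda>q. ?E q - ?A q - ?Y q - (?E q - ?A q - ?Y q - s * idle_sum a w n \<eta> q j))
     \<longlonglongrightarrow> post_transform a w n s \<eta> j - 0 - (\<Sum>i\<in>UNIV. pre_transform a w (Suc n) s \<eta> i / of_real (lam i) * Mmat Q lam (\<eta> - s) $ i $ j) - 0"
    by (intro tendsto_diff entry_lim here_term_end_lim entry_balance tendsto_sum tendsto_mult drift_sum_lim tendsto_const)
  then show ?thesis by simp
qed

end

text \<open>
The idle term arises as a limit in which \<open>s\<close> only appears as a factor.  Its value at \<open>s = 1\<close>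
therefore determines it for all \<open>s\<close>.
\<close>

lemma balance:
  assumes n: "1 \<le> n" and \<eta>: "0 \<le> Re \<eta>"
  shows "\<exists>\<kappa>. \<forall>s j. 0 \<le> Re s \<longrightarrow>
    (\<Sum>i\<in>UNIV. pre_transform a w (Suc n) s \<eta> i / of_real (lam i) * Mmat Q lam (\<eta> - s) $ i $ j) = post_transform a w n s \<eta> j - s * \<kappa> j"
proof (intro exI allI impI)
  fix s j assume s: "0 \<le> Re s"
  let ?R = "\<lambda>s j. post_transform a w n s \<eta> j - (\<Sum>i\<in>UNIV. pre_transform a w (Suc n) s \<eta> i / of_real (lam i) * Mmat Q lam (\<eta> - s) $ i $ j)"
  have "(\<lambda>q. 1 * idle_sum a w n \<eta> q j) \<longlonglongrightarrow> ?R 1 j" by (rule balance_lim[OF n _ \<eta>]) simp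
  then have "(\<lambda>q. s * idle_sum a w n \<eta> q j) \<longlonglongrightarrow> s * ?R 1 j" by (intro tendsto_mult tendsto_const) simp
  then have "s * ?R 1 j = ?R s j" using balance_lim[OF n s \<eta>] by (rule LIMSEQ_unique)
  then show "(\<Sum>i\<in>UNIV. pre_transform a w (Suc n) s \<eta> i / of_real (lam i) * Mmat Q lam (\<eta> - s) $ i $ j) = post_transform a w n s \<eta> j - s * ?R 1 j"
    by simp
qed

end

section \<open>Linear algebra\<close>

lemma poly_det: "poly (det A) x = det (\<chi> i j. poly (A $ i $ j) x)"
  unfolding det_def by (simp add: poly_sum poly_prod)

lemma degree_of_int_mult: "degree (of_int k * (p :: complex poly)) \<le> degree p"
  using degree_mult_le[of "of_int k" p] by simp

lemma degree_prod_le_sum: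
  fixes f :: "'a \<Rightarrow> complex poly"
  assumes "finite A" "\<And>x. x \<in> A \<Longrightarrow> degree (f x) \<le> g x"
  shows "degree (prod f A) \<le> sum g A"
  using assms
proof (induction rule: finite_induct)
  case (insert x A)
  have "degree (f x * prod f A) \<le> degree (f x) + degree (prod f A)" by (rule degree_mult_le)
  also have "\<dots> \<le> g x + sum g A" using insert by (intro add_mono) auto
  finally show ?case using insert by simp
qed simp

definition char_mat :: "real^'n^'n \<Rightarrow> ('n::finite \<Rightarrow> real) \<Rightarrow> complex \<Rightarrow> complex poly^'n^'n" where
  "char_mat Q lam \<eta> = mat [:\<eta>, -1:] + diag (\<lambda>i. [:of_real (lam i):])
          - map_matrix (\<lambda>q. [:of_real q:]) (transpose Q)"

lemma poly_char_mat: "(\<chi> i j. poly (char_mat Q lam \<eta> $ i $ j) s) = transpose (Mmat Q lam (\<eta> - s))"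
  by (auto simp: vec_eq_iff char_mat_def Mmat_def mat_def diag_def Lam_def map_matrix_def transpose_def)

lemma det_poly_eval: "poly (det_poly Q lam \<eta>) s = det (transpose (Mmat Q lam (\<eta> - s)))"
  unfolding det_poly_def char_mat_def[symmetric] poly_det poly_char_mat ..

lemma degree_char_mat: "degree (char_mat Q lam \<eta> $ i $ j) \<le> 1"
proof -
  have "degree [:\<eta>, -1:] \<le> 1" by simp
  then show ?thesis by (auto simp: char_mat_def mat_def diag_def map_matrix_def intro!: degree_diff_le degree_add_le)
qed

text \<open>
The zeros are enumerated as a nonempty multiset, which excludes that the determinant is the
zero polynomial.
\<close>

lemma det_poly_factor:
  fixes Q :: "real^'n^'n::finite"
  assumes "enumerates_zeros Q lam \<eta> z"
  obtains c where "c \<noteq> 0" "\<And>s. det (transpose (Mmat Q lam (\<eta> - s))) = c * (\<Prod>j=1..CARD('n). (s - z j))"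
proof -
  let ?p = "det_poly Q lam \<eta>"
  have z: "proots ?p = image_mset z (mset_set {1..CARD('n)})" using assms by (simp add: enumerates_zeros_def)
  have p0: "?p \<noteq> 0"
  proof
    assume "?p = 0"
    then have "size (image_mset z (mset_set {1..CARD('n)})) = 0" using z by simp
    then show False by (simp add: Suc_le_eq)
  qed
  have "smult (lead_coeff ?p) (\<Prod>x\<in>#proots ?p. [:- x, 1:]) = ?p" by (rule complex_poly_decompose_multiset)
  also have "(\<Prod>x\<in>#proots ?p. [:- x, 1:]) = (\<Prod>j=1..CARD('n). [:- z j, 1:])"
    unfolding z by (simp add: prod_unfold_prod_mset image_mset.compositionality comp_def)
  finally have factor: "smult (lead_coeff ?p) (\<Prod>j=1..CARD('n). [:- z j, 1:]) = ?p" .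
  have "poly ?p s = lead_coeff ?p * (\<Prod>j=1..CARD('n). (s - z j))" for s
  proof -
    have "poly ?p s = poly (smult (lead_coeff ?p) (\<Prod>j=1..CARD('n). [:- z j, 1:])) s" unfolding factor ..
    then show ?thesis by (simp add: poly_prod)
  qed
  then show thesis using p0 by (intro that[of "lead_coeff ?p"]) (auto simp: det_poly_eval)
qed

text \<open>
In Cramer's rule one column of the matrix is replaced by the constants \<open>b\<close>, so at most
\<open>N - 1\<close> factors of each product in the determinant depend on \<open>s\<close>.
\<close>

lemma cramer_poly:
  fixes Q :: "real^'n^'n::finite" and b :: "complex^'n"
  obtains p :: "'n \<Rightarrow> complex poly" where "\<And>k. degree (p k) < CARD('n)"
    "\<And>s x. det (transpose (Mmat Q lam (\<eta> - s))) \<noteq> 0 \<Longrightarrow> transpose (Mmat Q lam (\<eta> - s)) *v x = b \<Longrightarrow>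
      x = (\<chi> k. poly (p k) s / det (transpose (Mmat Q lam (\<eta> - s))))"
proof -
  let ?B = "\<lambda>k. (\<chi> i j. if j = k then [:b $ i:] else char_mat Q lam \<eta> $ i $ j) :: complex poly^'n^'n"
  define p where "p k = det (?B k)" for k
  show thesis
  proof (rule that[of p])
    fix k
    have "degree (p k) \<le> CARD('n) - 1"
      unfolding p_def det_def
    proof (rule degree_sum_le[OF finite_permutations[OF finite]])
      fix \<pi> assume "\<pi> \<in> {\<pi>. \<pi> permutes (UNIV :: 'n set)}"
      then have perm: "\<pi> permutes (UNIV :: 'n set)" by simp
      have "degree (of_int (sign \<pi>) * (\<Prod>i\<in>UNIV. ?B k $ i $ \<pi> i)) \<le> degree (\<Prod>i\<in>UNIV. ?B k $ i $ \<pi> i)"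
        by (rule degree_of_int_mult)
      also have "\<dots> \<le> (\<Sum>i\<in>UNIV. if \<pi> i = k then 0 else 1)"
        by (rule degree_prod_le_sum) (auto intro: degree_char_mat[unfolded One_nat_def])
      also have "\<dots> = (\<Sum>i\<in>UNIV. if i = k then 0 else 1)"
        using sum.permute[OF perm, of "\<lambda>i. if i = k then 0 else 1 :: nat"] by (simp add: comp_def)
      also have "\<dots> = (\<Sum>i\<in>UNIV - {k}. 1)" by (rule sum.mono_neutral_cong_right) auto
      also have "\<dots> = CARD('n) - 1" by (simp add: card_Diff_singleton)
      finally show "degree (of_int (sign \<pi>) * (\<Prod>i\<in>UNIV. ?B k $ i $ \<pi> i)) \<le> CARD('n) - 1" .
    qed
    moreover have "0 < CARD('n)" by simp
    ultimately show "degree (p k) < CARD('n)" by linarith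
  next
    fix s and x :: "complex^'n"
    let ?A = "transpose (Mmat Q lam (\<eta> - s))"
    assume d: "det ?A \<noteq> 0" and "?A *v x = b"
    then have "x = (\<chi> k. det (\<chi> i j. if j = k then b $ i else ?A $ i $ j) / det ?A)"
      using cramer[OF d] by blast
    moreover have "poly (p k) s = det (\<chi> i j. if j = k then b $ i else ?A $ i $ j)" for k
    proof -
      have "?A $ i $ j = poly (char_mat Q lam \<eta> $ i $ j) s" for i j
        using arg_cong[OF poly_char_mat[of Q lam \<eta> s], of "\<lambda>A. A $ i $ j"] by simp
      then show ?thesis unfolding p_def poly_det
        by (intro arg_cong[of _ _ det]) (auto simp: vec_eq_iff)
    qed
    ultimately show "x = (\<chi> k. poly (p k) s / det ?A)" by simp
  qed
qed

lemma poly_shifted_sum: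
  fixes p :: "complex poly"
  assumes "degree p < N"
  shows "(\<Sum>l=1..N. s ^ l * coeff p (l - 1)) = s * poly p s"
proof -
  have "s * poly p s = s * (\<Sum>l\<le>degree p. coeff p l * s ^ l)" by (simp add: poly_altdef)
  also have "(\<Sum>l\<le>degree p. coeff p l * s ^ l) = (\<Sum>l<N. coeff p l * s ^ l)"
    by (rule sum.mono_neutral_left) (use assms in \<open>auto simp: coeff_eq_0 not_le\<close>)
  also have "s * \<dots> = (\<Sum>l<N. s ^ Suc l * coeff p l)" by (simp add: sum_distrib_left mult_ac)
  also have "\<dots> = (\<Sum>l=1..N. s ^ l * coeff p (l - 1))"
    by (rule sum.reindex_bij_witness[of _ "\<lambda>l. l - 1" Suc]) auto
  finally show ?thesis ..
qed

definition l1_norm :: "complex^'n \<Rightarrow> real" where "l1_norm x = (\<Sum>j\<in>UNIV. norm (x $ j))"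

lemma l1_norm_nonneg: "0 \<le> l1_norm x" by (simp add: l1_norm_def sum_nonneg)

lemma norm_le_l1: "norm x \<le> l1_norm x"
  unfolding l1_norm_def norm_vec_def by (rule L2_set_le_sum) simp

lemma l1_norm_mult: "l1_norm (A *v x) \<le> (\<Sum>i\<in>UNIV. \<Sum>j\<in>UNIV. norm (A $ i $ j)) * l1_norm x"
proof -
  have "norm ((A *v x) $ i) \<le> (\<Sum>j\<in>UNIV. norm (A $ i $ j)) * l1_norm x" for i
  proof -
    have "norm ((A *v x) $ i) \<le> (\<Sum>j\<in>UNIV. norm (A $ i $ j * x $ j))"
      unfolding matrix_vector_mult_def by (simp add: norm_sum)
    also have "\<dots> \<le> (\<Sum>j\<in>UNIV. norm (A $ i $ j) * l1_norm x)"
      unfolding norm_mult l1_norm_def by (intro sum_mono mult_left_mono member_le_sum) auto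
    finally show ?thesis by (simp add: sum_distrib_right)
  qed
  then show ?thesis unfolding l1_norm_def[of "A *v x"] sum_distrib_right by (intro sum_mono) (simp add: sum_distrib_right)
qed

lemma Kmat_mult:
  "Kmat Q lam B r s \<eta> *v x = r *s (Lam lam *v (matrix_inv (transpose (Mmat Q lam (\<eta> - s))) *v (Bstar B s *v x)))"
proof -
  have "mat r *v y = r *s y" for y :: "complex^'n"
    by (simp add: vec_eq_iff matrix_vector_mult_def mat_def if_distrib if_distribR cong: if_cong)
  then show ?thesis unfolding Kmat_def by (simp add: matrix_vector_mul_assoc[symmetric])
qed

lemma diag_mult: "(diag d *v x) $ i = d i * (x $ i :: complex)"
  by (simp add: matrix_vector_mult_def diag_def if_distrib if_distribR cong: if_cong)

lemma matrix_inv_solve: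
  fixes A :: "complex^'n^'n"
  assumes "det A \<noteq> 0"
  shows "A *v (matrix_inv A *v b) = b" "A *v x = b \<Longrightarrow> x = matrix_inv A *v b"
proof -
  have inv: "invertible A" using assms by (simp add: invertible_det_nz)
  then have AA: "A ** matrix_inv A = mat 1" "matrix_inv A ** A = mat 1"
    unfolding invertible_def matrix_inv_def by (metis (mono_tags, lifting) someI_ex)+
  show "A *v (matrix_inv A *v b) = b" by (simp add: matrix_vector_mul_assoc AA)
  show "x = matrix_inv A *v b" if "A *v x = b"
    unfolding that[symmetric] by (simp add: matrix_vector_mul_assoc AA)
qed

context queue
begin

lemma LST_le: "0 \<le> Re s \<Longrightarrow> norm (LST (B i) s) \<le> 1"
proof -
  assume s: "0 \<le> Re s"
  have rd: "real_distribution (B i)" and neg: "\<And>x. x < 0 \<Longrightarrow> cdf (B i) x = 0" using service[of i] by (auto simp: service_law_def)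
  have ps: "prob_space (B i)" using rd by (simp add: real_distribution_def)
  have fm: "finite_measure (B i)" using ps by (rule prob_space.finite_measure)
  have sets: "sets (B i) = sets borel" using rd by (simp add: real_distribution_def real_distribution_axioms_def)
  have "AE x in B i. \<forall>m::nat. \<not> x \<le> - inverse (real (Suc m))"
  proof (subst AE_all_countable, rule allI)
    fix m :: nat
    let ?c = "- inverse (real (Suc m))"
    have "measure (B i) {..?c} = 0" using neg[of ?c] by (simp add: cdf_def)
    then have "{..?c} \<in> null_sets (B i)"
      using sets by (auto simp: null_sets_def finite_measure.emeasure_eq_measure[OF fm])
    then have "AE x in B i. x \<notin> {..?c}" by (rule AE_not_in)
    then show "AE x in B i. \<not> x \<le> ?c" by simp
  qed
  then have pos: "AE x in B i. 0 \<le> x"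
  proof eventually_elim
    case (elim x)
    show ?case
    proof (rule ccontr)
      assume "\<not> 0 \<le> x"
      then obtain m :: nat where "inverse (real (Suc m)) < - x" using reals_Archimedean[of "- x"] by auto
      then show False using elim by (auto dest: spec[of _ m])
    qed
  qed
  have "norm (LST (B i) s) \<le> (LINT x|B i. norm (exp (- s * of_real x)))" unfolding LST_def by (rule integral_norm_bound)
  also have "\<dots> \<le> (LINT x|B i. 1)"
  proof (rule integral_mono_AE)
    have m: "(\<lambda>x. norm (exp (- s * of_real x))) \<in> borel_measurable (B i)"
      unfolding measurable_cong_sets[OF sets refl] by measurable
    have le: "AE x in B i. norm (exp (- s * of_real x)) \<le> 1" using pos by eventually_elim (use s in simp)
    show "integrable (B i) (\<lambda>x. norm (exp (- s * of_real x)))"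
      by (rule finite_measure.integrable_const_bound[OF fm _ m, of 1]) (use le in simp)
    show "integrable (B i) (\<lambda>x. 1 :: real)" using fm by (rule finite_measure.integrable_const)
    show "AE x in B i. norm (exp (- s * of_real x)) \<le> 1" by (rule le)
  qed
  also have "\<dots> = 1" using ps by (simp add: prob_space.prob_space)
  finally show ?thesis .
qed

text \<open>
Column \<open>j\<close> of the equation is bounded below by the reverse triangle inequality.  When these
bounds are summed over \<open>j\<close>, the terms with \<open>Q\<close> cancel because the rows of \<open>Q\<close> sum to 0, and
only \<open>lam j - Re s \<ge> (1 - Re s / lmin) lam j\<close> remains.
\<close>

lemma resolvent_contraction:
  assumes \<eta>: "0 \<le> Re \<eta>" and s: "0 \<le> Re s" and eq: "transpose (Mmat Q lam (\<eta> - s)) *v y = b"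
  shows "(1 - Re s / lmin) * l1_norm (Lam lam *v y) \<le> l1_norm b"
proof -
  have bj: "b $ j = (\<eta> - s + of_real (lam j) - of_real (Q $ j $ j)) * y $ j - (\<Sum>i\<in>UNIV - {j}. of_real (Q $ i $ j) * y $ i)" for j
  proof -
    have "b $ j = (\<Sum>i\<in>UNIV. Mmat Q lam (\<eta> - s) $ i $ j * y $ i)"
      unfolding eq[symmetric] by (simp add: matrix_vector_mult_def transpose_def)
    also have "\<dots> = Mmat Q lam (\<eta> - s) $ j $ j * y $ j + (\<Sum>i\<in>UNIV - {j}. Mmat Q lam (\<eta> - s) $ i $ j * y $ i)"
      by (rule sum.remove) auto
    also have "(\<Sum>i\<in>UNIV - {j}. Mmat Q lam (\<eta> - s) $ i $ j * y $ i) = - (\<Sum>i\<in>UNIV - {j}. of_real (Q $ i $ j) * y $ i)"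
      unfolding sum_negf[symmetric] by (rule sum.cong) (auto simp: Mmat_entry killed_gen_def)
    finally show ?thesis by (simp add: Mmat_entry killed_gen_def algebra_simps)
  qed
  have "(lam j - Re s) * norm (y $ j) - (\<Sum>i\<in>UNIV. Q $ i $ j * norm (y $ i)) \<le> norm (b $ j)" for j
  proof -
    have "lam j - Re s - Q $ j $ j \<le> Re (\<eta> - s + of_real (lam j) - of_real (Q $ j $ j))" using \<eta> by simp
    also have "\<dots> \<le> norm (\<eta> - s + of_real (lam j) - of_real (Q $ j $ j))" by (rule complex_Re_le_cmod)
    finally have "(lam j - Re s - Q $ j $ j) * norm (y $ j) \<le> norm ((\<eta> - s + of_real (lam j) - of_real (Q $ j $ j)) * y $ j)"
      unfolding norm_mult by (rule mult_right_mono) simp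
    moreover have "norm (\<Sum>i\<in>UNIV - {j}. of_real (Q $ i $ j) * y $ i) \<le> (\<Sum>i\<in>UNIV - {j}. Q $ i $ j * norm (y $ i))"
      by (rule order_trans[OF norm_sum]) (auto simp: norm_mult Q_offdiag intro!: sum_mono)
    moreover have "norm ((\<eta> - s + of_real (lam j) - of_real (Q $ j $ j)) * y $ j) - norm (\<Sum>i\<in>UNIV - {j}. of_real (Q $ i $ j) * y $ i) \<le> norm (b $ j)"
      unfolding bj by (rule norm_triangle_ineq2)
    moreover have "(\<Sum>i\<in>UNIV. Q $ i $ j * norm (y $ i)) = Q $ j $ j * norm (y $ j) + (\<Sum>i\<in>UNIV - {j}. Q $ i $ j * norm (y $ i))"
      by (rule sum.remove) auto
    ultimately show ?thesis by (simp add: left_diff_distrib)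
  qed
  then have "(\<Sum>j\<in>UNIV. (lam j - Re s) * norm (y $ j) - (\<Sum>i\<in>UNIV. Q $ i $ j * norm (y $ i))) \<le> l1_norm b"
    unfolding l1_norm_def by (intro sum_mono)
  moreover have "(\<Sum>j\<in>UNIV. \<Sum>i\<in>UNIV. Q $ i $ j * norm (y $ i)) = 0"
    by (subst sum.swap) (simp add: Q_row flip: sum_distrib_right)
  ultimately have 1: "(\<Sum>j\<in>UNIV. (lam j - Re s) * norm (y $ j)) \<le> l1_norm b" by (simp add: sum_subtractf)
  have "(1 - Re s / lmin) * l1_norm (Lam lam *v y) \<le> (\<Sum>j\<in>UNIV. (lam j - Re s) * norm (y $ j))"
    unfolding l1_norm_def sum_distrib_left
  proof (rule sum_mono)
    fix j
    have "Re s * 1 \<le> Re s * (lam j / lmin)" using s lmin_le[of j] lmin_pos by (intro mult_left_mono) auto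
    then have "(1 - Re s / lmin) * lam j \<le> lam j - Re s" by (simp add: algebra_simps)
    then have "(1 - Re s / lmin) * lam j * norm (y $ j) \<le> (lam j - Re s) * norm (y $ j)" by (intro mult_right_mono) auto
    then show "(1 - Re s / lmin) * norm ((Lam lam *v y) $ j) \<le> (lam j - Re s) * norm (y $ j)"
      using lam_pos[of j] by (simp add: Lam_def diag_mult norm_mult mult.assoc)
  qed
  then show ?thesis using 1 by linarith
qed

section \<open>The transform vector\<close>

lemma workload_nonneg: "0 \<le> w \<Longrightarrow> 0 \<le> workload a w T S (Suc m) \<omega>"
  by (cases m) auto

lemma pre_transform_le:
  assumes "0 \<le> w" "0 \<le> Re s" "0 \<le> Re \<eta>"
  shows "norm (pre_transform a w (Suc m) s \<eta> j) \<le> 1"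
  unfolding pre_transform_def
proof (rule norm_expectation_le)
  have [measurable]: "workload a w T S (Suc m) \<in> borel_measurable M"
    by (intro workload_measurable) (auto intro!: T_meas S_meas)
  have [measurable]: "T (Suc m) \<in> borel_measurable M" "Y (Suc m) \<in> measurable M (count_space UNIV)" by (auto intro: T_meas Y_meas)
  show "(\<lambda>\<omega>. exp (- s * of_real (workload a w T S (Suc m) \<omega>) - \<eta> * of_real (T (Suc m) \<omega>)) * of_bool (Y (Suc m) \<omega> = j)) \<in> borel_measurable M"
    by measurable
  fix \<omega> assume w: "\<omega> \<in> space M"
  have "0 \<le> Re s * workload a w T S (Suc m) \<omega>" "0 \<le> Re \<eta> * T (Suc m) \<omega>"
    using assms workload_nonneg[OF assms(1)] T_nonneg[OF w, of "Suc m"] by (auto simp del: workload.simps)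
  then show "norm (exp (- s * of_real (workload a w T S (Suc m) \<omega>) - \<eta> * of_real (T (Suc m) \<omega>)) * of_bool (Y (Suc m) \<omega> = j)) \<le> 1"
    by (simp add: norm_mult norm_of_bool_eq of_bool_def del: workload.simps)
qed

lemma pre_transform_first: "pre_transform a w (Suc 0) s \<eta> j = exp (- s * of_real w) * initial_vec M X $ j"
proof -
  have "pre_transform a w (Suc 0) s \<eta> j = (LINT \<omega>|M. exp (- s * of_real w) * of_real (of_bool (X 0 \<omega> = j)))"
    unfolding pre_transform_def by (rule Bochner_Integration.integral_cong) (auto simp: T_one arrival_state_def)
  also have "\<dots> = exp (- s * of_real w) * of_real (LINT \<omega>|M. of_bool (X 0 \<omega> = j))"
    by (simp only: integral_mult_right_zero integral_complex_of_real)
  also have "(LINT \<omega>|M. of_bool (X 0 \<omega> = j)) = pX 0 j" by (rule pX_eq) simp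
  finally show ?thesis by (simp add: initial_vec_def)
qed

text \<open>
The workload \<open>W\<close> is a function of the arrivals and the earlier services, so \<open>service_transform\<close>
separates the new service.  Services are nonnegative only almost surely.
\<close>

lemma post_transform_eq:
  assumes a: "0 \<le> a" and w: "0 \<le> w" and s: "0 \<le> Re s" and \<eta>: "0 \<le> Re \<eta>"
  shows "post_transform a w (Suc m) s \<eta> j = LST (B j) s * pre_transform a w (Suc m) (of_real a * s) \<eta> j"
proof -
  let ?W = "workload a w T S (Suc m)"
  let ?f = "\<lambda>\<omega>. exp (- (of_real a * s) * of_real (?W \<omega>) - \<eta> * of_real (T (Suc m) \<omega>)) :: complex"
  have W0: "0 \<le> ?W \<omega>" for \<omega> using workload_nonneg[OF w] .
  have [measurable]: "T (Suc m) \<in> borel_measurable (with_services m BA)"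
    using subalgebra_with_services_base[OF subalgebra_BA] T_BA[of "Suc m"] by (auto intro: measurable_from_subalg)
  have [measurable]: "?W \<in> borel_measurable (with_services m BA)"
  proof (rule workload_measurable)
    show "T k \<in> borel_measurable (with_services m BA)" if "k \<in> {1..Suc m}" for k
      using subalgebra_with_services_base[OF subalgebra_BA] T_BA[of k] that by (auto intro: measurable_from_subalg)
    show "S k \<in> borel_measurable (with_services m BA)" if "k \<in> {1..<Suc m}" for k
      using that by (intro S_with_services[OF subalgebra_BA]) auto
  qed simp
  have [measurable]: "Y (Suc m) \<in> measurable M (count_space UNIV)" "S (Suc m) \<in> borel_measurable M" "T (Suc m) \<in> borel_measurable M"
    by (auto intro: Y_meas S_meas T_meas)
  have [measurable]: "?W \<in> borel_measurable M" by (intro workload_measurable) (auto intro!: T_meas S_meas)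
  have f: "?f \<in> borel_measurable (with_services m BA)" by measurable
  have fb: "norm (?f \<omega>) \<le> 1" if "\<omega> \<in> space M" for \<omega>
  proof -
    have "0 \<le> a * Re s * ?W \<omega>" "0 \<le> Re \<eta> * T (Suc m) \<omega>"
      using a s \<eta> W0[of \<omega>] T_nonneg[OF that, of "Suc m"] by (auto simp del: workload.simps)
    then show ?thesis by (simp del: workload.simps)
  qed
  have "post_transform a w (Suc m) s \<eta> j = (LINT \<omega>|M. ?f \<omega> * of_bool (Y (Suc m) \<omega> = j) * exp (- s * of_real (S (Suc m) \<omega>)))"
    unfolding post_transform_def
  proof (rule integral_cong_AE)
    show "(\<lambda>\<omega>. drift (empty_at a w (Suc m) \<omega>) s \<eta> (T (Suc m) \<omega>) * of_bool (Y (Suc m) \<omega> = j)) \<in> borel_measurable M"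
      unfolding drift_def empty_at_def by measurable
    show "(\<lambda>\<omega>. ?f \<omega> * of_bool (Y (Suc m) \<omega> = j) * exp (- s * of_real (S (Suc m) \<omega>))) \<in> borel_measurable M" by measurable
    show "AE \<omega> in M. drift (empty_at a w (Suc m) \<omega>) s \<eta> (T (Suc m) \<omega>) * of_bool (Y (Suc m) \<omega> = j)
        = ?f \<omega> * of_bool (Y (Suc m) \<omega> = j) * exp (- s * of_real (S (Suc m) \<omega>))"
      using S_nonneg[of m]
    proof eventually_elim
      case (elim \<omega>)
      have "0 \<le> a * ?W \<omega> + S (Suc m) \<omega>" using elim a W0[of \<omega>] by (intro add_nonneg_nonneg mult_nonneg_nonneg)
      then have "drift (empty_at a w (Suc m) \<omega>) s \<eta> (T (Suc m) \<omega>) = exp (- s * of_real (a * ?W \<omega> + S (Suc m) \<omega>) - \<eta> * of_real (T (Suc m) \<omega>))"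
        unfolding drift_def empty_at_def by (simp add: max_absorb2 del: workload.simps)
      also have "\<dots> = ?f \<omega> * exp (- s * of_real (S (Suc m) \<omega>))"
        unfolding exp_add[symmetric] by (rule arg_cong[of _ _ exp]) (simp add: algebra_simps del: workload.simps)
      finally show ?case by (simp only: mult_ac)
    qed
  qed
  also have "\<dots> = LST (B j) s * (LINT \<omega>|M. ?f \<omega> * of_bool (Y (Suc m) \<omega> = j))"
    by (rule service_transform[OF f fb s])
  finally show ?thesis by (simp only: pre_transform_def)
qed

lemma Zvec_nth: "Zvec M X T S a w r s \<eta> $ j = (\<Sum>m. r ^ Suc m * pre_transform a w (Suc m) s \<eta> j)"
  unfolding Zvec_def pre_transform_def by (simp add: indicator_def[abs_def] of_bool_def)

context
  fixes a w :: real and r \<eta> :: complex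
  assumes a: "0 < a" "a < 1" and w: "0 \<le> w" and r: "norm r < 1" and \<eta>: "0 \<le> Re \<eta>"
begin

lemma Zvec_sums:
  assumes "0 \<le> Re s"
  shows "(\<lambda>m. r ^ Suc m * pre_transform a w (Suc m) s \<eta> j) sums (Zvec M X T S a w r s \<eta> $ j)"
proof -
  have "summable (\<lambda>m. r ^ Suc m * pre_transform a w (Suc m) s \<eta> j)"
  proof (rule summable_comparison_test')
    show "summable (\<lambda>m. norm r ^ Suc m)" using r by (simp add: summable_mult summable_geometric)
    show "norm (r ^ Suc m * pre_transform a w (Suc m) s \<eta> j) \<le> norm r ^ Suc m" if "0 \<le> m" for m
      using mult_left_mono[OF pre_transform_le[OF w assms \<eta>], of "norm r ^ Suc m"] by (simp add: norm_mult norm_power)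
  qed
  then show ?thesis unfolding Zvec_nth by (rule summable_sums)
qed

lemma Zvec_bounded:
  obtains R where "\<And>s. 0 \<le> Re s \<Longrightarrow> l1_norm (Zvec M X T S a w r s \<eta>) \<le> R"
proof (rule that)
  fix s assume s: "0 \<le> Re s"
  have sm: "summable (\<lambda>m. norm r ^ Suc m)" using r by (simp add: summable_mult summable_geometric)
  have "norm (Zvec M X T S a w r s \<eta> $ j) \<le> (\<Sum>m. norm r ^ Suc m)" for j
    unfolding Zvec_nth
    by (rule norm_suminf_le[OF _ sm])
       (use mult_left_mono[OF pre_transform_le[OF w s \<eta>]] in \<open>simp add: norm_mult norm_power mult_left_le\<close>)
  then show "l1_norm (Zvec M X T S a w r s \<eta>) \<le> (\<Sum>j\<in>(UNIV :: 'n set). \<Sum>m. norm r ^ Suc m)"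
    unfolding l1_norm_def by (intro sum_mono)
qed

text \<open>
The balance of all customers, summed with the weights \<open>r ^ (n + 1)\<close>.  Convergence of the series
of the idle terms follows from that of the other two series at \<open>s = 1\<close>.
\<close>

lemma Zvec_balance:
  obtains \<kappa> :: "complex^'n" where "\<And>s. 0 \<le> Re s \<Longrightarrow>
    transpose (Mmat Q lam (\<eta> - s)) *v
        (\<chi> i. (Zvec M X T S a w r s \<eta> $ i - r * exp (- s * of_real w) * initial_vec M X $ i) / of_real (lam i))
      = r *s (Bstar B s *v Zvec M X T S a w r (of_real a * s) \<eta>) - s *s \<kappa>"
proof -
  have "\<forall>m. \<exists>\<kappa>. \<forall>s j. 0 \<le> Re s \<longrightarrow>
    (\<Sum>i\<in>UNIV. pre_transform a w (Suc (Suc m)) s \<eta> i / of_real (lam i) * Mmat Q lam (\<eta> - s) $ i $ j) = post_transform a w (Suc m) s \<eta> j - s * \<kappa> j"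
    using balance[OF _ \<eta>] by simp
  from choice[OF this] obtain k where k: "\<And>m s j. 0 \<le> Re s \<Longrightarrow>
    (\<Sum>i\<in>UNIV. pre_transform a w (Suc (Suc m)) s \<eta> i / of_real (lam i) * Mmat Q lam (\<eta> - s) $ i $ j) = post_transform a w (Suc m) s \<eta> j - s * k m j"
    by blast
  have tail: "(\<lambda>m. r ^ Suc (Suc m) * pre_transform a w (Suc (Suc m)) s \<eta> i) sums (Zvec M X T S a w r s \<eta> $ i - r * exp (- s * of_real w) * initial_vec M X $ i)"
    if s: "0 \<le> Re s" for s i
  proof -
    have "(\<lambda>m. r ^ Suc (Suc m) * pre_transform a w (Suc (Suc m)) s \<eta> i) sums (Zvec M X T S a w r s \<eta> $ i - r ^ Suc 0 * pre_transform a w (Suc 0) s \<eta> i)"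
      using Zvec_sums[OF s, of i] by (subst sums_Suc_iff) simp
    then show ?thesis by (simp add: pre_transform_first mult.assoc)
  qed
  let ?v = "\<lambda>s. (\<chi> i. (Zvec M X T S a w r s \<eta> $ i - r * exp (- s * of_real w) * initial_vec M X $ i) / of_real (lam i)) :: complex^'n"
  have lhs: "(\<lambda>m. r ^ Suc (Suc m) * (post_transform a w (Suc m) s \<eta> j - s * k m j)) sums ((transpose (Mmat Q lam (\<eta> - s)) *v ?v s) $ j)"
    if s: "0 \<le> Re s" for s j
  proof -
    have "(\<lambda>m. \<Sum>i\<in>UNIV. r ^ Suc (Suc m) * pre_transform a w (Suc (Suc m)) s \<eta> i / of_real (lam i) * Mmat Q lam (\<eta> - s) $ i $ j)
       sums (\<Sum>i\<in>UNIV. ?v s $ i * Mmat Q lam (\<eta> - s) $ i $ j)"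
      unfolding vec_lambda_beta by (intro sums_sum sums_mult2 sums_divide tail s)
    also have "(\<lambda>m. \<Sum>i\<in>UNIV. r ^ Suc (Suc m) * pre_transform a w (Suc (Suc m)) s \<eta> i / of_real (lam i) * Mmat Q lam (\<eta> - s) $ i $ j)
        = (\<lambda>m. r ^ Suc (Suc m) * (post_transform a w (Suc m) s \<eta> j - s * k m j))"
      unfolding k[OF s, symmetric] sum_distrib_left by (simp add: mult.assoc)
    also have "(\<Sum>i\<in>UNIV. ?v s $ i * Mmat Q lam (\<eta> - s) $ i $ j) = (transpose (Mmat Q lam (\<eta> - s)) *v ?v s) $ j"
      by (simp add: matrix_vector_mult_def transpose_def mult.commute)
    finally show ?thesis .
  qed
  have us: "(\<lambda>m. r ^ Suc (Suc m) * post_transform a w (Suc m) s \<eta> j) sums ((r *s (Bstar B s *v Zvec M X T S a w r (of_real a * s) \<eta>)) $ j)"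
    if s: "0 \<le> Re s" for s j
  proof -
    have as: "0 \<le> Re (of_real a * s)" using s a by simp
    have "(\<lambda>m. r * LST (B j) s * (r ^ Suc m * pre_transform a w (Suc m) (of_real a * s) \<eta> j)) sums (r * LST (B j) s * Zvec M X T S a w r (of_real a * s) \<eta> $ j)"
      by (intro sums_mult Zvec_sums[OF as])
    moreover have "(\<lambda>m. r * LST (B j) s * (r ^ Suc m * pre_transform a w (Suc m) (of_real a * s) \<eta> j)) = (\<lambda>m. r ^ Suc (Suc m) * post_transform a w (Suc m) s \<eta> j)"
      using a by (simp add: post_transform_eq[OF _ w s \<eta>] mult_ac)
    ultimately show ?thesis by (simp add: Bstar_def diag_mult mult.assoc)
  qed
  \<comment> \<open>The limit of the series of idle terms, read off at \<open>s = 1\<close>.\<close>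
  define \<kappa> where "\<kappa> = (\<chi> j. (r *s (Bstar B 1 *v Zvec M X T S a w r (of_real a * 1) \<eta>)) $ j - (transpose (Mmat Q lam (\<eta> - 1)) *v ?v 1) $ j)"
  have kap: "(\<lambda>m. r ^ Suc (Suc m) * k m j) sums (\<kappa> $ j)" for j
    using sums_diff[OF us[of 1 j] lhs[of 1 j]] by (simp add: \<kappa>_def algebra_simps)
  show thesis
  proof (rule that[of \<kappa>], subst vec_eq_iff, rule allI)
    fix s j assume s: "0 \<le> Re (s::complex)"
    have "(\<lambda>m. r ^ Suc (Suc m) * post_transform a w (Suc m) s \<eta> j - s * (r ^ Suc (Suc m) * k m j))
        sums ((r *s (Bstar B s *v Zvec M X T S a w r (of_real a * s) \<eta>)) $ j - s * \<kappa> $ j)"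
      by (intro sums_diff us[OF s] sums_mult kap)
    moreover have "(\<lambda>m. r ^ Suc (Suc m) * post_transform a w (Suc m) s \<eta> j - s * (r ^ Suc (Suc m) * k m j))
        = (\<lambda>m. r ^ Suc (Suc m) * (post_transform a w (Suc m) s \<eta> j - s * k m j))"
      by (auto simp: algebra_simps)
    ultimately show "(transpose (Mmat Q lam (\<eta> - s)) *v ?v s) $ j
        = (r *s (Bstar B s *v Zvec M X T S a w r (of_real a * s) \<eta>) - s *s \<kappa>) $ j"
      using sums_unique2[OF lhs[OF s, of j]] by simp
  qed
qed

lemma functional_equation:
  assumes z: "enumerates_zeros Q lam \<eta> z"
  obtains C where "\<And>s. 0 \<le> Re s \<Longrightarrow> s \<notin> z ` {1..CARD('n)} \<Longrightarrow>
    Zvec M X T S a w r s \<eta> = Kmat Q lam B r s \<eta> *v Zvec M X T S a w r (of_real a * s) \<eta>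
      + Lvec (initial_vec M X) z C w r s"
proof -
  obtain \<kappa> :: "complex^'n" where \<kappa>: "\<And>s. 0 \<le> Re s \<Longrightarrow>
    transpose (Mmat Q lam (\<eta> - s)) *v
        (\<chi> i. (Zvec M X T S a w r s \<eta> $ i - r * exp (- s * of_real w) * initial_vec M X $ i) / of_real (lam i))
      = r *s (Bstar B s *v Zvec M X T S a w r (of_real a * s) \<eta>) - s *s \<kappa>" using Zvec_balance by blast
  obtain c where c: "c \<noteq> 0" "\<And>s. det (transpose (Mmat Q lam (\<eta> - s))) = c * (\<Prod>j=1..CARD('n). (s - z j))"
    using det_poly_factor[OF z] by blast
  obtain p where p: "\<And>k. degree (p k) < CARD('n)"
    "\<And>s x. det (transpose (Mmat Q lam (\<eta> - s))) \<noteq> 0 \<Longrightarrow> transpose (Mmat Q lam (\<eta> - s)) *v x = \<kappa> \<Longrightarrow>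
      x = (\<chi> k. poly (p k) s / det (transpose (Mmat Q lam (\<eta> - s))))"
    by (rule cramer_poly[of Q lam \<eta> \<kappa>]) blast
  \<comment> \<open>The shift of the index comes from the factor \<open>s\<close> in front of the idle term.\<close>
  define C :: "nat \<Rightarrow> complex^'n" where "C l = (\<chi> k. - of_real (lam k) * coeff (p k) (l - 1) / c)" for l
  show thesis
  proof (rule that[of C])
    fix s assume s: "0 \<le> Re s" and sz: "s \<notin> z ` {1..CARD('n)}"
    let ?A = "transpose (Mmat Q lam (\<eta> - s))"
    let ?\<Pi> = "\<Prod>j=1..CARD('n). (s - z j)"
    let ?Z = "Zvec M X T S a w r s \<eta>" and ?Za = "Zvec M X T S a w r (of_real a * s) \<eta>"
    have \<Pi>: "?\<Pi> \<noteq> 0" using sz by auto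
    have d: "det ?A \<noteq> 0" unfolding c using c(1) \<Pi> by simp
    let ?v = "(\<chi> i. (?Z $ i - r * exp (- s * of_real w) * initial_vec M X $ i) / of_real (lam i)) :: complex^'n"
    have "?v = matrix_inv ?A *v (r *s (Bstar B s *v ?Za) - s *s \<kappa>)"
      by (rule matrix_inv_solve(2)[OF d \<kappa>[OF s]])
    then have v: "?v = r *s (matrix_inv ?A *v (Bstar B s *v ?Za)) - s *s (matrix_inv ?A *v \<kappa>)"
      by (simp add: matrix_vector_mult_diff_distrib vector_scalar_commute)
    have inv\<kappa>: "(matrix_inv ?A *v \<kappa>) $ k = poly (p k) s / (c * ?\<Pi>)" for k
    proof -
      have "matrix_inv ?A *v \<kappa> = (\<chi> k. poly (p k) s / det ?A)"
        by (rule p(2)[OF d matrix_inv_solve(1)[OF d]])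
      then show ?thesis unfolding c by simp
    qed
    have L: "Lvec (initial_vec M X) z C w r s $ k
       = r * exp (- s * of_real w) * initial_vec M X $ k - of_real (lam k) * (s * (matrix_inv ?A *v \<kappa>) $ k)" for k
    proof -
      have "(\<Sum>l=1..CARD('n). s ^ l *s C l) $ k = (\<Sum>l=1..CARD('n). - of_real (lam k) / c * (s ^ l * coeff (p k) (l - 1)))"
        by (simp add: C_def mult_ac)
      also have "\<dots> = - of_real (lam k) / c * (s * poly (p k) s)"
        unfolding sum_distrib_left[symmetric] poly_shifted_sum[OF p(1)] ..
      finally have "1 / ?\<Pi> * (\<Sum>l=1..CARD('n). s ^ l *s C l) $ k = - (of_real (lam k) * (s * (matrix_inv ?A *v \<kappa>) $ k))"
        unfolding inv\<kappa> by (simp add: mult_ac)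
      then show ?thesis unfolding Lvec_def by simp
    qed
    show "?Z = Kmat Q lam B r s \<eta> *v ?Za + Lvec (initial_vec M X) z C w r s"
    proof (subst vec_eq_iff, rule allI)
      fix k
      have "(?Z $ k - r * exp (- s * of_real w) * initial_vec M X $ k) / of_real (lam k)
         = r * (matrix_inv ?A *v (Bstar B s *v ?Za)) $ k - s * (matrix_inv ?A *v \<kappa>) $ k"
        using arg_cong[OF v, of "\<lambda>x. x $ k"] by simp
      then have "?Z $ k = r * exp (- s * of_real w) * initial_vec M X $ k
         + of_real (lam k) * (r * (matrix_inv ?A *v (Bstar B s *v ?Za)) $ k - s * (matrix_inv ?A *v \<kappa>) $ k)"
        using lam_pos[of k] by (simp add: field_simps)
      moreover have "(Kmat Q lam B r s \<eta> *v ?Za) $ k = r * (of_real (lam k) * (matrix_inv ?A *v (Bstar B s *v ?Za)) $ k)"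
        unfolding Kmat_mult by (simp add: Lam_def diag_mult)
      ultimately show "?Z $ k = (Kmat Q lam B r s \<eta> *v ?Za + Lvec (initial_vec M X) z C w r s) $ k"
        by (simp add: L algebra_simps)
    qed
  qed
qed

lemma Kmat_contraction:
  assumes z: "enumerates_zeros Q lam \<eta> z" and s: "0 \<le> Re s" "Re s < lmin" and sz: "s \<notin> z ` {1..CARD('n)}"
  shows "l1_norm (Kmat Q lam B r s \<eta> *v x) \<le> norm r / (1 - Re s / lmin) * l1_norm x"
proof -
  let ?A = "transpose (Mmat Q lam (\<eta> - s))"
  obtain c where c: "c \<noteq> 0" "\<And>s. det (transpose (Mmat Q lam (\<eta> - s))) = c * (\<Prod>j=1..CARD('n). (s - z j))"
    using det_poly_factor[OF z] by blast
  have d: "det ?A \<noteq> 0" unfolding c using c(1) sz by auto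
  have pos: "0 < 1 - Re s / lmin" using s lmin_pos by simp
  let ?b = "Bstar B s *v x"
  have "l1_norm ?b \<le> l1_norm x"
    unfolding l1_norm_def Bstar_def diag_mult norm_mult
    by (intro sum_mono) (use LST_le[OF s(1)] in \<open>auto intro: mult_left_le_one_le\<close>)
  moreover have "(1 - Re s / lmin) * l1_norm (Lam lam *v (matrix_inv ?A *v ?b)) \<le> l1_norm ?b"
    by (rule resolvent_contraction[OF \<eta> s(1) matrix_inv_solve(1)[OF d]])
  ultimately have "l1_norm (Lam lam *v (matrix_inv ?A *v ?b)) \<le> l1_norm x / (1 - Re s / lmin)"
    using pos by (simp add: pos_le_divide_eq mult.commute)
  then have "norm r * l1_norm (Lam lam *v (matrix_inv ?A *v ?b)) \<le> norm r * (l1_norm x / (1 - Re s / lmin))"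
    by (intro mult_left_mono) auto
  moreover have "l1_norm (Kmat Q lam B r s \<eta> *v x) = norm r * l1_norm (Lam lam *v (matrix_inv ?A *v ?b))"
    unfolding Kmat_mult by (simp add: l1_norm_def norm_mult sum_distrib_left)
  ultimately show ?thesis by simp
qed

text \<open>
After finitely many steps all factors contract the \<open>l\<^sup>1\<close> norm by a common \<open>\<rho> < 1\<close>, so the
remainder tends to 0 geometrically; the first factors only contribute a constant.
\<close>

lemma iterated_solution:
  fixes L :: "complex \<Rightarrow> complex^'n" and s0 :: complex
  assumes z: "enumerates_zeros Q lam \<eta> z" and s0: "0 \<le> Re s0"
    and sz: "\<And>n. of_real a ^ n * s0 \<notin> z ` {1..CARD('n)}"
    and eq: "\<And>s. 0 \<le> Re s \<Longrightarrow> s \<notin> z ` {1..CARD('n)} \<Longrightarrow>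
      Zvec M X T S a w r s \<eta> = Kmat Q lam B r s \<eta> *v Zvec M X T S a w r (of_real a * s) \<eta> + L s"
  shows "(\<lambda>n. ordered_prod (\<lambda>m. Kmat Q lam B r (of_real a ^ m * s0) \<eta>) n *v L (of_real a ^ n * s0))
     sums Zvec M X T S a w r s0 \<eta>"
proof -
  let ?s = "\<lambda>n. of_real a ^ n * s0" and ?Z = "\<lambda>s. Zvec M X T S a w r s \<eta>"
  let ?K = "\<lambda>m. Kmat Q lam B r (?s m) \<eta>"
  let ?P = "ordered_prod ?K"
  have Re_s: "Re (?s n) = a ^ n * Re s0" for n
    by (simp flip: of_real_power)
  have s_nn: "0 \<le> Re (?s n)" for n unfolding Re_s using a s0 by simp
  have Z_step: "?Z (?s n) = ?K n *v ?Z (?s (Suc n)) + L (?s n)" for n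
    using eq[OF s_nn sz, of n] by (simp add: mult.assoc)
  have partial: "?Z s0 = (\<Sum>k<n. ?P k *v L (?s k)) + ?P n *v ?Z (?s n)" for n
  proof (induction n)
    case (Suc n)
    have "?P n *v ?Z (?s n) = ?P (Suc n) *v ?Z (?s (Suc n)) + ?P n *v L (?s n)"
      unfolding Z_step[of n] matrix_vector_right_distrib by (simp add: matrix_vector_mul_assoc)
    then show ?case using Suc by simp
  qed simp
  obtain R where R: "\<And>s. 0 \<le> Re s \<Longrightarrow> l1_norm (?Z s) \<le> R" using Zvec_bounded by blast
  define \<rho> where "\<rho> = (norm r + 1) / 2"
  have \<rho>: "norm r < \<rho>" "\<rho> < 1" "0 < \<rho>" using r by (auto simp: \<rho>_def intro: add_nonneg_pos)
  have a0: "(\<lambda>n. a ^ n * Re s0) \<longlonglongrightarrow> 0 * Re s0"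
    using a by (intro tendsto_mult LIMSEQ_realpow_zero tendsto_const) auto
  then have a0': "(\<lambda>n. a ^ n * Re s0) \<longlonglongrightarrow> 0" by simp
  have "(\<lambda>n. norm r / (1 - a ^ n * Re s0 / lmin)) \<longlonglongrightarrow> norm r / (1 - 0 / lmin)"
    using lmin_pos by (intro tendsto_intros a0') auto
  then have "\<forall>\<^sub>F n in sequentially. norm r / (1 - a ^ n * Re s0 / lmin) < \<rho>"
    using \<rho> by (intro order_tendstoD(2)) auto
  with order_tendstoD(2)[OF a0' lmin_pos]
  have "\<forall>\<^sub>F n in sequentially. a ^ n * Re s0 < lmin \<and> norm r / (1 - a ^ n * Re s0 / lmin) < \<rho>"
    by eventually_elim simp
  then obtain m0 where m0: "\<And>n. m0 \<le> n \<Longrightarrow> a ^ n * Re s0 < lmin \<and> norm r / (1 - a ^ n * Re s0 / lmin) < \<rho>"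
    by (auto simp: eventually_sequentially)
  have contr: "l1_norm (?K n *v x) \<le> \<rho> * l1_norm x" if "m0 \<le> n" for n x
  proof -
    have "l1_norm (?K n *v x) \<le> norm r / (1 - Re (?s n) / lmin) * l1_norm x"
      using m0[OF that] by (intro Kmat_contraction[OF z s_nn _ sz]) (simp add: Re_s)
    also have "\<dots> \<le> \<rho> * l1_norm x" using m0[OF that] unfolding Re_s by (intro mult_right_mono l1_norm_nonneg) auto
    finally show ?thesis .
  qed
  define D where "D = (\<Sum>i\<in>UNIV. \<Sum>j\<in>UNIV. norm (?P m0 $ i $ j))"
  have D0: "0 \<le> D" unfolding D_def by (intro sum_nonneg) auto
  have geo: "l1_norm (?P (m0 + k) *v x) \<le> D * \<rho> ^ k * l1_norm x" for k x
  proof (induction k arbitrary: x)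
    case 0 then show ?case unfolding D_def using l1_norm_mult[of "?P m0" x] by simp
  next
    case (Suc k)
    have "l1_norm (?P (m0 + Suc k) *v x) = l1_norm (?P (m0 + k) *v (?K (m0 + k) *v x))"
      by (simp add: matrix_vector_mul_assoc)
    also have "\<dots> \<le> D * \<rho> ^ k * l1_norm (?K (m0 + k) *v x)" by (rule Suc)
    also have "\<dots> \<le> D * \<rho> ^ k * (\<rho> * l1_norm x)" using D0 \<rho> by (intro mult_left_mono contr) auto
    finally show ?case by (simp add: mult_ac)
  qed
  have "(\<lambda>k. ?P (k + m0) *v ?Z (?s (k + m0))) \<longlonglongrightarrow> 0"
  proof (rule tendsto_norm_zero_cancel, rule tendsto_sandwich[of "\<lambda>_. 0" _ _ "\<lambda>k. D * \<rho> ^ k * R"])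
    show "\<forall>\<^sub>F k in sequentially. norm (?P (k + m0) *v ?Z (?s (k + m0))) \<le> D * \<rho> ^ k * R"
    proof (intro always_eventually allI)
      fix k
      have "norm (?P (k + m0) *v ?Z (?s (k + m0))) \<le> D * \<rho> ^ k * l1_norm (?Z (?s (k + m0)))"
        using order_trans[OF norm_le_l1 geo[of k "?Z (?s (k + m0))"]] by (simp add: add.commute)
      also have "\<dots> \<le> D * \<rho> ^ k * R" using D0 \<rho> by (intro mult_left_mono R s_nn) auto
      finally show "norm (?P (k + m0) *v ?Z (?s (k + m0))) \<le> D * \<rho> ^ k * R" .
    qed
    have "(\<lambda>k. D * \<rho> ^ k * R) \<longlonglongrightarrow> D * 0 * R" using \<rho> by (intro tendsto_intros LIMSEQ_realpow_zero) auto
    then show "(\<lambda>k. D * \<rho> ^ k * R) \<longlonglongrightarrow> 0" by simp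
  qed auto
  then have rest: "(\<lambda>n. ?P n *v ?Z (?s n)) \<longlonglongrightarrow> 0" by (rule LIMSEQ_offset)
  have "(\<lambda>n. ?Z s0 - ?P n *v ?Z (?s n)) \<longlonglongrightarrow> ?Z s0 - 0" by (intro tendsto_diff tendsto_const rest)
  moreover have "?Z s0 - ?P n *v ?Z (?s n) = (\<Sum>k<n. ?P k *v L (?s k))" for n
    using partial[of n] by simp
  ultimately show ?thesis by (simp add: sums_def)
qed

end

end

theorem mainTheorem9:
  fixes M :: "'w measure"
    and X :: "real \<Rightarrow> 'w \<Rightarrow> 'n::finite"
    and Q :: "real^'n^'n"
    and lam :: "'n \<Rightarrow> real"
    and B :: "'n \<Rightarrow> real measure"
    and T S :: "nat \<Rightarrow> 'w \<Rightarrow> real"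
    and a w :: real
    and \<mu> :: "complex \<Rightarrow> nat \<Rightarrow> complex"
  assumes "prob_space M"
    and "0 < a" and "a < 1" and "0 \<le> w"
    and "\<And>i. 0 < lam i"
    and "\<And>i. service_law (B i)"
    and "ctmc M X Q"
    and "modulated_poisson_arrivals M X lam T"
    and "modulated_services M X T B S"
    and "\<And>\<eta>. enumerates_zeros Q lam \<eta> (\<mu> \<eta>)"
  shows "\<forall>r \<eta>. cmod r < 1 \<and> 0 \<le> Re \<eta> \<longrightarrow>
    (\<exists>C :: nat \<Rightarrow> complex^'n. \<forall>s. 0 \<le> Re s \<and>
        (\<forall>n. of_real a ^ n * s \<notin> \<mu> \<eta> ` {1..CARD('n)}) \<longrightarrow>
        Zvec M X T S a w r s \<eta> =
          Kmat Q lam B r s \<eta> *v Zvec M X T S a w r (of_real a * s) \<eta>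
          + Lvec (initial_vec M X) (\<mu> \<eta>) C w r s \<and>
        (\<lambda>n. ordered_prod (\<lambda>m. Kmat Q lam B r (of_real a ^ m * s) \<eta>) n
               *v Lvec (initial_vec M X) (\<mu> \<eta>) C w r (of_real a ^ n * s))
          sums Zvec M X T S a w r s \<eta>)"
proof (intro allI impI)
  fix r \<eta> assume r\<eta>: "cmod r < 1 \<and> 0 \<le> Re \<eta>"
  obtain P where P: "transition_semigroup P" "has_generator P Q"
    "\<And>t h j. 0 \<le> t \<Longrightarrow> 0 \<le> h \<Longrightarrow> AE \<omega> in M.
       real_cond_exp M (history M X t) (indicator {\<omega>\<in>space M. X (t + h) \<omega> = j}) \<omega> = P h $ X t \<omega> $ j"
    using assms(7) unfolding ctmc_def by blast
  have X: "\<And>t. 0 \<le> t \<Longrightarrow> X t \<in> measurable M (count_space UNIV)"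
    "\<And>\<omega> t. \<omega> \<in> space M \<Longrightarrow> 0 \<le> t \<Longrightarrow> \<forall>\<^sub>F u in at_right t. X u \<omega> = X t \<omega>"
    using assms(7) unfolding ctmc_def by blast+
  interpret M: prob_space M by (rule assms(1))
  interpret queue M X P Q lam B T S
    by unfold_locales (use assms P X in auto)
  obtain C where C: "\<And>s. 0 \<le> Re s \<Longrightarrow> s \<notin> \<mu> \<eta> ` {1..CARD('n)} \<Longrightarrow>
    Zvec M X T S a w r s \<eta> = Kmat Q lam B r s \<eta> *v Zvec M X T S a w r (of_real a * s) \<eta>
      + Lvec (initial_vec M X) (\<mu> \<eta>) C w r s"
    using functional_equation[OF assms(2-4) _ _ assms(10)] r\<eta> by blast
  show "\<exists>C :: nat \<Rightarrow> complex^'n. \<forall>s. 0 \<le> Re s \<and>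
        (\<forall>n. of_real a ^ n * s \<notin> \<mu> \<eta> ` {1..CARD('n)}) \<longrightarrow>
        Zvec M X T S a w r s \<eta> =
          Kmat Q lam B r s \<eta> *v Zvec M X T S a w r (of_real a * s) \<eta>
          + Lvec (initial_vec M X) (\<mu> \<eta>) C w r s \<and>
        (\<lambda>n. ordered_prod (\<lambda>m. Kmat Q lam B r (of_real a ^ m * s) \<eta>) n
               *v Lvec (initial_vec M X) (\<mu> \<eta>) C w r (of_real a ^ n * s))
          sums Zvec M X T S a w r s \<eta>"
  proof (intro exI[of _ C] allI impI conjI)
    fix s assume s: "0 \<le> Re s \<and> (\<forall>n. of_real a ^ n * s \<notin> \<mu> \<eta> ` {1..CARD('n)})"
    then have "of_real a ^ 0 * s \<notin> \<mu> \<eta> ` {1..CARD('n)}" by blast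
    then show "Zvec M X T S a w r s \<eta> = Kmat Q lam B r s \<eta> *v Zvec M X T S a w r (of_real a * s) \<eta>
          + Lvec (initial_vec M X) (\<mu> \<eta>) C w r s" using C s by simp
    show "(\<lambda>n. ordered_prod (\<lambda>m. Kmat Q lam B r (of_real a ^ m * s) \<eta>) n
               *v Lvec (initial_vec M X) (\<mu> \<eta>) C w r (of_real a ^ n * s))
          sums Zvec M X T S a w r s \<eta>"
      by (rule iterated_solution[OF assms(2-4) _ _ assms(10) _ _ C]) (use s r\<eta> in auto)
  qed
qed

end
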